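(* Assume the setup below with $0<d_n\le1$ for all $n$ and $d_n\ge C|n|^{-\zeta}$ for all $n\ne0$, for some constants $C>0$ and $\zeta<\tfrac12$. Then there exist constants $C'>0$ and $\gamma''>0$ such that for all $m\in\mathbb Z\setminus\{0\}$, $$\int_\Omega\Big(\sup_{t\in\mathbb R}\big|\langle\delta_m,e^{-itJ_\omega}\delta_0\rangle\big|\Big)\,d\mu(\omega)\le C'|m|^{\zeta/2}\exp\!\big(-\gamma''|m|^{1-2\zeta}\big).$$
   Context: Setup: $r:\mathbb R\to[0,\infty)$ is bounded, measurable, compactly supported, with $\int_{\mathbb R} r(x)\,dx=1$. $(d_n)_{n\in\mathbb Z}$ is a fixed sequence of positive reals and $r_n(x)=d_n^{-1}r(d_n^{-1}x)$. $c\in\ell^\infty(\mathbb Z)$ is real. $a\in\ell^\infty(\mathbb Z)$ is real with $a(n)\ge\delta>0$ for all $n$. $\Omega=\mathbb R^{\mathbb Z}$ and $\mu$ is the product probability measure $d\mu(\omega)=\prod_{n} r_n(\omega(n)-c(n))\,d\omega(n)$. $(J_\omega\phi)(n)=a(n)\phi(n+1)+a(n-1)\phi(n-1)+\omega(n)\phi(n)$ on $\ell^2(\mathbb Z)$. *)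

theory Defs
  imports "HOL-Probability.Probability"
begin

definition scaled_density :: "(real \<Rightarrow> real) \<Rightarrow> (int \<Rightarrow> real) \<Rightarrow> int \<Rightarrow> real \<Rightarrow> real" where
  "scaled_density r d n x = r (x / d n) / d n"

definition anderson_measure ::
  "(real \<Rightarrow> real) \<Rightarrow> (int \<Rightarrow> real) \<Rightarrow> (int \<Rightarrow> real) \<Rightarrow> (int \<Rightarrow> real) measure" where
  "anderson_measure r d c =
     (\<Pi>\<^sub>M n\<in>UNIV. density lborel (\<lambda>x. ennreal (scaled_density r d n (x - c n))))"

definition jacobi_op :: "(int \<Rightarrow> real) \<Rightarrow> (int \<Rightarrow> real) \<Rightarrow> (int \<Rightarrow> real) \<Rightarrow> int \<Rightarrow> real" where
  "jacobi_op a \<omega> \<psi> n = a n * \<psi> (n + 1) + a (n - 1) * \<psi> (n - 1) + \<omega> n * \<psi> n"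

definition delta_vec :: "int \<Rightarrow> int \<Rightarrow> real" where
  "delta_vec m n = (if n = m then 1 else 0)"

text \<open>The matrix element <delta_m, exp(-i t J_omega) delta_0>, given by the exponential
  series sum_k (-i t)^k / k! * <delta_m, J_omega^k delta_0>
  (J_omega is bounded for mu-almost every omega).\<close>
definition evolution_entry ::
  "(int \<Rightarrow> real) \<Rightarrow> (int \<Rightarrow> real) \<Rightarrow> real \<Rightarrow> int \<Rightarrow> complex" where
  "evolution_entry a \<omega> t m =
     (\<Sum>k. ((- \<i> * complex_of_real t) ^ k / of_nat (fact k)) *
            complex_of_real (((jacobi_op a \<omega>) ^^ k) (delta_vec 0) m))"

end

theory Submission
  imports Defs "HOL-Computational_Algebra.Fundamental_Theorem_Algebra"
begin

text \<open>Kunz--Souillard method. Truncate the operator to a box, expand the time evolution in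
  eigenvectors and put p = min 0 m, q = max 0 m. Averaging the eigenvector correlator over
  \<omega>(p) alone turns the sum over eigenvalues into an integral over the energy E, because each E is an
  eigenvalue for exactly one value of \<omega>(p), and the derivative of that value with respect to E is the
  inverse square of the normalised eigenvector at p. At fixed E the ratios of neighbouring eigenvector
  entries obey a Riccati recursion, so they form a Markov chain driven by the independent \<omega>(j), and the
  expectation of |\<phi>(q)/\<phi>(p)| becomes a product of transfer operators on L2 of the line: each is a
  unitary inversion followed by convolution with the density of \<omega>(j). A convolution fails
  to contract only slowly varying functions; these have little mass near the origin, and the inversion
  moves their mass there, so that the image is not slowly varying. Hence two consecutive steps contract
  by a factor 1 - \<kappa> d^2, and with d of order |m| to the power -\<zeta> the product over |m|/2 such pairs is
  exp (- \<gamma> |m|^(1 - 2 \<zeta>)). The first and the last density contribute the prefactor, and Fatou's lemma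
  removes the box.\<close>

section \<open>Spectral decomposition of finite Jacobi matrices\<close>

text \<open>Why L2: the correlator |phi(0) phi(m)| equals phi(p)^2 |phi(q)/phi(p)|. Spectral
  averaging consumes phi(p)^2 as a Jacobian and leaves the ratio to the first power. Its factors
  a/|z| are square roots of the Jacobian a^2/z^2 of the inversion, so L2 is the exponent for which
  the inversion is isometric. Why d^2: the loss of L2 mass in one convolution is an integrated
  variance, called \<open>deficit\<close>. A density bounded by S/d cannot concentrate on a scale
  much shorter than d, so a small deficit gives near invariance under a shift of order at least d.
  Leaving a fixed window takes at most about 1/d such shifts, and Cauchy-Schwarz squares this
  number. Why the power \<zeta>/2: the first density has squared norm at most S/d_p, the last one
  turns an L2 bound into a sup bound at the cost S/d_q. One of p, q is the site 0, so under the
  square root only d_m contributes a power of |m|. The supremum over t is uncountable; measurability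
  is established for boxes only, where continuity in t reduces it to rational t.\<close>

text \<open>The two recurrences subtract to a telescoping sum. Three uses explain the general ring:
  conjugate complex arguments give real roots, the limit of equal arguments gives simple roots, two
  distinct real roots give orthogonality.\<close>

lemma christoffel_darboux:
  fixes z w :: "'a::comm_ring_1" and A B x y :: "nat \<Rightarrow> 'a"
  assumes x0: "A 0 * x 1 = (z - B 0) * x 0"
    and xS: "\<And>i. A (Suc i) * x (Suc (Suc i)) = (z - B (Suc i)) * x (Suc i) - A i * x i"
    and y0: "A 0 * y 1 = (w - B 0) * y 0"
    and yS: "\<And>i. A (Suc i) * y (Suc (Suc i)) = (w - B (Suc i)) * y (Suc i) - A i * y i"
  shows "(z - w) * (\<Sum>i\<le>n. x i * y i) = A n * (x (Suc n) * y n - x n * y (Suc n))"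
proof (induction n)
  case 0
  have "A 0 * (x (Suc 0) * y 0 - x 0 * y (Suc 0)) = (A 0 * x 1) * y 0 - x 0 * (A 0 * y 1)"
    by (simp add: algebra_simps)
  also have "\<dots> = ((z - B 0) * x 0) * y 0 - x 0 * ((w - B 0) * y 0)" by (simp only: x0 y0)
  finally show ?case by (simp add: algebra_simps)
next
  case (Suc n)
  have "A (Suc n) * (x (Suc (Suc n)) * y (Suc n) - x (Suc n) * y (Suc (Suc n))) =
      (A (Suc n) * x (Suc (Suc n))) * y (Suc n) - x (Suc n) * (A (Suc n) * y (Suc (Suc n)))"
    by (simp add: algebra_simps)
  also have "\<dots> = (z - w) * (x (Suc n) * y (Suc n)) + A n * (x (Suc n) * y n - x n * y (Suc n))"
    by (simp only: xS yS) (simp add: algebra_simps)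
  finally show ?case by (simp only: sum.atMost_Suc distrib_left Suc.IH add.commute)
qed

text \<open>The orthonormal polynomials of the Jacobi matrix: their values at \<open>x\<close> solve
  the eigenvalue recurrence at energy \<open>x\<close> with first entry 1. Hence the roots of the
  polynomial of index \<open>Suc n\<close> are the eigenvalues of the leading block of size
  \<open>Suc n\<close>.\<close>

fun opoly :: "(nat \<Rightarrow> real) \<Rightarrow> (nat \<Rightarrow> real) \<Rightarrow> nat \<Rightarrow> real poly" where
  "opoly \<alpha> \<beta> 0 = 1"
| "opoly \<alpha> \<beta> (Suc 0) = smult (1 / \<alpha> 0) [:- \<beta> 0, 1:]"
| "opoly \<alpha> \<beta> (Suc (Suc k)) = smult (1 / \<alpha> (Suc k))
     ([:- \<beta> (Suc k), 1:] * opoly \<alpha> \<beta> (Suc k) - smult (\<alpha> k) (opoly \<alpha> \<beta> k))"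

lemma opoly_degree:
  assumes "\<And>i. \<alpha> i > 0"
  shows "degree (opoly \<alpha> \<beta> k) = k \<and> opoly \<alpha> \<beta> k \<noteq> 0"
proof (induction k rule: less_induct)
  case (less k)
  show ?case
  proof -
    consider "k = 0" | "k = Suc 0" | j where "k = Suc (Suc j)" by (metis not0_implies_Suc)
    then show ?thesis
  proof cases
    case 1 then show ?thesis by simp
  next
    case 2 then show ?thesis using assms[of 0] by simp
  next
    case (3 j)
    have j: "degree (opoly \<alpha> \<beta> (Suc j)) = Suc j" "opoly \<alpha> \<beta> (Suc j) \<noteq> 0"
      "degree (opoly \<alpha> \<beta> j) = j" using less 3 by auto
    have d1: "degree ([:- \<beta> (Suc j), 1:] * opoly \<alpha> \<beta> (Suc j)) = Suc (Suc j)"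
      using j by (subst degree_mult_eq) auto
    have d2: "degree (smult (\<alpha> j) (opoly \<alpha> \<beta> j)) < Suc (Suc j)"
      using j(3) le_less_trans[OF degree_smult_le] by (metis less_Suc_eq)
    have "degree ([:- \<beta> (Suc j), 1:] * opoly \<alpha> \<beta> (Suc j) - smult (\<alpha> j) (opoly \<alpha> \<beta> j)) = Suc (Suc j)"
      using d1 d2 using degree_add_eq_left[of "- smult (\<alpha> j) (opoly \<alpha> \<beta> j)" "[:- \<beta> (Suc j), 1:] * opoly \<alpha> \<beta> (Suc j)"]
      by (simp del: mult_pCons_left)
    then have "degree (opoly \<alpha> \<beta> k) = k"
      using assms[of "Suc j"] 3 by (simp del: mult_pCons_left)
    then show ?thesis using 3 by (metis degree_0 nat.distinct(1))
  qed
  qed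
qed

lemma opoly_rec:
  assumes "\<And>i. \<alpha> i > 0"
  shows "\<alpha> 0 * poly (opoly \<alpha> \<beta> 1) x = (x - \<beta> 0) * poly (opoly \<alpha> \<beta> 0) x"
    "\<alpha> (Suc k) * poly (opoly \<alpha> \<beta> (Suc (Suc k))) x =
      (x - \<beta> (Suc k)) * poly (opoly \<alpha> \<beta> (Suc k)) x - \<alpha> k * poly (opoly \<alpha> \<beta> k) x"
  using assms[of 0] assms[of "Suc k"] by (auto simp: field_simps)

text \<open>Counting the roots uses the fundamental theorem of algebra, hence the passage to complex
  coefficients; afterwards all roots turn out to be real.\<close>

definition copoly where "copoly \<alpha> \<beta> k = map_poly complex_of_real (opoly \<alpha> \<beta> k)"

lemma poly_of_real_map: "poly (map_poly complex_of_real p) (of_real x) = of_real (poly p x)"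
  by (induction p) (auto simp: map_poly_pCons)

lemma poly_cnj_map: "poly (map_poly complex_of_real p) (cnj z) = cnj (poly (map_poly complex_of_real p) z)"
  by (induction p) (auto simp: map_poly_pCons)

lemma map_poly_of_real_hom:
  "map_poly complex_of_real (p - q) = map_poly of_real p - map_poly of_real q"
  "map_poly complex_of_real (smult c p) = smult (of_real c) (map_poly of_real p)"
  "map_poly complex_of_real ([:b, 1:] * p) = [:of_real b, 1:] * map_poly of_real p"
  by (auto intro!: poly_eqI simp: coeff_map_poly coeff_pCons split: nat.splits)

lemma copoly_rec:
  assumes "\<And>i. \<alpha> i > 0"
  shows "of_real (\<alpha> 0) * poly (copoly \<alpha> \<beta> 1) z = (z - of_real (\<beta> 0)) * poly (copoly \<alpha> \<beta> 0) z"
    "of_real (\<alpha> (Suc k)) * poly (copoly \<alpha> \<beta> (Suc (Suc k))) z =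
      (z - of_real (\<beta> (Suc k))) * poly (copoly \<alpha> \<beta> (Suc k)) z
       - of_real (\<alpha> k) * poly (copoly \<alpha> \<beta> k) z"
proof -
  show "of_real (\<alpha> 0) * poly (copoly \<alpha> \<beta> 1) z = (z - of_real (\<beta> 0)) * poly (copoly \<alpha> \<beta> 0) z"
    using assms[of 0] by (simp add: copoly_def map_poly_pCons field_simps)
  have "copoly \<alpha> \<beta> (Suc (Suc k)) = smult (of_real (1 / \<alpha> (Suc k)))
     ([:of_real (- \<beta> (Suc k)), 1:] * copoly \<alpha> \<beta> (Suc k) - smult (of_real (\<alpha> k)) (copoly \<alpha> \<beta> k))"
    by (simp only: copoly_def opoly.simps map_poly_of_real_hom)
  then show "of_real (\<alpha> (Suc k)) * poly (copoly \<alpha> \<beta> (Suc (Suc k))) z =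
      (z - of_real (\<beta> (Suc k))) * poly (copoly \<alpha> \<beta> (Suc k)) z
       - of_real (\<alpha> k) * poly (copoly \<alpha> \<beta> k) z"
    using assms[of "Suc k"] by (simp add: field_simps)
qed

text \<open>In Christoffel-Darboux at \<open>z\<close> and \<open>cnj z\<close> the right side
  vanishes, while the sum consists of squared moduli and contains the constant polynomial 1. So the
  factor \<open>z - cnj z\<close> must vanish.\<close>

lemma copoly_root_real:
  assumes pos: "\<And>i. \<alpha> i > 0" and root: "poly (copoly \<alpha> \<beta> (Suc n)) z = 0"
  shows "z \<in> \<real>"
proof -
  let ?q = "\<lambda>i z. poly (copoly \<alpha> \<beta> i) z"
  have root': "?q (Suc n) (cnj z) = 0" using root by (simp add: copoly_def poly_cnj_map)
  have "(z - cnj z) * (\<Sum>i\<le>n. ?q i z * ?q i (cnj z))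
     = of_real (\<alpha> n) * (?q (Suc n) z * ?q n (cnj z) - ?q n z * ?q (Suc n) (cnj z))"
    by (rule christoffel_darboux) (use copoly_rec[of \<alpha>, OF pos] in auto)
  also have "\<dots> = 0" using root root' by simp
  finally have eq: "(z - cnj z) * (\<Sum>i\<le>n. ?q i z * ?q i (cnj z)) = 0" .
  have "(\<Sum>i\<le>n. ?q i z * ?q i (cnj z)) = of_real (\<Sum>i\<le>n. (cmod (?q i z))\<^sup>2)"
    by (simp add: copoly_def poly_cnj_map complex_norm_square del: of_real_power)
  moreover have "(\<Sum>i\<le>n. (cmod (?q i z))\<^sup>2) > 0"
    by (rule sum_pos2[of _ 0]) (auto simp: copoly_def)
  ultimately have "(\<Sum>i\<le>n. ?q i z * ?q i (cnj z)) \<noteq> 0"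
    by (simp only: of_real_eq_0_iff less_imp_neq[symmetric] not_False_eq_True)
  with eq have "cnj z = z" by (simp only: mult_eq_0_iff simp_thms right_minus_eq)
  then show ?thesis by (simp only: Reals_cnj_iff)
qed

text \<open>Dividing Christoffel-Darboux by \<open>x - z\<close> and letting \<open>x\<close> tend
  to \<open>z\<close> expresses \<open>F z\<close> through the derivative at \<open>z\<close>. A
  double root would give \<open>F z = 0\<close>, but \<open>z\<close> is real and \<open>F z\<close>
  is then a sum of real squares including 1.\<close>

lemma copoly_root_simple:
  assumes pos: "\<And>i. \<alpha> i > 0" and root: "poly (copoly \<alpha> \<beta> (Suc n)) z = 0"
  shows "poly (pderiv (copoly \<alpha> \<beta> (Suc n))) z \<noteq> 0"
proof
  let ?Q = "copoly \<alpha> \<beta>"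
  let ?q = "\<lambda>i z. poly (copoly \<alpha> \<beta> i) z"
  assume d: "poly (pderiv (copoly \<alpha> \<beta> (Suc n))) z = 0"
  define F where "F x = (\<Sum>i\<le>n. ?q i x * ?q i z)" for x
  have CD: "(x - z) * F x = of_real (\<alpha> n) * ?q n z * ?q (Suc n) x" for x
  proof -
    have "(x - z) * F x = of_real (\<alpha> n) * (?q (Suc n) x * ?q n z - ?q n x * ?q (Suc n) z)"
      unfolding F_def by (rule christoffel_darboux) (use copoly_rec[of \<alpha>, OF pos] in auto)
    then show ?thesis using root by simp
  qed
  have 1: "((\<lambda>x. of_real (\<alpha> n) * ?q n z * ?q (Suc n) x) has_field_derivative
       of_real (\<alpha> n) * ?q n z * poly (pderiv (?Q (Suc n))) z) (at z)"
    by (intro DERIV_cmult poly_DERIV)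
  have "isCont F z" unfolding F_def by (intro continuous_intros)
  then have "F \<midarrow>z\<rightarrow> F z" by (simp add: isCont_def)
  moreover have "((\<lambda>x. (of_real (\<alpha> n) * ?q n z * ?q (Suc n) x - of_real (\<alpha> n) * ?q n z * ?q (Suc n) z) / (x - z)) \<longlongrightarrow> 0) (at z)"
    using 1 d unfolding has_field_derivative_iff by simp
  moreover have "\<forall>\<^sub>F x in at z. (of_real (\<alpha> n) * ?q n z * ?q (Suc n) x - of_real (\<alpha> n) * ?q n z * ?q (Suc n) z) / (x - z) = F x"
    unfolding eventually_at
  proof (intro exI[of _ 1] conjI ballI impI)
    fix x assume "x \<noteq> z \<and> dist x z < 1"
    then show "(of_real (\<alpha> n) * ?q n z * ?q (Suc n) x - of_real (\<alpha> n) * ?q n z * ?q (Suc n) z) / (x - z) = F x"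
      using CD[of x] root by (simp add: field_simps)
  qed simp
  ultimately have "F \<midarrow>z\<rightarrow> 0" using tendsto_cong by force
  with \<open>F \<midarrow>z\<rightarrow> F z\<close> have F0: "F z = 0" using LIM_unique by blast
  have "z \<in> \<real>" by (rule copoly_root_real[of \<alpha>, OF pos root])
  then obtain x where x: "z = of_real x" by (auto elim: Reals_cases)
  have "F z = of_real (\<Sum>i\<le>n. (poly (opoly \<alpha> \<beta> i) x)\<^sup>2)"
    by (simp add: F_def x copoly_def poly_of_real_map power2_eq_square)
  moreover have "(\<Sum>i\<le>n. (poly (opoly \<alpha> \<beta> i) x)\<^sup>2) > 0"
    by (rule sum_pos2[of _ 0]) auto
  ultimately show False using F0 by (simp only: eq_commute[of 0] of_real_eq_0_iff less_irrefl)
qed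

text \<open>Since all complex roots are simple, their number is the degree; since they are real,
  none is lost on the real line.\<close>

lemma opoly_card_roots:
  assumes pos: "\<And>i. \<alpha> i > 0"
  shows "card {x. poly (opoly \<alpha> \<beta> (Suc n)) x = 0} = Suc n"
proof -
  let ?p = "copoly \<alpha> \<beta> (Suc n)"
  have sq: "rsquarefree ?p" unfolding rsquarefree_roots using copoly_root_simple[of \<alpha>, OF pos] by blast
  have deg: "degree ?p = Suc n"
    using opoly_degree[of \<alpha>, OF pos, of \<beta> "Suc n"] by (simp add: copoly_def degree_map_poly del: opoly.simps)
  then have p0: "?p \<noteq> 0" by auto
  have "degree ?p = degree (smult (lead_coeff ?p) (\<Prod>z|poly ?p z = 0. [:-z, 1:]))"
    using complex_poly_decompose_rsquarefree[OF sq] by simp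
  also have "\<dots> = card {z. poly ?p z = 0}"
    using p0 by (simp add: degree_prod_eq_sum_degree)
  also have "{z. poly ?p z = 0} = complex_of_real ` {x. poly (opoly \<alpha> \<beta> (Suc n)) x = 0}"
  proof (intro equalityI subsetI)
    fix z assume z: "z \<in> {z. poly ?p z = 0}"
    then have "z \<in> \<real>" using copoly_root_real[of \<alpha>, OF pos, of \<beta> n z] by simp
    then obtain x where "z = of_real x" by (auto elim: Reals_cases)
    then show "z \<in> complex_of_real ` {x. poly (opoly \<alpha> \<beta> (Suc n)) x = 0}"
      using z by (auto simp: copoly_def poly_of_real_map simp del: opoly.simps)
  qed (auto simp: copoly_def poly_of_real_map simp del: opoly.simps)
  also have "card \<dots> = card {x. poly (opoly \<alpha> \<beta> (Suc n)) x = 0}"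
    by (rule card_image) (auto simp: inj_on_def)
  finally show ?thesis using deg by simp
qed

text \<open>The residuals of the unit vectors after projection onto the rows have squared norms that sum to
  N - card \<Lambda> = 0.\<close>
lemma orthonormal_rows_imp_columns:
  fixes M :: "'a \<Rightarrow> nat \<Rightarrow> real"
  assumes fin: "finite \<Lambda>" and card: "card \<Lambda> = N"
    and orth: "\<And>l k. l \<in> \<Lambda> \<Longrightarrow> k \<in> \<Lambda> \<Longrightarrow> (\<Sum>i<N. M l i * M k i) = (if l = k then 1 else 0)"
    and "i < N" "j < N"
  shows "(\<Sum>l\<in>\<Lambda>. M l i * M l j) = (if i = j then 1 else 0)"
proof -
  define e where "e i j = (if i = j then 1 else 0 :: real)" for i j :: nat
  define res where "res i j = e i j - (\<Sum>l\<in>\<Lambda>. M l i * M l j)" for i j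
  have sq: "(\<Sum>j<N. (res i j)\<^sup>2) = 1 - (\<Sum>l\<in>\<Lambda>. (M l i)\<^sup>2)" if i: "i < N" for i
  proof -
    have ee: "(\<Sum>j<N. (e i j)\<^sup>2) = 1"
    proof -
      have "(\<Sum>j<N. (e i j)\<^sup>2) = (\<Sum>j<N. if i = j then 1 else 0)" by (intro sum.cong) (auto simp: e_def)
      then show ?thesis using i by simp
    qed
    have em: "(\<Sum>j<N. e i j * (\<Sum>l\<in>\<Lambda>. M l i * M l j)) = (\<Sum>l\<in>\<Lambda>. (M l i)\<^sup>2)"
    proof -
      have "(\<Sum>j<N. e i j * (\<Sum>l\<in>\<Lambda>. M l i * M l j)) = (\<Sum>j<N. if i = j then (\<Sum>l\<in>\<Lambda>. M l i * M l j) else 0)"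
        by (intro sum.cong) (auto simp: e_def)
      then show ?thesis using i by (simp add: power2_eq_square)
    qed
    have "(\<Sum>j<N. (\<Sum>l\<in>\<Lambda>. M l i * M l j)\<^sup>2) = (\<Sum>j<N. \<Sum>l\<in>\<Lambda>. \<Sum>k\<in>\<Lambda>. (M l i * M k i) * (M l j * M k j))"
      by (simp add: power2_eq_square sum_product mult.assoc mult.left_commute)
    also have "\<dots> = (\<Sum>l\<in>\<Lambda>. \<Sum>j<N. \<Sum>k\<in>\<Lambda>. (M l i * M k i) * (M l j * M k j))"
      by (rule sum.swap)
    also have "\<dots> = (\<Sum>l\<in>\<Lambda>. \<Sum>k\<in>\<Lambda>. \<Sum>j<N. (M l i * M k i) * (M l j * M k j))"
      by (intro sum.cong refl sum.swap)
    also have "\<dots> = (\<Sum>l\<in>\<Lambda>. \<Sum>k\<in>\<Lambda>. if l = k then M l i * M k i else 0)"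
      by (intro sum.cong refl) (simp add: orth flip: sum_distrib_left)
    also have "\<dots> = (\<Sum>l\<in>\<Lambda>. (M l i)\<^sup>2)" using fin by (simp add: power2_eq_square)
    finally have mm: "(\<Sum>j<N. (\<Sum>l\<in>\<Lambda>. M l i * M l j)\<^sup>2) = (\<Sum>l\<in>\<Lambda>. (M l i)\<^sup>2)" .
    have "(\<Sum>j<N. (res i j)\<^sup>2) = (\<Sum>j<N. (e i j)\<^sup>2 - 2 * (e i j * (\<Sum>l\<in>\<Lambda>. M l i * M l j)) + (\<Sum>l\<in>\<Lambda>. M l i * M l j)\<^sup>2)"
      by (intro sum.cong refl) (simp add: res_def power2_diff mult.assoc)
    also have "\<dots> = 1 - 2 * (\<Sum>l\<in>\<Lambda>. (M l i)\<^sup>2) + (\<Sum>l\<in>\<Lambda>. (M l i)\<^sup>2)"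
      by (simp only: sum.distrib sum_subtractf ee em mm flip: sum_distrib_left)
    finally show ?thesis by simp
  qed
  have "(\<Sum>i<N. \<Sum>j<N. (res i j)\<^sup>2) = (\<Sum>i<N. 1 - (\<Sum>l\<in>\<Lambda>. (M l i)\<^sup>2))"
    by (intro sum.cong) (auto simp: sq)
  also have "\<dots> = real N - (\<Sum>i<N. \<Sum>l\<in>\<Lambda>. (M l i)\<^sup>2)" by (simp add: sum_subtractf)
  also have "(\<Sum>i<N. \<Sum>l\<in>\<Lambda>. (M l i)\<^sup>2) = (\<Sum>l\<in>\<Lambda>. \<Sum>i<N. (M l i)\<^sup>2)" by (rule sum.swap)
  also have "\<dots> = (\<Sum>l\<in>\<Lambda>. 1)" by (intro sum.cong refl) (use orth in \<open>simp add: power2_eq_square\<close>)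
  finally have "(\<Sum>i<N. \<Sum>j<N. (res i j)\<^sup>2) = 0" using card by simp
  then have "(\<Sum>j<N. (res i j)\<^sup>2) = 0"
    using \<open>i < N\<close> by (subst (asm) sum_nonneg_eq_0_iff) (auto intro: sum_nonneg)
  then have "(res i j)\<^sup>2 = 0"
    using \<open>j < N\<close> by (subst (asm) sum_nonneg_eq_0_iff) auto
  then show ?thesis by (simp add: res_def e_def)
qed

text \<open>The eigenvectors are the normalised value vectors of \<open>opoly\<close> at the roots
  of index \<open>Suc n\<close>; being a root is the boundary condition behind the last row.
  Christoffel-Darboux makes them orthogonal, and as there are \<open>Suc n\<close> of them,
  completeness follows by counting.\<close>

lemma jacobi_matrix_spectral:
  fixes \<alpha> \<beta> :: "nat \<Rightarrow> real"
  assumes pos: "\<And>i. \<alpha> i > 0"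
  obtains \<Lambda> :: "real set" and v where "finite \<Lambda>"
    "\<And>l i. l \<in> \<Lambda> \<Longrightarrow> i \<ge> Suc n \<Longrightarrow> v l i = 0"
    "\<And>l. l \<in> \<Lambda> \<Longrightarrow> \<alpha> 0 * v l 1 + \<beta> 0 * v l 0 = l * v l 0"
    "\<And>l i. l \<in> \<Lambda> \<Longrightarrow> Suc i \<le> n \<Longrightarrow>
       \<alpha> (Suc i) * v l (Suc (Suc i)) + \<alpha> i * v l i + \<beta> (Suc i) * v l (Suc i) = l * v l (Suc i)"
    "\<And>l. l \<in> \<Lambda> \<Longrightarrow> (\<Sum>i\<le>n. (v l i)\<^sup>2) = 1"
    "\<And>i j. i \<le> n \<Longrightarrow> j \<le> n \<Longrightarrow> (\<Sum>l\<in>\<Lambda>. v l i * v l j) = (if i = j then 1 else 0)"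
proof -
  let ?p = "\<lambda>i x. poly (opoly \<alpha> \<beta> i) x"
  define \<Lambda> where "\<Lambda> = {x. ?p (Suc n) x = 0}"
  define nm where "nm l = (\<Sum>i\<le>n. (?p i l)\<^sup>2)" for l
  define v where "v l i = (if i \<le> n then ?p i l / sqrt (nm l) else 0)" for l i
  have card: "card \<Lambda> = Suc n" unfolding \<Lambda>_def by (rule opoly_card_roots[of \<alpha>, OF pos])
  then have fin: "finite \<Lambda>" using card.infinite by fastforce
  have nm: "nm l > 0" for l unfolding nm_def by (rule sum_pos2[of _ 0]) auto
  \<comment> \<open>The index \<open>Suc n\<close> is included: there \<open>v\<close> is cut off to
    0, and the polynomial vanishes because \<open>l\<close> is a root. This lets the recurrence be
    used unchanged in the last row.\<close>
  have vp: "v l i * sqrt (nm l) = ?p i l" if "i \<le> Suc n" "l \<in> \<Lambda>" for l i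
  proof (cases "i \<le> n")
    case True then show ?thesis using nm[of l] by (simp add: v_def)
  next
    case False then have "i = Suc n" using that by simp
    then show ?thesis using that by (simp add: v_def \<Lambda>_def)
  qed
  have norm1: "(\<Sum>i\<le>n. (v l i)\<^sup>2) = 1" for l
  proof -
    have "(\<Sum>i\<le>n. (v l i)\<^sup>2) = (\<Sum>i\<le>n. (?p i l)\<^sup>2 / nm l)"
      by (rule sum.cong) (use nm[of l] in \<open>auto simp: v_def power_divide\<close>)
    also have "\<dots> = nm l / nm l" unfolding nm_def by (rule sum_divide_distrib[symmetric])
    finally show ?thesis using nm[of l] by simp
  qed
  have orth: "(\<Sum>i<Suc n. v l i * v k i) = (if l = k then 1 else 0)" if lk: "l \<in> \<Lambda>" "k \<in> \<Lambda>" for l k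
  proof (cases "l = k")
    case True then show ?thesis using norm1[of k]
      by (simp add: lessThan_Suc_atMost power2_eq_square)
  next
    case False
    have "(l - k) * (\<Sum>i\<le>n. ?p i l * ?p i k) = \<alpha> n * (?p (Suc n) l * ?p n k - ?p n l * ?p (Suc n) k)"
      by (rule christoffel_darboux) (use opoly_rec[of \<alpha>, OF pos] in \<open>auto simp del: opoly.simps\<close>)
    also have "\<dots> = 0" using lk by (simp add: \<Lambda>_def)
    finally have 0: "(\<Sum>i\<le>n. ?p i l * ?p i k) = 0" using False by simp
    have "(\<Sum>i<Suc n. v l i * v k i) = (\<Sum>i\<le>n. ?p i l * ?p i k / (sqrt (nm l) * sqrt (nm k)))"
      unfolding lessThan_Suc_atMost by (rule sum.cong) (auto simp: v_def)
    also have "\<dots> = 0" using 0 by (simp flip: sum_divide_distrib)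
    finally show ?thesis using False by simp
  qed
  show ?thesis
  proof (rule that[of \<Lambda> v])
    show "finite \<Lambda>" by fact
    show "v l i = 0" if "l \<in> \<Lambda>" "i \<ge> Suc n" for l i using that by (simp add: v_def)
    show "\<alpha> 0 * v l 1 + \<beta> 0 * v l 0 = l * v l 0" if l: "l \<in> \<Lambda>" for l
    proof -
      have "(\<alpha> 0 * v l 1 + \<beta> 0 * v l 0 - l * v l 0) * sqrt (nm l) =
        \<alpha> 0 * (v l 1 * sqrt (nm l)) + \<beta> 0 * (v l 0 * sqrt (nm l)) - l * (v l 0 * sqrt (nm l))"
        by (simp add: algebra_simps)
      also have "\<dots> = \<alpha> 0 * ?p 1 l + \<beta> 0 * ?p 0 l - l * ?p 0 l"
        using vp[of 1 l] vp[of 0 l] l by (simp only: le_add1 plus_1_eq_Suc le0 le_refl Suc_le_mono)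
      also have "\<dots> = 0" unfolding opoly_rec(1)[of \<alpha>, OF pos] by (simp add: algebra_simps)
      finally have "(\<alpha> 0 * v l 1 + \<beta> 0 * v l 0 - l * v l 0) * sqrt (nm l) = 0" .
      then show ?thesis using nm[of l] by simp
    qed
    show "\<alpha> (Suc i) * v l (Suc (Suc i)) + \<alpha> i * v l i + \<beta> (Suc i) * v l (Suc i) = l * v l (Suc i)"
      if l: "l \<in> \<Lambda>" and i: "Suc i \<le> n" for l i
    proof -
      have "(\<alpha> (Suc i) * v l (Suc (Suc i)) + \<alpha> i * v l i + \<beta> (Suc i) * v l (Suc i) - l * v l (Suc i)) * sqrt (nm l)
        = \<alpha> (Suc i) * (v l (Suc (Suc i)) * sqrt (nm l)) + \<alpha> i * (v l i * sqrt (nm l))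
          + \<beta> (Suc i) * (v l (Suc i) * sqrt (nm l)) - l * (v l (Suc i) * sqrt (nm l))"
        by (simp add: algebra_simps)
      also have "\<dots> = \<alpha> (Suc i) * ?p (Suc (Suc i)) l + \<alpha> i * ?p i l + \<beta> (Suc i) * ?p (Suc i) l - l * ?p (Suc i) l"
        using vp[of "Suc (Suc i)" l] vp[of "Suc i" l] vp[of i l] l i by (simp del: opoly.simps)
      also have "\<dots> = 0" unfolding opoly_rec(2)[of \<alpha>, OF pos] by (simp add: algebra_simps del: opoly.simps)
      finally show ?thesis using nm[of l] by simp
    qed
    show "(\<Sum>i\<le>n. (v l i)\<^sup>2) = 1" for l by (rule norm1)
    show "(\<Sum>l\<in>\<Lambda>. v l i * v l j) = (if i = j then 1 else 0)" if "i \<le> n" "j \<le> n" for i j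
      by (rule orthonormal_rows_imp_columns[OF fin card orth]) (use that in auto)
  qed
qed

section \<open>Riccati recursion and spectral averaging\<close>

text \<open>For a solution \<psi> of the three-term recurrence started at 0, ric k E = E - \<alpha> (k-1) \<psi> (k-1) / \<psi> k.
  When some \<psi> i vanishes the division yields a junk value; \<open>regular\<close> excludes these finitely many E.\<close>
fun ric :: "(nat \<Rightarrow> real) \<Rightarrow> (nat \<Rightarrow> real) \<Rightarrow> nat \<Rightarrow> real \<Rightarrow> real" where
  "ric \<alpha> \<beta> 0 E = E"
| "ric \<alpha> \<beta> (Suc k) E = E - (\<alpha> k)\<^sup>2 / (ric \<alpha> \<beta> k E - \<beta> k)"

text \<open>The derivative of \<open>ric\<close> in the energy. Along a solution it is the sum of
  squared ratios of entries, which is how the normalisation of eigenvectors enters.\<close>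

fun dric :: "(nat \<Rightarrow> real) \<Rightarrow> (nat \<Rightarrow> real) \<Rightarrow> nat \<Rightarrow> real \<Rightarrow> real" where
  "dric \<alpha> \<beta> 0 E = 1"
| "dric \<alpha> \<beta> (Suc k) E = 1 + (\<alpha> k)\<^sup>2 / (ric \<alpha> \<beta> k E - \<beta> k)\<^sup>2 * dric \<alpha> \<beta> k E"

definition regular :: "(nat \<Rightarrow> real) \<Rightarrow> (nat \<Rightarrow> real) \<Rightarrow> nat \<Rightarrow> real \<Rightarrow> bool" where
  "regular \<alpha> \<beta> k E \<longleftrightarrow> (\<forall>i<k. ric \<alpha> \<beta> i E \<noteq> \<beta> i)"

lemma dric_ge_1: "dric \<alpha> \<beta> k E \<ge> 1"
proof (induction k)
  case (Suc k)
  then have "dric \<alpha> \<beta> k E \<ge> 0" by simp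
  then show ?case by simp
qed simp

lemma ric_has_derivative:
  "regular \<alpha> \<beta> k E \<Longrightarrow> (ric \<alpha> \<beta> k has_real_derivative dric \<alpha> \<beta> k E) (at E)"
proof (induction k)
  case 0
  have "ric \<alpha> \<beta> 0 = (\<lambda>E. E)" by auto
  then show ?case by simp
next
  case (Suc k)
  then have 1: "(ric \<alpha> \<beta> k has_real_derivative dric \<alpha> \<beta> k E) (at E)" and nz: "ric \<alpha> \<beta> k E - \<beta> k \<noteq> 0"
    by (auto simp: regular_def)
  have eq: "ric \<alpha> \<beta> (Suc k) = (\<lambda>E. E - (\<alpha> k)\<^sup>2 / (ric \<alpha> \<beta> k E - \<beta> k))" by auto
  show ?case unfolding eq
    by (rule derivative_eq_intros 1 refl nz)+ (use nz in \<open>auto simp: field_simps power2_eq_square\<close>)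
qed

text \<open>Only the equations at indices below \<open>k\<close> are assumed. In the application
  \<open>k\<close> is the site p, whose potential value varies and must not occur in these
  formulas.\<close>

lemma regular_solution:
  fixes \<psi> :: "nat \<Rightarrow> real"
  assumes pos: "\<And>i. \<alpha> i > 0" and reg: "regular \<alpha> \<beta> k E" and nz: "\<psi> 0 \<noteq> 0"
    and r0: "k > 0 \<Longrightarrow> \<alpha> 0 * \<psi> 1 = (E - \<beta> 0) * \<psi> 0"
    and rS: "\<And>i. Suc i < k \<Longrightarrow> \<alpha> (Suc i) * \<psi> (Suc (Suc i)) = (E - \<beta> (Suc i)) * \<psi> (Suc i) - \<alpha> i * \<psi> i"
    and "i \<le> k"
  shows "\<psi> i \<noteq> 0" "i < k \<Longrightarrow> \<alpha> i * \<psi> (Suc i) = (ric \<alpha> \<beta> i E - \<beta> i) * \<psi> i"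
    "i > 0 \<Longrightarrow> ric \<alpha> \<beta> i E = E - \<alpha> (i-1) * \<psi> (i-1) / \<psi> i"
    "dric \<alpha> \<beta> i E = (\<Sum>j\<le>i. (\<psi> j / \<psi> i)\<^sup>2)"
proof -
  have "\<psi> i \<noteq> 0 \<and> (i < k \<longrightarrow> \<alpha> i * \<psi> (Suc i) = (ric \<alpha> \<beta> i E - \<beta> i) * \<psi> i) \<and>
    (i > 0 \<longrightarrow> ric \<alpha> \<beta> i E = E - \<alpha> (i-1) * \<psi> (i-1) / \<psi> i) \<and>
    dric \<alpha> \<beta> i E = (\<Sum>j\<le>i. (\<psi> j / \<psi> i)\<^sup>2)"
    using \<open>i \<le> k\<close>
  proof (induction i)
    case 0
    then show ?case using nz r0 by auto
  next
    case (Suc i)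
    then have IH: "\<psi> i \<noteq> 0" "\<alpha> i * \<psi> (Suc i) = (ric \<alpha> \<beta> i E - \<beta> i) * \<psi> i"
        "dric \<alpha> \<beta> i E = (\<Sum>j\<le>i. (\<psi> j / \<psi> i)\<^sup>2)" by auto
    have d: "ric \<alpha> \<beta> i E - \<beta> i \<noteq> 0" using reg Suc.prems by (auto simp: regular_def)
    have n1: "\<psi> (Suc i) \<noteq> 0" using IH d pos[of i] by auto
    have q: "\<alpha> i / (ric \<alpha> \<beta> i E - \<beta> i) = \<psi> i / \<psi> (Suc i)"
      using IH(2) d n1 by (simp add: field_simps)
    have e: "ric \<alpha> \<beta> (Suc i) E = E - \<alpha> i * \<psi> i / \<psi> (Suc i)"
      using q by (simp add: power2_eq_square flip: times_divide_eq_right)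
    have "dric \<alpha> \<beta> (Suc i) E = 1 + (\<psi> i / \<psi> (Suc i))\<^sup>2 * (\<Sum>j\<le>i. (\<psi> j / \<psi> i)\<^sup>2)"
      using IH(3) q by (simp flip: power_divide)
    also have "\<dots> = 1 + (\<Sum>j\<le>i. (\<psi> j / \<psi> (Suc i))\<^sup>2)"
      unfolding sum_distrib_left
      by (intro arg_cong2[where f = "(+)"] refl sum.cong)
        (use IH(1) in \<open>simp add: power_divide\<close>)
    also have "\<dots> = (\<Sum>j\<le>Suc i. (\<psi> j / \<psi> (Suc i))\<^sup>2)" using n1 by simp
    finally have f: "dric \<alpha> \<beta> (Suc i) E = (\<Sum>j\<le>Suc i. (\<psi> j / \<psi> (Suc i))\<^sup>2)" .
    have g: "\<alpha> (Suc i) * \<psi> (Suc (Suc i)) = (ric \<alpha> \<beta> (Suc i) E - \<beta> (Suc i)) * \<psi> (Suc i)" if "Suc i < k"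
      using rS[OF that] n1 e by (simp add: field_simps)
    show ?case using n1 e f g by auto
  qed
  then show "\<psi> i \<noteq> 0" "i < k \<Longrightarrow> \<alpha> i * \<psi> (Suc i) = (ric \<alpha> \<beta> i E - \<beta> i) * \<psi> i"
    "i > 0 \<Longrightarrow> ric \<alpha> \<beta> i E = E - \<alpha> (i-1) * \<psi> (i-1) / \<psi> i"
    "dric \<alpha> \<beta> i E = (\<Sum>j\<le>i. (\<psi> j / \<psi> i)\<^sup>2)" by auto
qed

text \<open>Regularity first fails at \<open>k\<close> exactly when the solution with first entry 1
  vanishes at the next index, so the new bad energies are roots of one nonzero polynomial.\<close>

lemma finite_not_regular:
  assumes pos: "\<And>i. \<alpha> i > 0"
  shows "finite {E. \<not> regular \<alpha> \<beta> k E}"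
proof (induction k)
  case 0
  then show ?case by (simp add: regular_def)
next
  case (Suc k)
  have "{E. \<not> regular \<alpha> \<beta> (Suc k) E} \<subseteq> {E. \<not> regular \<alpha> \<beta> k E} \<union> {x. poly (opoly \<alpha> \<beta> (Suc k)) x = 0}"
  proof (rule subsetI, rule ccontr)
    fix E assume "E \<in> {E. \<not> regular \<alpha> \<beta> (Suc k) E}"
      and contra: "E \<notin> {E. \<not> regular \<alpha> \<beta> k E} \<union> {x. poly (opoly \<alpha> \<beta> (Suc k)) x = 0}"
    then have a: "\<not> regular \<alpha> \<beta> (Suc k) E" "regular \<alpha> \<beta> k E" by auto
    then have eq: "ric \<alpha> \<beta> k E = \<beta> k" by (auto simp: regular_def less_Suc_eq)
    let ?\<psi> = "\<lambda>i. poly (opoly \<alpha> \<beta> i) E"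
    have "?\<psi> (Suc k) = 0"
    proof (cases k)
      case 0
      then show ?thesis using eq by simp
    next
      case (Suc j)
      have nz: "?\<psi> k \<noteq> 0"
        by (rule regular_solution(1)[of \<alpha>, OF pos a(2)]) (use opoly_rec[of \<alpha>, OF pos] in \<open>auto simp del: opoly.simps(2,3)\<close>)
      have "ric \<alpha> \<beta> k E = E - \<alpha> (k-1) * ?\<psi> (k-1) / ?\<psi> k"
        by (rule regular_solution(3)[of \<alpha>, OF pos a(2)]) (use opoly_rec[of \<alpha>, OF pos] Suc in \<open>auto simp del: opoly.simps(2,3)\<close>)
      then have "(E - \<beta> k) * ?\<psi> k - \<alpha> j * ?\<psi> j = 0" using eq nz Suc by (simp add: field_simps del: ric.simps opoly.simps)
      then have "\<alpha> k * ?\<psi> (Suc k) = 0"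
        using opoly_rec(2)[of \<alpha>, OF pos, of j \<beta> E] Suc by (simp del: opoly.simps)
      then show ?thesis using pos[of k] by (simp del: opoly.simps)
    qed
    with contra show False by simp
  qed
  moreover have "finite {x. poly (opoly \<alpha> \<beta> (Suc k)) x = 0}"
    by (rule poly_roots_finite) (use opoly_degree[of \<alpha>, OF pos] in blast)
  ultimately show ?case using Suc finite_subset by blast
qed

section \<open>Change of variables for piecewise increasing functions\<close>

text \<open>One half of the area formula. Between consecutive points of \<open>X\<close> the
  function is strictly increasing, so the change of variables theorem applies on each of these
  finitely many gaps. \<open>Q y\<close> is to be controlled by some set of preimages of
  \<open>y\<close>, and the finite set \<open>Y\<close> is null.\<close>

lemma nn_integral_preimage_sum_le:
  fixes \<Phi> \<Phi>' H :: "real \<Rightarrow> real" and Q :: "real \<Rightarrow> ennreal"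
  assumes X: "finite X" and der: "\<And>x. x \<notin> X \<Longrightarrow> (\<Phi> has_real_derivative \<Phi>' x) (at x)"
    and pos: "\<And>x. x \<notin> X \<Longrightarrow> \<Phi>' x > 0"
    and H[measurable]: "H \<in> borel_measurable borel" and H0: "\<And>x. H x \<ge> 0"
    and Y: "finite Y"
    and Q: "\<And>y. y \<notin> Y \<Longrightarrow> \<exists>\<Lambda>. finite \<Lambda> \<and> \<Lambda> \<inter> X = {} \<and> (\<forall>l\<in>\<Lambda>. \<Phi> l = y) \<and>
              Q y \<le> (\<Sum>l\<in>\<Lambda>. ennreal (H l / \<Phi>' l))"
  shows "(\<integral>\<^sup>+y. Q y \<partial>lborel) \<le> (\<integral>\<^sup>+x. ennreal (H x) \<partial>lborel)"
proof (cases "(\<integral>\<^sup>+x. ennreal (H x) \<partial>lborel) = \<infinity>")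
  case True
  then show ?thesis by simp
next
  case False
  \<comment> \<open>Having disposed of an infinite right side, \<open>H\<close> is integrable, as
    the change of variables theorem demands. That theorem speaks about the Lebesgue completion,
    hence the changes between \<open>lborel\<close> and \<open>lebesgue\<close>.\<close>
  have intH: "integrable lborel H"
    by (rule integrableI_nonneg) (use False H0 in \<open>auto simp: less_top\<close>)
  then have intHl: "integrable lebesgue H"
    using integrable_completion[of H lborel] by simp
  \<comment> \<open>The number of points of \<open>X\<close> to the left of \<open>x\<close> labels
    the gap containing \<open>x\<close>; the level sets \<open>S i\<close> are the gaps.\<close>
  define idx where "idx x = card {u \<in> X. u < x}" for x :: real
  define S where "S i = {x. x \<notin> X \<and> idx x = i}" for i
  define inv where "inv i = inv_into (S i) \<Phi>" for i
  define f where "f i y = H (inv i y) / \<Phi>' (inv i y)" for i y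
  have idx_eq: "real (idx x) = (\<Sum>u\<in>X. indicator {u<..} x)" for x
  proof -
    have "(\<Sum>u\<in>X. indicator {u<..} x :: real) = (\<Sum>u\<in>X. if u < x then 1 else 0)"
      by (intro sum.cong) (auto simp: indicator_def)
    also have "\<dots> = (\<Sum>u\<in>{u \<in> X. u < x}. 1)"
      by (rule sum.inter_filter[symmetric, OF X])
    finally show ?thesis by (simp add: idx_def)
  qed
  have meas_idx: "(\<lambda>x. real (idx x)) \<in> borel_measurable borel"
    unfolding idx_eq by measurable
  have S_eq: "S i = - X \<inter> {x. real (idx x) = real i}" for i by (auto simp: S_def)
  have S_borel: "S i \<in> sets borel" for i
    unfolding S_eq using X borel_measurable_eq[OF meas_idx, of "\<lambda>_. real i"]
    by (intro sets.Int borel_comp) (auto intro: borel_closed finite_imp_closed)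
  then have S_leb: "S i \<in> sets lebesgue" for i by simp
  have idx_le: "idx x \<le> card X" for x unfolding idx_def by (rule card_mono[OF X]) auto
  have inj: "inj_on \<Phi> (S i)" for i
  proof -
    have "\<Phi> x < \<Phi> y" if xy: "x \<in> S i" "y \<in> S i" "x < y" for x y
    proof (rule DERIV_pos_imp_increasing[OF \<open>x < y\<close>])
      fix z assume z: "x \<le> z" "z \<le> y"
      have "z \<notin> X"
      proof
        assume zX: "z \<in> X"
        then have "x < z" "z < y" using z xy zX unfolding S_def by (metis mem_Collect_eq order_le_less)+
        then have "{u \<in> X. u < x} \<subseteq> {u \<in> X. u < y}" "z \<in> {u \<in> X. u < y}" "z \<notin> {u \<in> X. u < x}"
          using zX by auto
        then have "{u \<in> X. u < x} \<subset> {u \<in> X. u < y}" by blast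
        then have "idx x < idx y" unfolding idx_def by (intro psubset_card_mono) (use X in auto)
        then show False using xy by (simp add: S_def)
      qed
      then show "\<exists>D. (\<Phi> has_real_derivative D) (at z) \<and> D > 0" using der pos by blast
    qed
    then show ?thesis by (intro linorder_inj_onI) (auto simp: less_imp_neq)
  qed
  have inv: "inv i (\<Phi> x) = x" if "x \<in> S i" for i x
    unfolding inv_def using inj that by simp
  have eqH: "\<bar>\<Phi>' x\<bar> * f i (\<Phi> x) = H x" if "x \<in> S i" for i x
    using inv[OF that] pos[of x] that by (simp add: f_def S_def)
  have HS: "H absolutely_integrable_on S i" for i
    unfolding set_integrable_def using integrable_mult_indicator[OF S_leb intHl] by simp
  have key: "f i absolutely_integrable_on (\<Phi> ` S i) \<and> integral (\<Phi> ` S i) (f i) = integral (S i) H" for i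
  proof -
    have "(\<lambda>x. \<bar>\<Phi>' x\<bar> * f i (\<Phi> x)) absolutely_integrable_on S i \<longleftrightarrow> H absolutely_integrable_on S i"
      by (rule set_integrable_cong) (use eqH in auto)
    moreover have "integral (S i) (\<lambda>x. \<bar>\<Phi>' x\<bar> * f i (\<Phi> x)) = integral (S i) H"
      by (rule integral_cong) (use eqH in auto)
    ultimately have "(\<lambda>x. \<bar>\<Phi>' x\<bar> * f i (\<Phi> x)) absolutely_integrable_on S i \<and>
       integral (S i) (\<lambda>x. \<bar>\<Phi>' x\<bar> * f i (\<Phi> x)) = integral (S i) H" using HS by simp
    then show ?thesis
      using has_absolute_integral_change_of_variables_1'[OF S_leb[of i] _ inj[of i], of \<Phi>' "f i" "integral (S i) H"]
        der by (auto simp: S_def intro: has_field_derivative_at_within)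
  qed
  define g where "g i y = indicator (\<Phi> ` S i) y * f i y" for i y
  have gint: "integrable lebesgue (g i)" for i
    using key[of i] unfolding set_integrable_def g_def by simp
  have g0: "g i y \<ge> 0" for i y
  proof (cases "y \<in> \<Phi> ` S i")
    case True
    then obtain x where "x \<in> S i" "y = \<Phi> x" by auto
    then show ?thesis using inv[of x i] H0[of x] pos[of x] by (simp add: g_def f_def S_def)
  qed (simp add: g_def)
  have gval: "(\<integral>\<^sup>+y. ennreal (g i y) \<partial>lebesgue) = (\<integral>\<^sup>+x. ennreal (indicator (S i) x * H x) \<partial>lebesgue)" for i
  proof -
    have "(\<integral>\<^sup>+y. ennreal (g i y) \<partial>lebesgue) = ennreal (integral\<^sup>L lebesgue (g i))"
      by (rule nn_integral_eq_integral[OF gint]) (use g0 in auto)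
    also have "integral\<^sup>L lebesgue (g i) = integral (\<Phi> ` S i) (f i)"
      using set_lebesgue_integral_eq_integral(2)[of "\<Phi> ` S i" "f i"] key[of i]
      by (simp add: set_lebesgue_integral_def g_def[abs_def])
    also have "\<dots> = integral (S i) H" using key by simp
    also have "\<dots> = integral\<^sup>L lebesgue (\<lambda>x. indicator (S i) x * H x)"
      using set_lebesgue_integral_eq_integral(2)[OF HS[of i]] by (simp add: set_lebesgue_integral_def)
    also have "ennreal \<dots> = (\<integral>\<^sup>+x. ennreal (indicator (S i) x * H x) \<partial>lebesgue)"
      by (rule nn_integral_eq_integral[symmetric])
        (use HS[of i] H0 in \<open>auto simp: set_integrable_def\<close>)
    finally show ?thesis .
  qed
  have AEY: "AE y in lebesgue. y \<notin> Y"
    by (rule AE_completion) (use Y in \<open>auto intro!: AE_not_in finite_imp_null_set_lborel\<close>)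
  have pw: "Q y \<le> (\<Sum>i\<le>card X. ennreal (g i y))" if "y \<notin> Y" for y
  proof -
    obtain \<Lambda> where L: "finite \<Lambda>" "\<Lambda> \<inter> X = {}" "\<And>l. l \<in> \<Lambda> \<Longrightarrow> \<Phi> l = y"
      "Q y \<le> (\<Sum>l\<in>\<Lambda>. ennreal (H l / \<Phi>' l))" using Q[OF \<open>y \<notin> Y\<close>] by blast
    \<comment> \<open>Grouping by gaps: by injectivity each gap holds at most one preimage of
      \<open>y\<close>.\<close>
    have "(\<Sum>l\<in>\<Lambda>. ennreal (H l / \<Phi>' l)) = (\<Sum>i\<le>card X. \<Sum>l\<in>{l\<in>\<Lambda>. idx l = i}. ennreal (H l / \<Phi>' l))"
      by (rule sum.group[symmetric]) (use L idx_le in auto)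
    also have "\<dots> \<le> (\<Sum>i\<le>card X. ennreal (g i y))"
    proof (rule sum_mono)
      fix i
      show "(\<Sum>l\<in>{l\<in>\<Lambda>. idx l = i}. ennreal (H l / \<Phi>' l)) \<le> ennreal (g i y)"
      proof (cases "{l\<in>\<Lambda>. idx l = i} = {}")
        case False
        then obtain l where l: "l \<in> \<Lambda>" "idx l = i" by auto
        then have lS: "l \<in> S i" using L by (auto simp: S_def)
        have "{l\<in>\<Lambda>. idx l = i} = {l}"
        proof (intro equalityI subsetI)
          fix k assume k: "k \<in> {l\<in>\<Lambda>. idx l = i}"
          then have "k \<in> S i" using L by (auto simp: S_def)
          moreover have "\<Phi> k = \<Phi> l" using k l L by auto
          ultimately show "k \<in> {l}" using inj[of i] lS by (auto simp: inj_on_def)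
        qed (use l in auto)
        moreover have "y \<in> \<Phi> ` S i" using lS L(3)[OF l(1)] by blast
        then have "g i y = H l / \<Phi>' l"
          using inv[OF lS] L(3)[OF l(1)] by (simp add: g_def f_def)
        ultimately show ?thesis by simp
      next
        case True
        show ?thesis by (simp only: True sum.empty zero_le)
      qed
    qed
    finally show ?thesis using L(4) by order
  qed
  have "(\<integral>\<^sup>+y. Q y \<partial>lborel) = (\<integral>\<^sup>+y. Q y \<partial>lebesgue)" by (simp add: nn_integral_completion)
  also have "\<dots> \<le> (\<integral>\<^sup>+y. (\<Sum>i\<le>card X. ennreal (g i y)) \<partial>lebesgue)"
    by (rule nn_integral_mono_AE) (use AEY pw in auto)
  also have "\<dots> = (\<Sum>i\<le>card X. \<integral>\<^sup>+y. ennreal (g i y) \<partial>lebesgue)"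
    by (rule nn_integral_sum) (use gint in auto)
  also have "\<dots> = (\<Sum>i\<le>card X. \<integral>\<^sup>+x. ennreal (indicator (S i) x * H x) \<partial>lebesgue)"
    by (simp only: gval)
  also have "\<dots> = (\<integral>\<^sup>+x. (\<Sum>i\<le>card X. ennreal (indicator (S i) x * H x)) \<partial>lebesgue)"
    by (rule nn_integral_sum[symmetric]) (use HS in \<open>auto simp: set_integrable_def\<close>)
  also have "\<dots> \<le> (\<integral>\<^sup>+x. ennreal (H x) \<partial>lebesgue)"
  proof (rule nn_integral_mono)
    fix x
    have "(\<Sum>i\<le>card X. indicator (S i) x * H x) = (\<Sum>i\<le>card X. if idx x = i then indicator (- X) x * H x else 0)"
      by (intro sum.cong) (auto simp: S_def indicator_def)
    also have "\<dots> = indicator (- X) x * H x" using idx_le[of x] by simp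
    also have "\<dots> \<le> H x" using H0[of x] by (simp add: indicator_def)
    finally have "(\<Sum>i\<le>card X. indicator (S i) x * H x) \<le> H x" .
    then show "(\<Sum>i\<le>card X. ennreal (indicator (S i) x * H x)) \<le> ennreal (H x)"
      using H0[of x] by (subst sum_ennreal) (auto intro!: ennreal_leI)
  qed
  also have "\<dots> = (\<integral>\<^sup>+x. ennreal (H x) \<partial>lborel)" by (simp add: nn_integral_completion)
  finally show ?thesis .
qed

section \<open>Eigenfunction expansion in finite boxes\<close>

lemma jacobi_box_spectral:
  fixes a \<omega> :: "int \<Rightarrow> real" and L :: nat
  assumes pos: "\<And>n. a n > 0"
  obtains \<Lambda> :: "real set" and \<phi> :: "real \<Rightarrow> int \<Rightarrow> real" where "finite \<Lambda>"
    "\<And>l n. l \<in> \<Lambda> \<Longrightarrow> \<bar>n\<bar> > int L \<Longrightarrow> \<phi> l n = 0"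
    "\<And>l n. l \<in> \<Lambda> \<Longrightarrow> \<bar>n\<bar> \<le> int L \<Longrightarrow> jacobi_op a \<omega> (\<phi> l) n = l * \<phi> l n"
    "\<And>l. l \<in> \<Lambda> \<Longrightarrow> (\<Sum>n=-int L..int L. (\<phi> l n)\<^sup>2) = 1"
    "\<And>m n. \<bar>m\<bar> \<le> int L \<Longrightarrow> \<bar>n\<bar> \<le> int L \<Longrightarrow> (\<Sum>l\<in>\<Lambda>. \<phi> l m * \<phi> l n) = (if m = n then 1 else 0)"
proof -
  define \<alpha> where "\<alpha> i = a (- int L + int i)" for i
  define \<beta> where "\<beta> i = \<omega> (- int L + int i)" for i
  have pos': "\<alpha> i > 0" for i using pos by (simp add: \<alpha>_def)
  obtain \<Lambda> :: "real set" and v where v: "finite \<Lambda>"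
    "\<And>l i. l \<in> \<Lambda> \<Longrightarrow> i \<ge> Suc (2 * L) \<Longrightarrow> v l i = 0"
    "\<And>l. l \<in> \<Lambda> \<Longrightarrow> \<alpha> 0 * v l 1 + \<beta> 0 * v l 0 = l * v l 0"
    "\<And>l i. l \<in> \<Lambda> \<Longrightarrow> Suc i \<le> 2 * L \<Longrightarrow>
       \<alpha> (Suc i) * v l (Suc (Suc i)) + \<alpha> i * v l i + \<beta> (Suc i) * v l (Suc i) = l * v l (Suc i)"
    "\<And>l. l \<in> \<Lambda> \<Longrightarrow> (\<Sum>i\<le>2 * L. (v l i)\<^sup>2) = 1"
    "\<And>i j. i \<le> 2 * L \<Longrightarrow> j \<le> 2 * L \<Longrightarrow> (\<Sum>l\<in>\<Lambda>. v l i * v l j) = (if i = j then 1 else 0)"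
    by (rule jacobi_matrix_spectral[where \<alpha> = \<alpha> and \<beta> = \<beta> and n = "2 * L", OF pos']) (rule that, assumption+)
  \<comment> \<open>The separate clause is essential to the left of the box: there
    \<open>nat\<close> would truncate to 0 and repeat the first entry.\<close>
  define \<phi> where "\<phi> l n = (if n < - int L then 0 else v l (nat (n + int L)))" for l n
  have \<phi>v: "\<phi> l (- int L + int i) = v l i" for l i by (simp add: \<phi>_def)
  show ?thesis
  proof (rule that[of \<Lambda> \<phi>])
    show "\<phi> l n = 0" if "l \<in> \<Lambda>" "\<bar>n\<bar> > int L" for l n
      using that v(2)[of l "nat (n + int L)"] by (auto simp: \<phi>_def)
    show "jacobi_op a \<omega> (\<phi> l) n = l * \<phi> l n" if l: "l \<in> \<Lambda>" and n: "\<bar>n\<bar> \<le> int L" for l n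
    proof (cases "nat (n + int L)")
      case 0
      then have n: "n = - int L" using n by linarith
      have "\<phi> l (n - 1) = 0" by (simp add: \<phi>_def n)
      moreover have "\<phi> l n = v l 0" "\<phi> l (n + 1) = v l 1" using \<phi>v[of l 0] \<phi>v[of l 1] by (simp_all add: n)
      ultimately show ?thesis using v(3)[OF l] by (simp add: jacobi_op_def \<alpha>_def \<beta>_def n)
    next
      case (Suc i)
      then have n': "n = - int L + int (Suc i)" "Suc i \<le> 2 * L" using n by linarith+
      have e: "n + 1 = - int L + int (Suc (Suc i))" "n - 1 = - int L + int i" using n' by simp_all
      have "\<phi> l n = v l (Suc i)" "\<phi> l (n+1) = v l (Suc (Suc i))" "\<phi> l (n-1) = v l i"
        unfolding e by (simp_all only: n'(1) \<phi>v)
      then show ?thesis using v(4)[OF l n'(2)]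
        by (simp add: jacobi_op_def \<alpha>_def \<beta>_def e(2)) (simp add: n')
    qed
    have bij: "bij_betw (\<lambda>i. - int L + int i) {..2 * L} {- int L..int L}"
      by (rule bij_betwI[where g = "\<lambda>n. nat (n + int L)"]) auto
    show "(\<Sum>n=-int L..int L. (\<phi> l n)\<^sup>2) = 1" if "l \<in> \<Lambda>" for l
    proof -
      have "(\<Sum>n=-int L..int L. (\<phi> l n)\<^sup>2) = (\<Sum>i\<le>2 * L. (v l i)\<^sup>2)"
        using sum.reindex_bij_betw[OF bij, of "\<lambda>n. (\<phi> l n)\<^sup>2", symmetric] by (simp only: \<phi>v)
      then show ?thesis using v(5)[OF that] by simp
    qed
    show "(\<Sum>l\<in>\<Lambda>. \<phi> l m * \<phi> l n) = (if m = n then 1 else 0)" if "\<bar>m\<bar> \<le> int L" "\<bar>n\<bar> \<le> int L" for m n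
    proof -
      have "(\<Sum>l\<in>\<Lambda>. \<phi> l m * \<phi> l n) = (\<Sum>l\<in>\<Lambda>. v l (nat (m + int L)) * v l (nat (n + int L)))"
        using that by (intro sum.cong) (auto simp: \<phi>_def)
      also have "\<dots> = (if nat (m + int L) = nat (n + int L) then 1 else 0)"
        by (rule v(6)) (use that in linarith)+
      finally show ?thesis using that by (auto simp: nat_eq_iff)
    qed
  qed (rule v(1))
qed

text \<open>The Dirichlet restriction to the box, kept as an operator on all functions on the
  integers so that its powers on \<open>delta_vec 0\<close> can be compared pointwise with those of
  \<open>jacobi_op\<close>.\<close>

definition box_op :: "nat \<Rightarrow> (int \<Rightarrow> real) \<Rightarrow> (int \<Rightarrow> real) \<Rightarrow> (int \<Rightarrow> real) \<Rightarrow> int \<Rightarrow> real" where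
  "box_op L a \<omega> \<psi> n = (if \<bar>n\<bar> \<le> int L then jacobi_op a \<omega> \<psi> n else 0)"

definition box_entry :: "(int \<Rightarrow> real) \<Rightarrow> (int \<Rightarrow> real) \<Rightarrow> nat \<Rightarrow> real \<Rightarrow> int \<Rightarrow> complex" where
  "box_entry a \<omega> L t m =
     (\<Sum>k. ((- \<i> * complex_of_real t) ^ k / of_nat (fact k)) *
            complex_of_real ((box_op L a \<omega> ^^ k) (delta_vec 0) m))"

definition box_eigen :: "nat \<Rightarrow> (int \<Rightarrow> real) \<Rightarrow> (int \<Rightarrow> real) \<Rightarrow> real \<Rightarrow> (int \<Rightarrow> real) \<Rightarrow> bool" where
  "box_eigen L a \<omega> E \<phi> \<longleftrightarrow> (\<forall>n. \<bar>n\<bar> > int L \<longrightarrow> \<phi> n = 0) \<and>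
     (\<forall>n. \<bar>n\<bar> \<le> int L \<longrightarrow> jacobi_op a \<omega> \<phi> n = E * \<phi> n)"

text \<open>Completeness writes \<open>delta_vec 0\<close> as a finite combination of eigenvectors,
  powers of the operator multiply the terms by powers of \<open>l\<close>, and the finite sum
  commutes with the exponential series.\<close>

lemma box_entry_expansion:
  assumes pos: "\<And>n. a n > 0"
  obtains \<Lambda> :: "real set" and \<phi> where "finite \<Lambda>"
    "\<And>l. l \<in> \<Lambda> \<Longrightarrow> box_eigen L a \<omega> l (\<phi> l)"
    "\<And>l. l \<in> \<Lambda> \<Longrightarrow> (\<Sum>n=-int L..int L. (\<phi> l n)\<^sup>2) = 1"
    "\<And>t m. box_entry a \<omega> L t m = (\<Sum>l\<in>\<Lambda>. of_real (\<phi> l 0 * \<phi> l m) * exp (- \<i> * of_real t * of_real l))"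
proof -
  obtain \<Lambda> :: "real set" and \<phi> :: "real \<Rightarrow> int \<Rightarrow> real" where fin: "finite \<Lambda>" and out: "\<And>l n. l \<in> \<Lambda> \<Longrightarrow> \<bar>n\<bar> > int L \<Longrightarrow> \<phi> l n = 0"
    and eig: "\<And>l n. l \<in> \<Lambda> \<Longrightarrow> \<bar>n\<bar> \<le> int L \<Longrightarrow> jacobi_op a \<omega> (\<phi> l) n = l * \<phi> l n"
    and norm: "\<And>l. l \<in> \<Lambda> \<Longrightarrow> (\<Sum>n=-int L..int L. (\<phi> l n)\<^sup>2) = 1"
    and compl: "\<And>m n. \<bar>m\<bar> \<le> int L \<Longrightarrow> \<bar>n\<bar> \<le> int L \<Longrightarrow> (\<Sum>l\<in>\<Lambda>. \<phi> l m * \<phi> l n) = (if m = n then 1 else 0)"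
    by (rule jacobi_box_spectral[where a = a and L = L and \<omega> = \<omega>, OF pos]) (rule that, assumption+)
  have pw: "(box_op L a \<omega> ^^ k) (delta_vec 0) m = (\<Sum>l\<in>\<Lambda>. l ^ k * (\<phi> l 0 * \<phi> l m))" for k m
  proof (induction k arbitrary: m)
    case 0
    show ?case
    proof (cases "\<bar>m\<bar> \<le> int L")
      case True
      then show ?thesis using compl[of 0 m] by (auto simp: delta_vec_def)
    next
      case False
      then show ?thesis using out[of _ m] by (auto simp: delta_vec_def)
    qed
  next
    case (Suc k)
    have IH: "(box_op L a \<omega> ^^ k) (delta_vec 0) = (\<lambda>m. \<Sum>l\<in>\<Lambda>. l ^ k * (\<phi> l 0 * \<phi> l m))"
      using Suc by blast
    show ?case
    proof (cases "\<bar>m\<bar> \<le> int L")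
      case True
      have "(box_op L a \<omega> ^^ Suc k) (delta_vec 0) m = jacobi_op a \<omega> (\<lambda>m. \<Sum>l\<in>\<Lambda>. l ^ k * (\<phi> l 0 * \<phi> l m)) m"
        using True by (simp add: IH box_op_def)
      also have "\<dots> = (\<Sum>l\<in>\<Lambda>. l ^ k * \<phi> l 0 * jacobi_op a \<omega> (\<phi> l) m)"
        by (simp add: jacobi_op_def sum_distrib_left sum.distrib algebra_simps)
      also have "\<dots> = (\<Sum>l\<in>\<Lambda>. l ^ Suc k * (\<phi> l 0 * \<phi> l m))"
        using eig True by (intro sum.cong) (auto simp: algebra_simps)
      finally show ?thesis .
    next
      case False
      then show ?thesis using out[of _ m] by (simp add: box_op_def)
    qed
  qed
  have ent: "box_entry a \<omega> L t m = (\<Sum>l\<in>\<Lambda>. of_real (\<phi> l 0 * \<phi> l m) * exp (- \<i> * of_real t * of_real l))" for t m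
  proof -
    have "(\<lambda>k. (- \<i> * of_real t * of_real l) ^ k /\<^sub>R fact k) sums exp (- \<i> * of_real t * of_real l :: complex)" for l
      by (rule exp_converges)
    then have "(\<lambda>k. of_real (\<phi> l 0 * \<phi> l m) * ((- \<i> * of_real t * of_real l) ^ k /\<^sub>R fact k)) sums
        (of_real (\<phi> l 0 * \<phi> l m) * exp (- \<i> * of_real t * of_real l :: complex))" for l
      by (rule sums_mult)
    then have S: "(\<lambda>k. \<Sum>l\<in>\<Lambda>. of_real (\<phi> l 0 * \<phi> l m) * ((- \<i> * of_real t * of_real l) ^ k /\<^sub>R fact k)) sums
        (\<Sum>l\<in>\<Lambda>. of_real (\<phi> l 0 * \<phi> l m) * exp (- \<i> * of_real t * of_real l :: complex))"
      by (rule sums_sum)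
    have eqn: "(\<lambda>k. \<Sum>l\<in>\<Lambda>. of_real (\<phi> l 0 * \<phi> l m) * ((- \<i> * of_real t * of_real l) ^ k /\<^sub>R fact k)) =
      (\<lambda>k. ((- \<i> * complex_of_real t) ^ k / of_nat (fact k)) *
            complex_of_real ((box_op L a \<omega> ^^ k) (delta_vec 0) m))"
    proof -
      have pm: "(- \<i> * of_real t * complex_of_real l) ^ k = (- \<i> * of_real t) ^ k * of_real l ^ k" for l k
        by (rule power_mult_distrib)
      have gen: "of_real c * ((z * of_real x ^ k) /\<^sub>R fact k) = (z / of_nat (fact k)) * complex_of_real (x ^ k * c)"
        for z :: complex and c x k by (simp add: scaleR_conv_of_real field_simps)
      show ?thesis unfolding pw of_real_sum sum_distrib_left
        by (intro ext sum.cong refl) (simp only: pm gen)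
    qed
    show ?thesis unfolding box_entry_def by (rule sums_unique[OF S[unfolded eqn], symmetric])
  qed
  show ?thesis
    by (rule that[of \<Lambda> \<phi>]) (use fin norm ent out eig in \<open>auto simp: box_eigen_def\<close>)
qed

text \<open>Time enters the expansion only through phases of modulus 1, so the eigenvector
  correlator dominates all times simultaneously.\<close>

lemma box_entry_bound:
  assumes pos: "\<And>n. a n > 0"
  obtains \<Lambda> :: "real set" and \<phi> where "finite \<Lambda>"
    "\<And>l. l \<in> \<Lambda> \<Longrightarrow> box_eigen L a \<omega> l (\<phi> l)"
    "\<And>l. l \<in> \<Lambda> \<Longrightarrow> (\<Sum>n=-int L..int L. (\<phi> l n)\<^sup>2) = 1"
    "\<And>t m. cmod (box_entry a \<omega> L t m) \<le> (\<Sum>l\<in>\<Lambda>. \<bar>\<phi> l 0 * \<phi> l m\<bar>)"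
proof -
  obtain \<Lambda> :: "real set" and \<phi> where *: "finite \<Lambda>"
    "\<And>l. l \<in> \<Lambda> \<Longrightarrow> box_eigen L a \<omega> l (\<phi> l)"
    "\<And>l. l \<in> \<Lambda> \<Longrightarrow> (\<Sum>n=-int L..int L. (\<phi> l n)\<^sup>2) = 1"
    "\<And>t m. box_entry a \<omega> L t m = (\<Sum>l\<in>\<Lambda>. of_real (\<phi> l 0 * \<phi> l m) * exp (- \<i> * of_real t * of_real l))"
    by (rule box_entry_expansion[where a = a and L = L and \<omega> = \<omega>, OF pos]) (rule that, assumption+)
  show ?thesis
  proof (rule that[of \<Lambda> \<phi>])
    fix t m
    have e: "cmod (exp (- \<i> * of_real t * of_real l)) = 1" for l
      by (simp add: norm_exp_eq_Re)
    show "cmod (box_entry a \<omega> L t m) \<le> (\<Sum>l\<in>\<Lambda>. \<bar>\<phi> l 0 * \<phi> l m\<bar>)"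
      unfolding *(4) by (rule order_trans[OF norm_sum]) (simp add: norm_mult e abs_mult)
  qed (use * in auto)
qed

text \<open>The Wronskian of the two eigenvectors vanishes on both sides of p.\<close>
lemma box_eigen_unique_site_value:
  assumes e1: "box_eigen L a (fun_upd \<omega> p y) E \<phi>" and e2: "box_eigen L a (fun_upd \<omega> p y') E \<psi>"
    and p: "\<bar>p\<bar> \<le> int L" and nz: "\<phi> p \<noteq> 0" "\<psi> p \<noteq> 0"
  shows "y = y'"
proof -
  define w where "w n = a n * (\<phi> (n + 1) * \<psi> n - \<phi> n * \<psi> (n + 1))" for n
  have step: "w n - w (n - 1) + ((fun_upd \<omega> p y) n - (fun_upd \<omega> p y') n) * \<phi> n * \<psi> n = 0" if "\<bar>n\<bar> \<le> int L" for n
  proof -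
    have "jacobi_op a (fun_upd \<omega> p y) \<phi> n * \<psi> n - \<phi> n * jacobi_op a (fun_upd \<omega> p y') \<psi> n = 0"
      using e1 e2 that by (simp add: box_eigen_def)
    then show ?thesis by (simp add: w_def jacobi_op_def algebra_simps)
  qed
  have top: "w n = 0" if "n \<le> int L" "n \<ge> p" for n
    using that
  proof (induction n rule: int_le_induct)
    case base
    then show ?case using e1 e2 by (simp add: w_def box_eigen_def)
  next
    case (step i)
    then show ?case using \<open>\<And>n. \<bar>n\<bar> \<le> int L \<Longrightarrow> _ n = 0\<close>[of i] p by auto
  qed
  have bot: "w n = 0" if "n \<ge> - int L - 1" "n \<le> p - 1" for n
    using that
  proof (induction n rule: int_ge_induct)
    case base
    then show ?case using e1 e2 by (simp add: w_def box_eigen_def)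
  next
    case (step i)
    then show ?case using \<open>\<And>n. \<bar>n\<bar> \<le> int L \<Longrightarrow> _ n = 0\<close>[of "i + 1"] p by auto
  qed
  have "(y - y') * \<phi> p * \<psi> p = 0" using step[OF p] top[of p] bot[of "p - 1"] p by auto
  then show ?thesis using nz by simp
qed

text \<open>The eigenvalue equation at an entry of maximal modulus, as for Gershgorin discs. It
  confines the later energy integral to a bounded window that does not depend on the box.\<close>

lemma box_eigen_bound:
  assumes e: "box_eigen L a \<omega> E \<phi>" and nz: "\<phi> p \<noteq> 0"
    and a: "\<And>n. \<bar>a n\<bar> \<le> A" and w: "\<And>n. \<bar>\<omega> n\<bar> \<le> b"
  shows "\<bar>E\<bar> \<le> 2 * A + b"
proof -
  let ?I = "{- int L..int L}"
  have "Max ((\<lambda>n. \<bar>\<phi> n\<bar>) ` ?I) \<in> (\<lambda>n. \<bar>\<phi> n\<bar>) ` ?I" by (rule Max_in) auto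
  then obtain m where mI: "m \<in> ?I" and m: "Max ((\<lambda>n. \<bar>\<phi> n\<bar>) ` ?I) = \<bar>\<phi> m\<bar>" by (elim imageE) blast
  have mx: "\<bar>\<phi> n\<bar> \<le> \<bar>\<phi> m\<bar>" for n
  proof (cases "n \<in> ?I")
    case True
    then show ?thesis unfolding m[symmetric] by (intro Max_ge) auto
  next
    case False
    then show ?thesis using e by (auto simp: box_eigen_def)
  qed
  have m0: "\<bar>\<phi> m\<bar> > 0" using mx[of p] nz by linarith
  have "E * \<phi> m = a m * \<phi> (m + 1) + a (m - 1) * \<phi> (m - 1) + \<omega> m * \<phi> m"
    using e mI by (auto simp: box_eigen_def jacobi_op_def)
  then have "\<bar>E * \<phi> m\<bar> \<le> \<bar>a m * \<phi> (m+1)\<bar> + \<bar>a (m-1) * \<phi> (m-1)\<bar> + \<bar>\<omega> m * \<phi> m\<bar>"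
    by linarith
  then have "\<bar>E\<bar> * \<bar>\<phi> m\<bar> \<le> \<bar>a m\<bar> * \<bar>\<phi> (m+1)\<bar> + \<bar>a (m-1)\<bar> * \<bar>\<phi> (m-1)\<bar> + \<bar>\<omega> m\<bar> * \<bar>\<phi> m\<bar>"
    by (simp only: abs_mult)
  also have "\<dots> \<le> A * \<bar>\<phi> m\<bar> + A * \<bar>\<phi> m\<bar> + b * \<bar>\<phi> m\<bar>"
    by (intro add_mono mult_mono mx a w) (use order_trans[OF abs_ge_zero a] order_trans[OF abs_ge_zero w] in auto)
  also have "\<dots> = (2 * A + b) * \<bar>\<phi> m\<bar>" by (simp add: algebra_simps)
  finally show ?thesis using m0 by simp
qed

section \<open>Riccati variables from both ends of the box\<close>

text \<open>The recursion started at the right end: index \<open>i\<close> is the site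
  \<open>L - i\<close>, and the coupling of this site to the next one on the left is
  \<open>a (L - i - 1)\<close>. Only sites strictly beyond \<open>j\<close> are read. For an
  eigenvector the value is \<open>E - a j * \<phi> (j + 1) / \<phi> j\<close>; \<open>zleft\<close>
  is the mirror image.\<close>

definition zright :: "nat \<Rightarrow> (int \<Rightarrow> real) \<Rightarrow> (int \<Rightarrow> real) \<Rightarrow> int \<Rightarrow> real \<Rightarrow> real" where
  "zright L a \<omega> j E = ric (\<lambda>i. a (int L - int i - 1)) (\<lambda>i. \<omega> (int L - int i)) (nat (int L - j)) E"

definition zleft :: "nat \<Rightarrow> (int \<Rightarrow> real) \<Rightarrow> (int \<Rightarrow> real) \<Rightarrow> int \<Rightarrow> real \<Rightarrow> real" where
  "zleft L a \<omega> j E = ric (\<lambda>i. a (- int L + int i)) (\<lambda>i. \<omega> (- int L + int i)) (nat (j + int L)) E"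

lemma ric_cong: "(\<And>i. i < k \<Longrightarrow> \<beta> i = \<beta>' i) \<Longrightarrow> ric \<alpha> \<beta> k E = ric \<alpha> \<beta>' k E"
  by (induction k) auto

lemma zright_rec: "j \<le> int L \<Longrightarrow> zright L a \<omega> (j - 1) E = E - (a (j - 1))\<^sup>2 / (zright L a \<omega> j E - \<omega> j)"
proof -
  assume j: "j \<le> int L"
  have "nat (int L - (j - 1)) = Suc (nat (int L - j))" using j by simp
  moreover have "int L - int (nat (int L - j)) = j" using j by simp
  ultimately show ?thesis by (simp add: zright_def)
qed

lemma zright_cong: "(\<And>i. i > j \<Longrightarrow> \<omega> i = \<omega>' i) \<Longrightarrow> zright L a \<omega> j E = zright L a \<omega>' j E"
  unfolding zright_def by (rule ric_cong) auto

lemma zleft_cong: "(\<And>i. i < j \<Longrightarrow> \<omega> i = \<omega>' i) \<Longrightarrow> zleft L a \<omega> j E = zleft L a \<omega>' j E"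
  unfolding zleft_def by (rule ric_cong) auto

text \<open>Used contrapositively: a nonzero entry at p forces a nonzero entry at either end of the
  box, where the recursions begin.\<close>

lemma zero_solution:
  fixes \<psi> :: "nat \<Rightarrow> real"
  assumes pos: "\<And>i. \<alpha> i > 0" and z: "\<psi> 0 = 0"
    and r0: "k > 0 \<Longrightarrow> \<alpha> 0 * \<psi> 1 = (E - \<beta> 0) * \<psi> 0"
    and rS: "\<And>i. Suc i < k \<Longrightarrow> \<alpha> (Suc i) * \<psi> (Suc (Suc i)) = (E - \<beta> (Suc i)) * \<psi> (Suc i) - \<alpha> i * \<psi> i"
    and "i \<le> k"
  shows "\<psi> i = 0"
  using \<open>i \<le> k\<close>
proof (induction i rule: less_induct)
  case (less i)
  consider "i = 0" | "i = 1" | j where "i = Suc (Suc j)" by (metis One_nat_def not0_implies_Suc)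
  then show ?case
  proof cases
    case 2
    then have "\<alpha> 0 * \<psi> 1 = 0" using r0 z less.prems by simp
    then show ?thesis using pos[of 0] 2 by simp
  next
    case (3 j)
    then have "\<alpha> (Suc j) * \<psi> (Suc (Suc j)) = 0" using rS[of j] less by simp
    then show ?thesis using pos[of "Suc j"] 3 by simp
  qed (use z in simp)
qed

text \<open>The value of \<omega>(p) for which E is an eigenvalue of the box.\<close>
definition site_energy :: "nat \<Rightarrow> (int \<Rightarrow> real) \<Rightarrow> (int \<Rightarrow> real) \<Rightarrow> int \<Rightarrow> real \<Rightarrow> real" where
  "site_energy L a \<omega> p E = zright L a \<omega> p E + zleft L a \<omega> p E - E"

text \<open>For an eigenvector each factor is the modulus of the ratio of the entries at
  \<open>j\<close> and \<open>j - 1\<close>, so the product telescopes to |phi(q)/phi(p)|. It reads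
  the potential only to the right of \<open>p\<close>.\<close>

definition decay :: "nat \<Rightarrow> (int \<Rightarrow> real) \<Rightarrow> (int \<Rightarrow> real) \<Rightarrow> int \<Rightarrow> int \<Rightarrow> real \<Rightarrow> real" where
  "decay L a \<omega> p q E = (\<Prod>j\<in>{p+1..q}. a (j - 1) / \<bar>zright L a \<omega> j E - \<omega> j\<bar>)"

text \<open>For an eigenvector this is its squared mass on the sites from \<open>j\<close> to the
  right end, relative to the squared entry at \<open>j\<close>; \<open>dleft\<close> is the mass
  from the left end up to \<open>j\<close>.\<close>

definition dright :: "nat \<Rightarrow> (int \<Rightarrow> real) \<Rightarrow> (int \<Rightarrow> real) \<Rightarrow> int \<Rightarrow> real \<Rightarrow> real" where
  "dright L a \<omega> j E = dric (\<lambda>i. a (int L - int i - 1)) (\<lambda>i. \<omega> (int L - int i)) (nat (int L - j)) E"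

definition dleft :: "nat \<Rightarrow> (int \<Rightarrow> real) \<Rightarrow> (int \<Rightarrow> real) \<Rightarrow> int \<Rightarrow> real \<Rightarrow> real" where
  "dleft L a \<omega> j E = dric (\<lambda>i. a (- int L + int i)) (\<lambda>i. \<omega> (- int L + int i)) (nat (j + int L)) E"

text \<open>The potential at \<open>p\<close> itself is not read, so the set of exceptional energies
  stays fixed while this value is averaged.\<close>

definition good_energy :: "nat \<Rightarrow> (int \<Rightarrow> real) \<Rightarrow> (int \<Rightarrow> real) \<Rightarrow> int \<Rightarrow> real \<Rightarrow> bool" where
  "good_energy L a \<omega> p E \<longleftrightarrow>
     regular (\<lambda>i. a (int L - int i - 1)) (\<lambda>i. \<omega> (int L - int i)) (nat (int L - p)) E \<and>
     regular (\<lambda>i. a (- int L + int i)) (\<lambda>i. \<omega> (- int L + int i)) (nat (p + int L)) E"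

lemma finite_bad_energy:
  assumes pos: "\<And>n. a n > 0"
  shows "finite {E. \<not> good_energy L a \<omega> p E}"
proof -
  have "{E. \<not> good_energy L a \<omega> p E} \<subseteq>
     {E. \<not> regular (\<lambda>i. a (int L - int i - 1)) (\<lambda>i. \<omega> (int L - int i)) (nat (int L - p)) E} \<union>
     {E. \<not> regular (\<lambda>i. a (- int L + int i)) (\<lambda>i. \<omega> (- int L + int i)) (nat (p + int L)) E}"
    by (auto simp: good_energy_def)
  moreover have "finite \<dots>" by (intro finite_UnI finite_not_regular pos)
  ultimately show ?thesis by (rule finite_subset)
qed

lemma site_energy_has_derivative:
  assumes "good_energy L a \<omega> p E"
  shows "(site_energy L a \<omega> p has_real_derivative (dright L a \<omega> p E + dleft L a \<omega> p E - 1)) (at E)"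
proof -
  have "(zright L a \<omega> p has_real_derivative dright L a \<omega> p E) (at E)"
    unfolding zright_def[abs_def] dright_def by (rule ric_has_derivative) (use assms in \<open>simp add: good_energy_def\<close>)
  moreover have "(zleft L a \<omega> p has_real_derivative dleft L a \<omega> p E) (at E)"
    unfolding zleft_def[abs_def] dleft_def by (rule ric_has_derivative) (use assms in \<open>simp add: good_energy_def\<close>)
  ultimately show ?thesis unfolding site_energy_def[abs_def]
    by (intro DERIV_diff DERIV_add DERIV_ident)
qed

lemma site_energy_deriv_pos: "dright L a \<omega> p E + dleft L a \<omega> p E - 1 > 0"
  using dric_ge_1[of "(\<lambda>i. a (int L - int i - 1))" "(\<lambda>i. \<omega> (int L - int i))" "nat (int L - p)" E]
    dric_ge_1[of "(\<lambda>i. a (- int L + int i))" "(\<lambda>i. \<omega> (- int L + int i))" "nat (p + int L)" E]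
  unfolding dright_def dleft_def by linarith

text \<open>The recursions from the two ends stop just before p and therefore see
  \<open>\<omega>\<close> rather than the updated value \<open>y\<close>. The equation at p then
  joins them and can be solved for \<open>y\<close>.\<close>

lemma box_eigen_riccati:
  assumes pos: "\<And>n. a n > 0" and e: "box_eigen L a (fun_upd \<omega> p y) E \<phi>"
    and p: "- int L \<le> p" "p < int L" and nz: "\<phi> p \<noteq> 0" and good: "good_energy L a \<omega> p E"
    and norm: "(\<Sum>n=-int L..int L. (\<phi> n)\<^sup>2) = 1"
    and q: "p \<le> q" "q \<le> int L"
  shows "site_energy L a \<omega> p E = y"
    "(\<phi> p)\<^sup>2 = 1 / (dright L a \<omega> p E + dleft L a \<omega> p E - 1)"
    "\<bar>\<phi> q\<bar> = \<bar>\<phi> p\<bar> * decay L a \<omega> p q E"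
proof -
  have out: "\<phi> n = 0" if "\<bar>n\<bar> > int L" for n using e that by (simp add: box_eigen_def)
  have eq: "a n * \<phi> (n + 1) + a (n - 1) * \<phi> (n - 1) + (fun_upd \<omega> p y) n * \<phi> n = E * \<phi> n" if "\<bar>n\<bar> \<le> int L" for n
    using e that by (simp add: box_eigen_def jacobi_op_def)
  define \<alpha> where "\<alpha> = (\<lambda>i::nat. a (int L - int i - 1))"
  define \<beta> where "\<beta> = (\<lambda>i::nat. \<omega> (int L - int i))"
  define \<psi> where "\<psi> = (\<lambda>i::nat. \<phi> (int L - int i))"
  define k where "k = nat (int L - p)"
  define \<alpha>' where "\<alpha>' = (\<lambda>i::nat. a (- int L + int i))"
  define \<beta>' where "\<beta>' = (\<lambda>i::nat. \<omega> (- int L + int i))"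
  define \<psi>' where "\<psi>' = (\<lambda>i::nat. \<phi> (- int L + int i))"
  define k' where "k' = nat (p + int L)"
  have al: "\<alpha> i > 0" "\<alpha>' i > 0" for i using pos by (auto simp: \<alpha>_def \<alpha>'_def)
  have kp: "int L - int k = p" "- int L + int k' = p" using p by (auto simp: k_def k'_def)
  have reg: "regular \<alpha> \<beta> k E" "regular \<alpha>' \<beta>' k' E"
    using good by (auto simp: good_energy_def \<alpha>_def \<beta>_def k_def \<alpha>'_def \<beta>'_def k'_def)
  have r0: "\<alpha> 0 * \<psi> 1 = (E - \<beta> 0) * \<psi> 0" if "k > 0"
    using eq[of "int L"] out[of "int L + 1"] that kp p by (auto simp: \<alpha>_def \<beta>_def \<psi>_def algebra_simps)
  have rS: "\<alpha> (Suc i) * \<psi> (Suc (Suc i)) = (E - \<beta> (Suc i)) * \<psi> (Suc i) - \<alpha> i * \<psi> i" if "Suc i < k" for i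
  proof -
    have "\<bar>int L - int (Suc i)\<bar> \<le> int L" "int L - int (Suc i) \<noteq> p" using that p by (auto simp: k_def)
    then show ?thesis using eq[of "int L - int (Suc i)"] by (simp add: \<alpha>_def \<beta>_def \<psi>_def algebra_simps)
  qed
  have r0': "\<alpha>' 0 * \<psi>' 1 = (E - \<beta>' 0) * \<psi>' 0" if "k' > 0"
    using eq[of "- int L"] out[of "- int L - 1"] that kp p by (auto simp: \<alpha>'_def \<beta>'_def \<psi>'_def algebra_simps)
  have rS': "\<alpha>' (Suc i) * \<psi>' (Suc (Suc i)) = (E - \<beta>' (Suc i)) * \<psi>' (Suc i) - \<alpha>' i * \<psi>' i" if "Suc i < k'" for i
  proof -
    have *: "\<bar>- int L + int (Suc i)\<bar> \<le> int L" "- int L + int (Suc i) \<noteq> p" using that p by (auto simp: k'_def)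
    then show ?thesis using eq[of "- int L + int (Suc i)"]
      by (simp add: \<alpha>'_def \<beta>'_def \<psi>'_def algebra_simps)
  qed
  have "\<psi> 0 \<noteq> 0"
  proof
    assume "\<psi> 0 = 0"
    then have "\<psi> k = 0" by (rule zero_solution[of \<alpha> \<psi> k E \<beta>, OF al(1) _ r0 rS]) auto
    then show False using nz kp by (simp add: \<psi>_def)
  qed
  note R = regular_solution[of \<alpha> \<beta> k E \<psi>, OF al(1) reg(1) \<open>\<psi> 0 \<noteq> 0\<close> r0 rS]
  have "\<psi>' 0 \<noteq> 0"
  proof
    assume "\<psi>' 0 = 0"
    then have "\<psi>' k' = 0" by (rule zero_solution[of \<alpha>' \<psi>' k' E \<beta>', OF al(2) _ r0' rS']) auto
    then show False using nz kp by (simp add: \<psi>'_def)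
  qed
  note R' = regular_solution[of \<alpha>' \<beta>' k' E \<psi>', OF al(2) reg(2) \<open>\<psi>' 0 \<noteq> 0\<close> r0' rS']
  have zr: "zright L a \<omega> p E = E - a p * \<phi> (p + 1) / \<phi> p"
  proof -
    have k0: "k > 0" using p by (simp add: k_def)
    have e1: "int L - int (k - 1) = p + 1" and e2: "int L - int (k - 1) - 1 = p" using kp k0 by linarith+
    have "\<alpha> (k - 1) = a p" by (simp only: \<alpha>_def e2)
    moreover have "\<psi> (k - 1) = \<phi> (p + 1)" "\<psi> k = \<phi> p" by (simp_all only: \<psi>_def e1 kp)
    moreover have "zright L a \<omega> p E = ric \<alpha> \<beta> k E" by (simp only: zright_def \<alpha>_def \<beta>_def k_def)
    ultimately show ?thesis using R(3)[of k] k0 by simp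
  qed
  have zl: "zleft L a \<omega> p E = E - a (p - 1) * \<phi> (p - 1) / \<phi> p"
  \<comment> \<open>If p is the left end, there is no recursion step on that side and the neighbour
    outside the box has entry 0.\<close>
  proof (cases "k' = 0")
    case True
    then have "p = - int L" using kp by simp
    then show ?thesis using out[of "p - 1"] by (simp add: zleft_def)
  next
    case False
    then have e1: "- int L + int (k' - 1) = p - 1" using kp by linarith
    have "\<alpha>' (k' - 1) = a (p - 1)" "\<psi>' (k' - 1) = \<phi> (p - 1)" "\<psi>' k' = \<phi> p"
      by (simp_all only: \<alpha>'_def \<psi>'_def e1 kp)
    moreover have "zleft L a \<omega> p E = ric \<alpha>' \<beta>' k' E" by (simp only: zleft_def \<alpha>'_def \<beta>'_def k'_def)
    ultimately show ?thesis using R'(3)[of k'] False by simp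
  qed
  have "a p * \<phi> (p + 1) + a (p - 1) * \<phi> (p - 1) + y * \<phi> p = E * \<phi> p"
    using eq[of p] p by auto
  then have "y * \<phi> p = E * \<phi> p - a p * \<phi> (p + 1) - a (p - 1) * \<phi> (p - 1)" by linarith
  then have "y = (E * \<phi> p - a p * \<phi> (p + 1) - a (p - 1) * \<phi> (p - 1)) / \<phi> p"
    using nz by (simp only: eq_divide_eq) simp
  then have "y = E - (a p * \<phi> (p + 1) / \<phi> p) - (a (p - 1) * \<phi> (p - 1) / \<phi> p)"
    using nz by (simp add: diff_divide_distrib)
  then show "site_energy L a \<omega> p E = y" by (simp add: site_energy_def zr zl)
  have dr: "dright L a \<omega> p E = (\<Sum>n\<in>{p..int L}. (\<phi> n / \<phi> p)\<^sup>2)"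
  proof -
    have "dright L a \<omega> p E = (\<Sum>j\<le>k. (\<psi> j / \<psi> k)\<^sup>2)"
      using R(4)[of k] by (simp add: dright_def \<alpha>_def \<beta>_def k_def)
    also have "\<dots> = (\<Sum>j\<le>k. (\<phi> (int L - int j) / \<phi> p)\<^sup>2)" using kp by (simp add: \<psi>_def)
    also have "\<dots> = (\<Sum>n\<in>{p..int L}. (\<phi> n / \<phi> p)\<^sup>2)"
    proof (rule sum.reindex_bij_betw)
      show "bij_betw (\<lambda>j. int L - int j) {..k} {p..int L}"
        by (rule bij_betwI[where g = "\<lambda>n. nat (int L - n)"]) (use p in \<open>auto simp: k_def\<close>)
    qed
    finally show ?thesis .
  qed
  have dl: "dleft L a \<omega> p E = (\<Sum>n\<in>{- int L..p}. (\<phi> n / \<phi> p)\<^sup>2)"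
  proof -
    have "dleft L a \<omega> p E = (\<Sum>j\<le>k'. (\<psi>' j / \<psi>' k')\<^sup>2)"
      using R'(4)[of k'] by (simp add: dleft_def \<alpha>'_def \<beta>'_def k'_def)
    also have "\<dots> = (\<Sum>j\<le>k'. (\<phi> (- int L + int j) / \<phi> p)\<^sup>2)" using kp by (simp add: \<psi>'_def)
    also have "\<dots> = (\<Sum>n\<in>{- int L..p}. (\<phi> n / \<phi> p)\<^sup>2)"
    proof (rule sum.reindex_bij_betw)
      show "bij_betw (\<lambda>j. - int L + int j) {..k'} {- int L..p}"
        by (rule bij_betwI[where g = "\<lambda>n. nat (n + int L)"]) (use p in \<open>auto simp: k'_def\<close>)
    qed
    finally show ?thesis .
  qed
  \<comment> \<open>The site p is counted by both one-sided sums with ratio 1; this is the origin of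
    the subtracted 1 in the derivative of \<open>site_energy\<close>.\<close>
  have "(\<Sum>n\<in>{- int L..p}. (\<phi> n / \<phi> p)\<^sup>2) = (\<Sum>n\<in>{- int L..p-1}. (\<phi> n / \<phi> p)\<^sup>2) + 1"
  proof -
    have "{- int L..p} = insert p {- int L..p-1}" using p by auto
    then show ?thesis using nz by simp
  qed
  moreover have "(\<Sum>n\<in>{- int L..p-1}. (\<phi> n / \<phi> p)\<^sup>2) + (\<Sum>n\<in>{p..int L}. (\<phi> n / \<phi> p)\<^sup>2) = (\<Sum>n=-int L..int L. (\<phi> n / \<phi> p)\<^sup>2)"
  proof -
    have "{- int L..int L} = {- int L..p-1} \<union> {p..int L}" using p by auto
    then show ?thesis by (simp add: sum.union_disjoint)
  qed
  moreover have "(\<Sum>n=-int L..int L. (\<phi> n / \<phi> p)\<^sup>2) = 1 / (\<phi> p)\<^sup>2"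
    using norm by (simp add: power_divide flip: sum_divide_distrib)
  ultimately have "dright L a \<omega> p E + dleft L a \<omega> p E - 1 = 1 / (\<phi> p)\<^sup>2" using dr dl by simp
  then show "(\<phi> p)\<^sup>2 = 1 / (dright L a \<omega> p E + dleft L a \<omega> p E - 1)" using nz by simp
  show "\<bar>\<phi> q\<bar> = \<bar>\<phi> p\<bar> * decay L a \<omega> p q E"
    using q
  proof (induction q rule: int_ge_induct)
    case base
    show ?case by (simp add: decay_def)
  next
    case (step j)
    define i where "i = nat (int L - (j + 1))"
    have i: "int L - int i = j + 1" "i < k" "int L - int (Suc i) = j" "int L - int i - 1 = j"
      using step by (auto simp: i_def k_def)
    have z: "ric \<alpha> \<beta> i E = zright L a \<omega> (j + 1) E" by (simp add: zright_def \<alpha>_def \<beta>_def i_def)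
    have b: "\<beta> i = \<omega> (j + 1)" "\<alpha> i = a j" "\<psi> i = \<phi> (j + 1)" "\<psi> (Suc i) = \<phi> j"
      by (simp_all only: \<beta>_def \<alpha>_def \<psi>_def i(4)) (simp_all only: i)
    have "a j * \<phi> j = (zright L a \<omega> (j + 1) E - \<omega> (j + 1)) * \<phi> (j + 1)"
      using R(2)[of i] i(2) by (simp only: z b less_imp_le)
    moreover have "zright L a \<omega> (j + 1) E - \<omega> (j + 1) \<noteq> 0"
      using reg(1) i(2) z b by (auto simp: regular_def)
    ultimately have "\<phi> (j + 1) = a j / (zright L a \<omega> (j + 1) E - \<omega> (j + 1)) * \<phi> j" by (simp add: field_simps)
    then have "\<bar>\<phi> (j + 1)\<bar> = a j / \<bar>zright L a \<omega> (j + 1) E - \<omega> (j + 1)\<bar> * \<bar>\<phi> j\<bar>"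
      using pos[of j] by (simp add: abs_mult)
    moreover have "decay L a \<omega> p (j + 1) E = a j / \<bar>zright L a \<omega> (j + 1) E - \<omega> (j + 1)\<bar> * decay L a \<omega> p j E"
    proof -
      have "{p + 1..j + 1} = insert (j + 1) {p + 1..j}" using step by auto
      then show ?thesis by (simp add: decay_def)
    qed
    ultimately show ?case using step by simp
  qed
qed

lemma ric_measurable[measurable]: "ric \<alpha> \<beta> k \<in> borel_measurable borel"
proof (induction k)
  case 0
  have "ric \<alpha> \<beta> 0 = (\<lambda>E. E)" by auto
  then show ?case by simp
next
  case (Suc k)
  have [measurable]: "ric \<alpha> \<beta> k \<in> borel_measurable borel" by fact
  have "ric \<alpha> \<beta> (Suc k) = (\<lambda>E. E - (\<alpha> k)\<^sup>2 / (ric \<alpha> \<beta> k E - \<beta> k))" by auto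
  then show ?case by simp
qed

lemma decay_nonneg:
  assumes "\<And>n. a n > 0" shows "decay L a \<omega> p q E \<ge> 0"
  unfolding decay_def by (rule prod_nonneg) (use assms less_imp_le in \<open>auto intro: divide_nonneg_nonneg\<close>)

text \<open>Eigenvalues belonging to the value \<open>y\<close> at p are preimages of
  \<open>y\<close> under \<open>site_energy\<close>, and the squared entry at p is the reciprocal
  derivative there. So the correlator is a preimage sum, and changing variables to the energy
  removes that entry altogether, leaving only \<open>decay\<close>.\<close>

lemma spectral_averaging:
  fixes h :: "real \<Rightarrow> real"
  assumes pos: "\<And>n. a n > 0" and aA: "\<And>n. a n \<le> A"
    and p: "- int L \<le> p" "p < q" "q \<le> int L"
    and pq: "(p = 0 \<and> q = m) \<or> (p = m \<and> q = 0)"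
    and h[measurable]: "h \<in> borel_measurable borel" and h0: "\<And>y. h y \<ge> 0"
    and supp: "\<And>y. \<bar>y\<bar> > b \<Longrightarrow> h y = 0" and w: "\<And>n. \<bar>\<omega> n\<bar> \<le> b"
  shows "(\<integral>\<^sup>+y. ennreal (h y) * (SUP t. ennreal (cmod (box_entry a (fun_upd \<omega> p y) L t m))) \<partial>lborel)
    \<le> (\<integral>\<^sup>+E. ennreal (h (site_energy L a \<omega> p E) * decay L a \<omega> p q E * indicator {-(2*A+b)..2*A+b} E) \<partial>lborel)"
proof (rule nn_integral_preimage_sum_le[where \<Phi> = "site_energy L a \<omega> p"
    and \<Phi>' = "\<lambda>E. dright L a \<omega> p E + dleft L a \<omega> p E - 1" and X = "{E. \<not> good_energy L a \<omega> p E}"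
    and Y = "{y. \<exists>E \<phi>. \<not> good_energy L a \<omega> p E \<and> box_eigen L a (fun_upd \<omega> p y) E \<phi> \<and> \<phi> p \<noteq> 0}"])
  let ?H = "\<lambda>E. h (site_energy L a \<omega> p E) * decay L a \<omega> p q E * indicator {-(2*A+b)..2*A+b} E"
  let ?X = "{E. \<not> good_energy L a \<omega> p E}"
  let ?Y = "{y. \<exists>E \<phi>. \<not> good_energy L a \<omega> p E \<and> box_eigen L a (fun_upd \<omega> p y) E \<phi> \<and> \<phi> p \<noteq> 0}"
  have p': "\<bar>p\<bar> \<le> int L" using p by auto
  show finX: "finite ?X" by (rule finite_bad_energy[OF pos])
  \<comment> \<open>A bad energy is an eigenvalue with nonzero entry at p for at most one value
    \<open>y\<close>, and there are finitely many bad energies.\<close>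
  show "finite ?Y"
  proof -
    have "?Y \<subseteq> (\<lambda>E. SOME y. \<exists>\<phi>. box_eigen L a (fun_upd \<omega> p y) E \<phi> \<and> \<phi> p \<noteq> 0) ` ?X"
    proof
      fix y assume "y \<in> ?Y"
      then obtain E \<phi> where E: "E \<in> ?X" "box_eigen L a (fun_upd \<omega> p y) E \<phi>" "\<phi> p \<noteq> 0" by auto
      have "(SOME y. \<exists>\<phi>. box_eigen L a (fun_upd \<omega> p y) E \<phi> \<and> \<phi> p \<noteq> 0) = y"
      proof (rule some_equality)
        show "\<exists>\<phi>. box_eigen L a (fun_upd \<omega> p y) E \<phi> \<and> \<phi> p \<noteq> 0" using E by blast
        show "y' = y" if "\<exists>\<phi>. box_eigen L a (fun_upd \<omega> p y') E \<phi> \<and> \<phi> p \<noteq> 0" for y'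
          using that box_eigen_unique_site_value[OF _ E(2) p' _ E(3)] by blast
      qed
      then show "y \<in> (\<lambda>E. SOME y. \<exists>\<phi>. box_eigen L a (fun_upd \<omega> p y) E \<phi> \<and> \<phi> p \<noteq> 0) ` ?X" using E(1) by force
    qed
    then show ?thesis using finX finite_surj by blast
  qed
  show "(site_energy L a \<omega> p has_real_derivative dright L a \<omega> p E + dleft L a \<omega> p E - 1) (at E)" if "E \<notin> ?X" for E
    by (rule site_energy_has_derivative) (use that in simp)
  show "0 < dright L a \<omega> p E + dleft L a \<omega> p E - 1" for E by (rule site_energy_deriv_pos)
  show "?H \<in> borel_measurable borel"
    unfolding site_energy_def decay_def zright_def zleft_def by measurable
  show "0 \<le> ?H E" for E using h0 decay_nonneg[of a, OF pos] by simp
  fix y assume y: "y \<notin> ?Y"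
  let ?Q = "ennreal (h y) * (SUP t. ennreal (cmod (box_entry a (fun_upd \<omega> p y) L t m)))"
  show "\<exists>\<Lambda>. finite \<Lambda> \<and> \<Lambda> \<inter> ?X = {} \<and> (\<forall>l\<in>\<Lambda>. site_energy L a \<omega> p l = y) \<and>
     ?Q \<le> (\<Sum>l\<in>\<Lambda>. ennreal (?H l / (dright L a \<omega> p l + dleft L a \<omega> p l - 1)))"
  proof (cases "h y = 0")
    case True
    then show ?thesis by (intro exI[of _ "{}"]) simp
  next
    case False
    then have yb: "\<bar>y\<bar> \<le> b" using supp[of y] by linarith
    obtain \<Lambda> :: "real set" and \<phi> where L: "finite \<Lambda>"
      "\<And>l. l \<in> \<Lambda> \<Longrightarrow> box_eigen L a (fun_upd \<omega> p y) l (\<phi> l)"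
      "\<And>l. l \<in> \<Lambda> \<Longrightarrow> (\<Sum>n=-int L..int L. (\<phi> l n)\<^sup>2) = 1"
      "\<And>t m. cmod (box_entry a (fun_upd \<omega> p y) L t m) \<le> (\<Sum>l\<in>\<Lambda>. \<bar>\<phi> l 0 * \<phi> l m\<bar>)"
      by (rule box_entry_bound[where a = a and L = L and \<omega> = "fun_upd \<omega> p y", OF pos]) (rule that, assumption+)
    \<comment> \<open>Discarded eigenvalues contribute nothing to the correlator, because p is 0 or
      \<open>m\<close>.\<close>
    define \<Lambda>' where "\<Lambda>' = {l \<in> \<Lambda>. \<phi> l p \<noteq> 0}"
    have good: "good_energy L a \<omega> p l" if "l \<in> \<Lambda>'" for l
      using y L(2)[of l] that by (auto simp: \<Lambda>'_def)
    have ric: "site_energy L a \<omega> p l = y"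
       "(\<phi> l p)\<^sup>2 = 1 / (dright L a \<omega> p l + dleft L a \<omega> p l - 1)"
       "\<bar>\<phi> l q\<bar> = \<bar>\<phi> l p\<bar> * decay L a \<omega> p q l" if l: "l \<in> \<Lambda>'" for l
      using box_eigen_riccati[of a, OF pos L(2)[of l] _ _ _ good[OF l] L(3)[of l], of q] p l by (auto simp: \<Lambda>'_def)
    have bd: "\<bar>l\<bar> \<le> 2 * A + b" if "l \<in> \<Lambda>'" for l
    proof (rule box_eigen_bound[OF L(2)])
      show "l \<in> \<Lambda>" "\<phi> l p \<noteq> 0" using that by (auto simp: \<Lambda>'_def)
      show "\<bar>a n\<bar> \<le> A" for n using pos[of n] aA[of n] by simp
      show "\<bar>(fun_upd \<omega> p y) n\<bar> \<le> b" for n using w yb by simp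
    qed
    have trm: "h y * \<bar>\<phi> l 0 * \<phi> l m\<bar> = ?H l / (dright L a \<omega> p l + dleft L a \<omega> p l - 1)" if l: "l \<in> \<Lambda>'" for l
    proof -
      have "\<bar>\<phi> l 0 * \<phi> l m\<bar> = \<bar>\<phi> l p\<bar> * \<bar>\<phi> l q\<bar>" using pq by (auto simp: abs_mult)
      also have "\<dots> = (\<phi> l p)\<^sup>2 * decay L a \<omega> p q l" by (simp add: ric(3)[OF l] power2_eq_square)
      finally have "\<bar>\<phi> l 0 * \<phi> l m\<bar> = decay L a \<omega> p q l / (dright L a \<omega> p l + dleft L a \<omega> p l - 1)"
        using ric(2)[OF l] by simp
      moreover have "l \<in> {-(2*A+b)..2*A+b}" using bd[OF l] by auto
      ultimately show ?thesis using ric(1)[OF l] by simp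
    qed
    have "(SUP t. ennreal (cmod (box_entry a (fun_upd \<omega> p y) L t m))) \<le> ennreal (\<Sum>l\<in>\<Lambda>. \<bar>\<phi> l 0 * \<phi> l m\<bar>)"
      by (rule SUP_least) (intro ennreal_leI L(4))
    also have "(\<Sum>l\<in>\<Lambda>. \<bar>\<phi> l 0 * \<phi> l m\<bar>) = (\<Sum>l\<in>\<Lambda>'. \<bar>\<phi> l 0 * \<phi> l m\<bar>)"
      by (rule sum.mono_neutral_right) (use L(1) pq in \<open>auto simp: \<Lambda>'_def\<close>)
    finally have "?Q \<le> ennreal (h y) * ennreal (\<Sum>l\<in>\<Lambda>'. \<bar>\<phi> l 0 * \<phi> l m\<bar>)" by (rule mult_left_mono) simp
    also have "\<dots> = ennreal (\<Sum>l\<in>\<Lambda>'. h y * \<bar>\<phi> l 0 * \<phi> l m\<bar>)"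
      using h0 by (simp add: ennreal_mult[symmetric] sum_nonneg sum_distrib_left)
    also have "\<dots> = (\<Sum>l\<in>\<Lambda>'. ennreal (h y * \<bar>\<phi> l 0 * \<phi> l m\<bar>))"
      using h0 by (intro sum_ennreal[symmetric]) simp
    also have "\<dots> = (\<Sum>l\<in>\<Lambda>'. ennreal (?H l / (dright L a \<omega> p l + dleft L a \<omega> p l - 1)))"
      by (intro sum.cong refl arg_cong[where f = ennreal] trm)
    finally have "?Q \<le> (\<Sum>l\<in>\<Lambda>'. ennreal (?H l / (dright L a \<omega> p l + dleft L a \<omega> p l - 1)))" .
    moreover have "finite \<Lambda>'" using L(1) by (simp add: \<Lambda>'_def)
    ultimately show ?thesis using good ric(1) by (intro exI[of _ \<Lambda>']) auto
  qed
qed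

section \<open>Contraction of the transfer operators\<close>

definition nsq :: "(real \<Rightarrow> real) \<Rightarrow> ennreal" where
  "nsq f = (\<integral>\<^sup>+x. ennreal ((f x)\<^sup>2) \<partial>lborel)"

definition msq :: "real \<Rightarrow> (real \<Rightarrow> real) \<Rightarrow> ennreal" where
  "msq M f = (\<integral>\<^sup>+x. ennreal ((f x)\<^sup>2) * indicator {-M..M} x \<partial>lborel)"

definition shd :: "(real \<Rightarrow> real) \<Rightarrow> real \<Rightarrow> ennreal" where
  "shd f s = (\<integral>\<^sup>+x. ennreal ((f (x + s) - f x)\<^sup>2) \<partial>lborel)"

definition conv :: "(real \<Rightarrow> real) \<Rightarrow> (real \<Rightarrow> real) \<Rightarrow> real \<Rightarrow> real" where
  "conv \<rho> g z = (\<integral>y. \<rho> y * g (z - y) \<partial>lborel)"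

lemma ennreal_summand_le:
  fixes x y z :: ennreal
  assumes "x + y = z" shows "x \<le> z" "y \<le> z"
  unfolding assms[symmetric] by (auto intro: add_increasing add_increasing2)

lemma nn_integral_shift:
  fixes f :: "real \<Rightarrow> ennreal"
  assumes [measurable]: "f \<in> borel_measurable borel"
  shows "(\<integral>\<^sup>+x. f (x + t) \<partial>lborel) = (\<integral>\<^sup>+x. f x \<partial>lborel)"
  using nn_integral_real_affine[of f 1 t] by (simp add: add.commute)

lemma nn_integral_reflect:
  fixes f :: "real \<Rightarrow> ennreal"
  assumes [measurable]: "f \<in> borel_measurable borel"
  shows "(\<integral>\<^sup>+x. f (t - x) \<partial>lborel) = (\<integral>\<^sup>+x. f x \<partial>lborel)"
  using nn_integral_real_affine[of f "-1" t] by simp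

text \<open>Telescope into \<open>n\<close> single shifts. Cauchy-Schwarz gives one factor
  \<open>n\<close>, and \<open>n\<close> equal integrals give the other.\<close>

lemma shd_multiple:
  assumes [measurable]: "f \<in> borel_measurable borel"
  shows "shd f (real n * s) \<le> ennreal ((real n)\<^sup>2) * shd f s"
proof -
  have pw: "(f (x + real n * s) - f x)\<^sup>2 \<le> real n * (\<Sum>j<n. (f (x + real j * s + s) - f (x + real j * s))\<^sup>2)" for x
  proof -
    have "f (x + real n * s) - f x = (\<Sum>j<n. f (x + real j * s + s) - f (x + real j * s))"
      using sum_lessThan_telescope[of "\<lambda>j. f (x + real j * s)" n] by (simp add: algebra_simps)
    then have "(f (x + real n * s) - f x)\<^sup>2 = (\<Sum>j<n. f (x + real j * s + s) - f (x + real j * s))\<^sup>2"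
      by simp
    also have "\<dots> \<le> (\<Sum>j<n. (f (x + real j * s + s) - f (x + real j * s))\<^sup>2) * real (card {..<n})"
      by (rule sum_squared_le_sum_of_squares)
    finally show ?thesis by (simp add: mult.commute)
  qed
  have "shd f (real n * s) \<le> (\<integral>\<^sup>+x. ennreal (real n) * (\<Sum>j<n. ennreal ((f (x + real j * s + s) - f (x + real j * s))\<^sup>2)) \<partial>lborel)"
    unfolding shd_def
    by (rule nn_integral_mono) (use pw in \<open>simp add: sum_ennreal sum_nonneg ennreal_leI flip: ennreal_mult\<close>)
  also have "\<dots> = ennreal (real n) * (\<Sum>j<n. \<integral>\<^sup>+x. ennreal ((f (x + real j * s + s) - f (x + real j * s))\<^sup>2) \<partial>lborel)"
    by (subst nn_integral_cmult, measurable) (subst nn_integral_sum, measurable)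
  also have "\<dots> = ennreal (real n) * (\<Sum>j<n. shd f s)"
    unfolding shd_def
    by (intro arg_cong[where f = "\<lambda>u. _ * u"] sum.cong refl
        nn_integral_shift[where f = "\<lambda>x. ennreal ((f (x + s) - f x)\<^sup>2)"]) measurable
  also have "\<dots> = ennreal ((real n)\<^sup>2) * shd f s"
    by (simp add: power2_eq_square ennreal_mult mult.assoc ennreal_of_nat_eq_real_of_nat)
  finally show ?thesis .
qed

text \<open>The translates of the window by multiples of \<open>t\<close> are disjoint. If
  \<open>f\<close> is nearly invariant under them, each carries almost the mass of the window, yet
  together they carry at most \<open>nsq f\<close>.\<close>

lemma msq_le_shd:
  assumes [measurable]: "f \<in> borel_measurable borel" and t: "\<bar>t\<bar> > 2 * M"
  shows "of_nat P * msq M f \<le> 2 * nsq f + 2 * (\<Sum>k<P. shd f (real k * t))"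
proof -
  let ?I = "\<lambda>k x. indicator {-M..M} (x - real k * t) :: ennreal"
  have step: "msq M f \<le> 2 * (\<integral>\<^sup>+x. ennreal ((f x)\<^sup>2) * ?I k x \<partial>lborel) + 2 * shd f (real k * t)" for k
  proof -
    have "(f x)\<^sup>2 \<le> 2 * (f (x + real k * t))\<^sup>2 + 2 * (f (x + real k * t) - f x)\<^sup>2" for x
      using zero_le_power2[of "2 * f (x + real k * t) - f x"] by (simp add: power2_eq_square algebra_simps)
    then have pw: "ennreal ((f x)\<^sup>2) * indicator {-M..M} x \<le> 2 * (ennreal ((f (x + real k * t))\<^sup>2) * indicator {-M..M} x)
         + 2 * ennreal ((f (x + real k * t) - f x)\<^sup>2)" for x
    proof (cases "x \<in> {-M..M}")
      case True
      have "ennreal ((f x)\<^sup>2) \<le> ennreal (2 * (f (x + real k * t))\<^sup>2 + 2 * (f (x + real k * t) - f x)\<^sup>2)"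
        using \<open>\<And>x. (f x)\<^sup>2 \<le> _ x\<close> by (intro ennreal_leI) simp
      also have "\<dots> = 2 * ennreal ((f (x + real k * t))\<^sup>2) + 2 * ennreal ((f (x + real k * t) - f x)\<^sup>2)"
        by (simp add: ennreal_plus ennreal_mult)
      finally show ?thesis using True by simp
    qed simp
    have "msq M f \<le> (\<integral>\<^sup>+x. 2 * (ennreal ((f (x + real k * t))\<^sup>2) * indicator {-M..M} x)
         + 2 * ennreal ((f (x + real k * t) - f x)\<^sup>2) \<partial>lborel)"
      unfolding msq_def by (rule nn_integral_mono) (rule pw)
    also have "\<dots> = 2 * (\<integral>\<^sup>+x. ennreal ((f (x + real k * t))\<^sup>2) * indicator {-M..M} x \<partial>lborel) + 2 * shd f (real k * t)"
      unfolding shd_def by (subst nn_integral_add) (auto simp: nn_integral_cmult)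
    also have "(\<integral>\<^sup>+x. ennreal ((f (x + real k * t))\<^sup>2) * indicator {-M..M} x \<partial>lborel) =
       (\<integral>\<^sup>+x. ennreal ((f x)\<^sup>2) * ?I k x \<partial>lborel)"
      using nn_integral_shift[of "\<lambda>x. ennreal ((f x)\<^sup>2) * ?I k x" "real k * t"] by simp
    finally show ?thesis .
  qed
  \<comment> \<open>Two windows containing \<open>x\<close> would have centres at distance at most
    \<open>2 * M\<close>, less than the modulus of \<open>t\<close>.\<close>
  have disj: "(\<Sum>k<P. ?I k x) \<le> 1" for x
  proof -
    have "card {k\<in>{..<P}. x - real k * t \<in> {-M..M}} \<le> 1"
    proof (rule card_le_Suc0_iff_eq[THEN iffD2, unfolded One_nat_def[symmetric]])
      show "\<forall>a1\<in>{k\<in>{..<P}. x - real k * t \<in> {-M..M}}. \<forall>a2\<in>{k\<in>{..<P}. x - real k * t \<in> {-M..M}}. a1 = a2"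
      proof (intro ballI, rule ccontr)
        fix k l assume kl: "k \<in> {k\<in>{..<P}. x - real k * t \<in> {-M..M}}"
          "l \<in> {k\<in>{..<P}. x - real k * t \<in> {-M..M}}" "k \<noteq> l"
        then have 1: "\<bar>(real k - real l) * t\<bar> \<le> 2 * M" by (auto simp: algebra_simps abs_le_iff)
        have "\<bar>real k - real l\<bar> \<ge> 1" using kl(3) by linarith
        then have "\<bar>real k - real l\<bar> * \<bar>t\<bar> \<ge> 1 * \<bar>t\<bar>" by (rule mult_right_mono) simp
        then show False using 1 t by (simp add: abs_mult)
      qed
    qed simp
    moreover have "(\<Sum>k<P. ?I k x) = of_nat (card {k\<in>{..<P}. x - real k * t \<in> {-M..M}})"
    proof -
      have "(\<Sum>k<P. ?I k x) = (\<Sum>k<P. if x - real k * t \<in> {-M..M} then 1 else 0)"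
        by (intro sum.cong) (auto simp: indicator_def)
      also have "\<dots> = (\<Sum>k\<in>{k\<in>{..<P}. x - real k * t \<in> {-M..M}}. 1)"
        by (rule sum.inter_filter[symmetric]) simp
      finally show ?thesis by (simp only: sum_constant mult_1_right)
    qed
    ultimately show ?thesis
      using of_nat_mono[of "card {k\<in>{..<P}. x - real k * t \<in> {-M..M}}" 1, where 'a = ennreal]
      by (simp only: of_nat_1)
  qed
  have "of_nat P * msq M f = (\<Sum>k<P. msq M f)" by simp
  also have "\<dots> \<le> (\<Sum>k<P. 2 * (\<integral>\<^sup>+x. ennreal ((f x)\<^sup>2) * ?I k x \<partial>lborel) + 2 * shd f (real k * t))"
    by (rule sum_mono) (rule step)
  also have "\<dots> = 2 * (\<Sum>k<P. \<integral>\<^sup>+x. ennreal ((f x)\<^sup>2) * ?I k x \<partial>lborel) + 2 * (\<Sum>k<P. shd f (real k * t))"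
    by (simp add: sum.distrib sum_distrib_left)
  also have "(\<Sum>k<P. \<integral>\<^sup>+x. ennreal ((f x)\<^sup>2) * ?I k x \<partial>lborel) = (\<integral>\<^sup>+x. (\<Sum>k<P. ennreal ((f x)\<^sup>2) * ?I k x) \<partial>lborel)"
    by (rule nn_integral_sum[symmetric]) measurable
  also have "\<dots> \<le> nsq f"
    unfolding nsq_def
  proof (rule nn_integral_mono)
    fix x
    have "(\<Sum>k<P. ennreal ((f x)\<^sup>2) * ?I k x) = ennreal ((f x)\<^sup>2) * (\<Sum>k<P. ?I k x)"
      by (simp add: sum_distrib_left)
    also have "\<dots> \<le> ennreal ((f x)\<^sup>2) * 1" by (rule mult_left_mono[OF disj]) simp
    finally show "(\<Sum>k<P. ennreal ((f x)\<^sup>2) * ?I k x) \<le> ennreal ((f x)\<^sup>2)" by simp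
  qed
  finally show ?thesis by (simp add: add_mono mult_left_mono)
qed

section \<open>Convolution with a bounded density\<close>

text \<open>The bound \<open>s\<close> quantifies spreading: an interval of length
  \<open>1 / (2 * s)\<close> has probability at most one half. It also makes convolution of square
  integrable functions well defined.\<close>

locale bdd_density =
  fixes \<rho> :: "real \<Rightarrow> real" and s :: real
  assumes rho_meas[measurable]: "\<rho> \<in> borel_measurable borel"
    and rho_nonneg: "\<And>y. \<rho> y \<ge> 0" and rho_le: "\<And>y. \<rho> y \<le> s"
    and rho_int: "(\<integral>\<^sup>+y. ennreal (\<rho> y) \<partial>lborel) = 1"
begin

lemma s_pos: "s > 0"
proof (rule ccontr)
  assume "\<not> s > 0"
  then have "\<rho> y = 0" for y using rho_le[of y] rho_nonneg[of y] by linarith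
  then show False using rho_int by simp
qed

lemma rho_integrable: "integrable lborel \<rho>"
  by (rule integrableI_nonneg) (use rho_int rho_nonneg in auto)

lemma rho_integral: "integral\<^sup>L lborel \<rho> = 1"
  using rho_int rho_nonneg by (simp add: integral_eq_nn_integral)

lemma sq_integrable:
  assumes [measurable]: "g \<in> borel_measurable borel" and fin: "nsq g < \<infinity>"
  shows "integrable lborel (\<lambda>y. (g (z - y))\<^sup>2)"
proof (rule integrableI_nonneg)
  show "(\<integral>\<^sup>+ y. ennreal ((g (z - y))\<^sup>2) \<partial>lborel) < \<infinity>"
    using nn_integral_reflect[of "\<lambda>y. ennreal ((g y)\<^sup>2)" z] fin by (simp add: nsq_def)
qed auto

lemma conv_integrable:
  assumes [measurable]: "g \<in> borel_measurable borel" and fin: "nsq g < \<infinity>"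
  shows "integrable lborel (\<lambda>y. \<rho> y * g (z - y))" "integrable lborel (\<lambda>y. \<rho> y * (g (z - y))\<^sup>2)"
proof -
  have 1: "integrable lborel (\<lambda>y. \<rho> y + s * (g (z - y))\<^sup>2)"
    using rho_integrable sq_integrable[OF assms] by simp
  show "integrable lborel (\<lambda>y. \<rho> y * g (z - y))"
  proof (rule Bochner_Integration.integrable_bound[OF 1])
    show "AE y in lborel. norm (\<rho> y * g (z - y)) \<le> norm (\<rho> y + s * (g (z - y))\<^sup>2)"
    proof (rule AE_I2)
      fix y
      have "\<bar>g (z - y)\<bar> \<le> 1 + (g (z - y))\<^sup>2"
        using zero_le_power2[of "\<bar>g (z - y)\<bar> - 1"] by (simp add: power2_eq_square algebra_simps)
      then have "\<rho> y * \<bar>g (z - y)\<bar> \<le> \<rho> y * (1 + (g (z - y))\<^sup>2)" by (rule mult_left_mono) (rule rho_nonneg)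
      also have "\<dots> \<le> \<rho> y + s * (g (z - y))\<^sup>2"
        using mult_right_mono[OF rho_le[of y], of "(g (z - y))\<^sup>2"] by (simp add: algebra_simps)
      finally show "norm (\<rho> y * g (z - y)) \<le> norm (\<rho> y + s * (g (z - y))\<^sup>2)"
        using rho_nonneg[of y] by (simp add: abs_mult)
    qed
  qed measurable
  have 2: "integrable lborel (\<lambda>y. s * (g (z - y))\<^sup>2)" using sq_integrable[OF assms] by simp
  show "integrable lborel (\<lambda>y. \<rho> y * (g (z - y))\<^sup>2)"
    by (rule Bochner_Integration.integrable_bound[OF 2])
      (use rho_nonneg rho_le s_pos in \<open>auto intro!: AE_I2 mult_right_mono simp: abs_mult\<close>)
qed

lemma conv_measurable[measurable]:
  assumes [measurable]: "g \<in> borel_measurable borel"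
  shows "conv \<rho> g \<in> borel_measurable borel"
  unfolding conv_def by measurable

lemma conv_nonneg:
  assumes "\<And>x. g x \<ge> 0" shows "conv \<rho> g z \<ge> 0"
  unfolding conv_def by (rule integral_nonneg_AE) (use assms rho_nonneg in auto)

lemma conv_nn:
  assumes [measurable]: "g \<in> borel_measurable borel" and fin: "nsq g < \<infinity>" and g0: "\<And>x. g x \<ge> 0"
  shows "ennreal (conv \<rho> g z) = (\<integral>\<^sup>+y. ennreal (\<rho> y * g (z - y)) \<partial>lborel)"
  unfolding conv_def
  by (rule nn_integral_eq_integral[symmetric])
    (use conv_integrable(1)[OF assms(1,2)] g0 rho_nonneg in auto)

text \<open>For fixed \<open>z\<close> and \<open>y\<close> distributed by \<open>\<rho>\<close>,
  the convolution is the mean of \<open>g (z - y)\<close>; this is the identity of second moment,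
  squared mean and variance.\<close>

lemma conv_variance:
  assumes [measurable]: "g \<in> borel_measurable borel" and fin: "nsq g < \<infinity>"
  shows "ennreal ((conv \<rho> g z)\<^sup>2) + (\<integral>\<^sup>+y. ennreal (\<rho> y * (g (z - y) - conv \<rho> g z)\<^sup>2) \<partial>lborel)
      = (\<integral>\<^sup>+y. ennreal (\<rho> y * (g (z - y))\<^sup>2) \<partial>lborel)"
proof -
  let ?u = "conv \<rho> g z"
  note int = conv_integrable[OF assms, of z]
  have eq: "\<rho> y * (g (z - y) - ?u)\<^sup>2 = \<rho> y * (g (z - y))\<^sup>2 - 2 * ?u * (\<rho> y * g (z - y)) + ?u\<^sup>2 * \<rho> y" for y
    by (simp add: power2_eq_square algebra_simps)
  have i3: "integrable lborel (\<lambda>y. \<rho> y * (g (z - y) - ?u)\<^sup>2)"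
    unfolding eq using int rho_integrable by simp
  have "(\<integral>y. \<rho> y * (g (z - y) - ?u)\<^sup>2 \<partial>lborel) = (\<integral>y. \<rho> y * (g (z - y))\<^sup>2 \<partial>lborel) - 2 * ?u * ?u + ?u\<^sup>2"
    unfolding eq using int rho_integrable rho_integral by (simp add: conv_def)
  then have e: "?u\<^sup>2 + (\<integral>y. \<rho> y * (g (z - y) - ?u)\<^sup>2 \<partial>lborel) = (\<integral>y. \<rho> y * (g (z - y))\<^sup>2 \<partial>lborel)"
    by (simp add: power2_eq_square)
  have "(\<integral>\<^sup>+y. ennreal (\<rho> y * (g (z - y) - ?u)\<^sup>2) \<partial>lborel) = ennreal (\<integral>y. \<rho> y * (g (z - y) - ?u)\<^sup>2 \<partial>lborel)"
    by (rule nn_integral_eq_integral[OF i3]) (simp add: rho_nonneg)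
  moreover have "(\<integral>\<^sup>+y. ennreal (\<rho> y * (g (z - y))\<^sup>2) \<partial>lborel) = ennreal (\<integral>y. \<rho> y * (g (z - y))\<^sup>2 \<partial>lborel)"
    by (rule nn_integral_eq_integral[OF int(2)]) (simp add: rho_nonneg)
  moreover have "(\<integral>y. \<rho> y * (g (z - y) - ?u)\<^sup>2 \<partial>lborel) \<ge> 0"
    by (rule integral_nonneg_AE) (simp add: rho_nonneg)
  ultimately show ?thesis by (simp add: ennreal_plus[symmetric] e del: ennreal_plus)
qed

text \<open>The variances of \<open>conv_variance\<close> integrated over \<open>z\<close>, written
  with \<open>y\<close> as the outer variable so that individual good values of \<open>y\<close> can
  be selected.\<close>

definition deficit :: "(real \<Rightarrow> real) \<Rightarrow> ennreal" where
  "deficit g = (\<integral>\<^sup>+y. ennreal (\<rho> y) * (\<integral>\<^sup>+z. ennreal ((g (z - y) - conv \<rho> g z)\<^sup>2) \<partial>lborel) \<partial>lborel)"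

lemma nsq_conv:
  assumes [measurable]: "g \<in> borel_measurable borel" and fin: "nsq g < \<infinity>"
  shows "nsq (conv \<rho> g) + deficit g = nsq g"
proof -
  interpret pair_sigma_finite lborel "lborel :: real measure" ..
  have "deficit g = (\<integral>\<^sup>+y. (\<integral>\<^sup>+z. ennreal (\<rho> y * (g (z - y) - conv \<rho> g z)\<^sup>2) \<partial>lborel) \<partial>lborel)"
    unfolding deficit_def
    by (intro nn_integral_cong) (subst nn_integral_cmult[symmetric], measurable, simp add: ennreal_mult rho_nonneg)
  also have "\<dots> = (\<integral>\<^sup>+z. (\<integral>\<^sup>+y. ennreal (\<rho> y * (g (z - y) - conv \<rho> g z)\<^sup>2) \<partial>lborel) \<partial>lborel)"
    by (rule lborel_pair.Fubini') measurable
  finally have d: "deficit g = \<dots>" .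
  have "nsq (conv \<rho> g) + deficit g = (\<integral>\<^sup>+z. ennreal ((conv \<rho> g z)\<^sup>2) +
      (\<integral>\<^sup>+y. ennreal (\<rho> y * (g (z - y) - conv \<rho> g z)\<^sup>2) \<partial>lborel) \<partial>lborel)"
    unfolding d nsq_def by (rule nn_integral_add[symmetric]) measurable
  also have "\<dots> = (\<integral>\<^sup>+z. (\<integral>\<^sup>+y. ennreal (\<rho> y * (g (z - y))\<^sup>2) \<partial>lborel) \<partial>lborel)"
    by (simp only: conv_variance[OF assms])
  also have "\<dots> = (\<integral>\<^sup>+y. (\<integral>\<^sup>+z. ennreal (\<rho> y * (g (z - y))\<^sup>2) \<partial>lborel) \<partial>lborel)"
    by (rule lborel_pair.Fubini'[symmetric]) measurable
  also have "\<dots> = (\<integral>\<^sup>+y. ennreal (\<rho> y) * nsq g \<partial>lborel)"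
  proof (intro nn_integral_cong)
    fix y
    have "(\<integral>\<^sup>+z. ennreal (\<rho> y * (g (z - y))\<^sup>2) \<partial>lborel) = ennreal (\<rho> y) * (\<integral>\<^sup>+z. ennreal ((g (z - y))\<^sup>2) \<partial>lborel)"
      by (subst nn_integral_cmult[symmetric], measurable, simp add: ennreal_mult rho_nonneg)
    also have "(\<integral>\<^sup>+z. ennreal ((g (z - y))\<^sup>2) \<partial>lborel) = nsq g"
      using nn_integral_shift[of "\<lambda>z. ennreal ((g z)\<^sup>2)" "- y"] by (simp add: nsq_def)
    finally show "(\<integral>\<^sup>+z. ennreal (\<rho> y * (g (z - y))\<^sup>2) \<partial>lborel) = ennreal (\<rho> y) * nsq g" .
  qed
  also have "\<dots> = nsq g" by (subst nn_integral_multc) (auto simp: rho_int)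
  finally show ?thesis .
qed

text \<open>By Markov, with probability at least 3/4 the translate of \<open>g\<close> by
  \<open>y\<close> is within squared distance \<open>4 * \<theta>\<close> of the convolution. Such
  \<open>y\<close> cannot all be close together because the density is bounded; two distant ones are
  compared through the convolution, which costs \<open>2 * (4 * \<theta>)\<close> for each.\<close>

lemma ex_good_shift:
  assumes [measurable]: "g \<in> borel_measurable borel" and \<theta>: "\<theta> > 0" "deficit g \<le> ennreal \<theta>"
  obtains t where "\<bar>t\<bar> \<ge> 1 / (4 * s)" "shd g t \<le> ennreal (16 * \<theta>)"
proof -
  define H where "H y = (\<integral>\<^sup>+z. ennreal ((g (z - y) - conv \<rho> g z)\<^sup>2) \<partial>lborel)" for y
  have [measurable]: "H \<in> borel_measurable borel" unfolding H_def by measurable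
  define B where "B = {y. H y > ennreal (4 * \<theta>)}"
  have [measurable]: "B \<in> sets borel" unfolding B_def by measurable
  have "ennreal (4 * \<theta>) * (\<integral>\<^sup>+y. ennreal (\<rho> y) * indicator B y \<partial>lborel) =
     (\<integral>\<^sup>+y. ennreal (4 * \<theta>) * (ennreal (\<rho> y) * indicator B y) \<partial>lborel)"
    by (rule nn_integral_cmult[symmetric]) measurable
  also have "\<dots> \<le> deficit g" unfolding deficit_def H_def[symmetric]
  proof (rule nn_integral_mono)
    fix y
    show "ennreal (4 * \<theta>) * (ennreal (\<rho> y) * indicator B y) \<le> ennreal (\<rho> y) * H y"
    proof (cases "y \<in> B")
      case True
      then have "ennreal (4 * \<theta>) \<le> H y" by (simp add: B_def)
      then have "ennreal (\<rho> y) * ennreal (4 * \<theta>) \<le> ennreal (\<rho> y) * H y" by (rule mult_left_mono) simp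
      then show ?thesis using True by (simp add: mult.commute)
    qed simp
  qed
  also have "\<dots> \<le> ennreal \<theta>" by (rule \<theta>)
  finally have mB: "ennreal (4 * \<theta>) * (\<integral>\<^sup>+y. ennreal (\<rho> y) * indicator B y \<partial>lborel) \<le> ennreal \<theta>" .
  have B4: "(\<integral>\<^sup>+y. ennreal (\<rho> y) * indicator B y \<partial>lborel) \<le> ennreal (1/4)"
  proof -
    have "(\<integral>\<^sup>+y. ennreal (\<rho> y) * indicator B y \<partial>lborel) \<le> (\<integral>\<^sup>+y. ennreal (\<rho> y) \<partial>lborel)"
      by (rule nn_integral_mono) (auto simp: indicator_def)
    then obtain b where b: "(\<integral>\<^sup>+y. ennreal (\<rho> y) * indicator B y \<partial>lborel) = ennreal b" "b \<ge> 0"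
      using rho_int
      by (cases "(\<integral>\<^sup>+y. ennreal (\<rho> y) * indicator B y \<partial>lborel)") (auto simp: top_unique)
    have "4 * \<theta> * b \<le> \<theta>" using mB \<theta>(1) b by (simp add: ennreal_mult[symmetric] ennreal_le_iff)
    then have "b \<le> 1/4" using \<theta>(1) by (simp add: field_simps)
    then show ?thesis using b by (simp add: ennreal_leI)
  qed
  have split1: "1 \<le> ennreal (1/4) + (\<integral>\<^sup>+y. ennreal (\<rho> y) * indicator (- B) y \<partial>lborel)"
  proof -
    have "(\<integral>\<^sup>+y. ennreal (\<rho> y) \<partial>lborel) = (\<integral>\<^sup>+y. ennreal (\<rho> y) * indicator B y + ennreal (\<rho> y) * indicator (- B) y \<partial>lborel)"
      by (intro nn_integral_cong) (auto simp: indicator_def)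
    also have "\<dots> = (\<integral>\<^sup>+y. ennreal (\<rho> y) * indicator B y \<partial>lborel) + (\<integral>\<^sup>+y. ennreal (\<rho> y) * indicator (- B) y \<partial>lborel)"
      by (rule nn_integral_add) measurable
    finally show ?thesis using B4 rho_int by (metis add_right_mono)
  qed
  have "\<exists>y\<in>(- B). \<exists>y'\<in>(- B). \<bar>y - y'\<bar> \<ge> 1 / (4 * s)"
  proof (rule ccontr)
    assume no: "\<not> ?thesis"
    have "(\<integral>\<^sup>+y. ennreal (\<rho> y) * indicator (- B) y \<partial>lborel) \<le> ennreal (1/2)"
    proof (cases "- B = {}")
      case True then show ?thesis by simp
    next
      case False
      then obtain y0 where y0: "y0 \<in> - B" by auto
      \<comment> \<open>If all good values lay within \<open>w\<close> of one of them, their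
        probability would be at most \<open>2 * w * s\<close>, that is 1/2, short of 3/4.\<close>
      define w where "w = 1 / (4 * s)"
      have "(\<integral>\<^sup>+y. ennreal (\<rho> y) * indicator (- B) y \<partial>lborel) \<le>
          (\<integral>\<^sup>+y. ennreal s * indicator {y0-w..y0+w} y \<partial>lborel)"
      proof (rule nn_integral_mono)
        fix y
        show "ennreal (\<rho> y) * indicator (- B) y \<le> ennreal s * indicator {y0-w..y0+w} y"
        proof (cases "y \<in> - B")
          case True
          then have "\<bar>y - y0\<bar> < w" using no y0 unfolding w_def by force
          then have "y \<in> {y0-w..y0+w}" by auto
          then show ?thesis using True rho_le[of y] by (simp add: ennreal_leI)
        qed simp
      qed
      also have "\<dots> = ennreal s * ennreal (2 / (4 * s))"
        using s_pos by (simp add: nn_integral_cmult w_def)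
      also have "\<dots> = ennreal (1/2)" using s_pos by (simp add: ennreal_mult[symmetric])
      finally show ?thesis .
    qed
    then have "(1::ennreal) \<le> ennreal (1/4) + ennreal (1/2)" using split1 by (meson add_left_mono order_trans)
    then have "ennreal 1 \<le> ennreal (1/4 + 1/2)" by (subst ennreal_plus) auto
    then show False by (subst (asm) ennreal_le_iff) auto
  qed
  then obtain y y' where y: "y \<in> -B" "y' \<in> -B" "\<bar>y - y'\<bar> \<ge> 1 / (4 * s)" by blast
  have "shd g (y - y') = (\<integral>\<^sup>+z. ennreal ((g (z - y') - g (z - y))\<^sup>2) \<partial>lborel)"
    unfolding shd_def
    using nn_integral_shift[of "\<lambda>x. ennreal ((g (x + (y - y')) - g x)\<^sup>2)" "- y"] by (simp add: algebra_simps)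
  also have "\<dots> \<le> (\<integral>\<^sup>+z. 2 * ennreal ((g (z - y') - conv \<rho> g z)\<^sup>2) + 2 * ennreal ((g (z - y) - conv \<rho> g z)\<^sup>2) \<partial>lborel)"
  proof (rule nn_integral_mono)
    fix z
    have "(a - b)\<^sup>2 \<le> 2 * (a - c)\<^sup>2 + 2 * (b - c)\<^sup>2" for a b c :: real
      using zero_le_power2[of "a + b - 2 * c"] by (simp add: power2_eq_square algebra_simps)
    then have "ennreal ((g (z - y') - g (z - y))\<^sup>2) \<le> ennreal (2 * (g (z - y') - conv \<rho> g z)\<^sup>2 + 2 * (g (z - y) - conv \<rho> g z)\<^sup>2)"
      by (intro ennreal_leI) simp
    then show "ennreal ((g (z - y') - g (z - y))\<^sup>2) \<le> 2 * ennreal ((g (z - y') - conv \<rho> g z)\<^sup>2) + 2 * ennreal ((g (z - y) - conv \<rho> g z)\<^sup>2)"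
      by (simp add: ennreal_plus ennreal_mult)
  qed
  also have "\<dots> = 2 * H y' + 2 * H y" unfolding H_def
    by (subst nn_integral_add) (auto simp: nn_integral_cmult)
  also have "\<dots> \<le> 2 * ennreal (4 * \<theta>) + 2 * ennreal (4 * \<theta>)"
    using y by (intro add_mono mult_left_mono) (auto simp: B_def not_less)
  also have "\<dots> = ennreal (16 * \<theta>)"
  proof -
    have "ennreal (16 * \<theta>) = ennreal (2 * (4 * \<theta>) + 2 * (4 * \<theta>))" by simp
    also have "\<dots> = 2 * ennreal (4 * \<theta>) + 2 * ennreal (4 * \<theta>)"
      using \<theta> by (subst ennreal_plus) (auto simp: ennreal_mult)
    finally show ?thesis by simp
  qed
  finally show ?thesis using that y(3) by blast
qed

text \<open>A small deficit makes g almost invariant under some shift of order at least d, hence under multiples of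
  it beyond 2 M; sixteen disjoint translates of the interval then carry nearly the same mass.\<close>
lemma msq_le_deficit:
  assumes [measurable]: "g \<in> borel_measurable borel" and fin: "nsq g < \<infinity>"
    and M: "M \<ge> 1" and d: "0 < d" "d \<le> 1" and s: "s = S / d"
  shows "msq M g \<le> nsq g / 8 + ennreal (2 * 16^3 * (4 * S * (2 * M + 1) + 1)\<^sup>2 / d\<^sup>2) * deficit g"
proof -
  define B where "B = 4 * S * (2 * M + 1) + 1"
  have S: "S > 0" using s_pos s d by (simp add: zero_less_divide_iff)
  obtain G where G: "nsq g = ennreal G" "G \<ge> 0" using fin by (cases "nsq g") auto
  have dle: "deficit g \<le> nsq g" by (rule ennreal_summand_le(2)[OF nsq_conv[OF assms(1,2)]])
  then obtain D where D: "deficit g = ennreal D" "D \<ge> 0" using G by (cases "deficit g") (auto simp: top_unique)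
  have mle: "msq M g \<le> nsq g" unfolding msq_def nsq_def by (rule nn_integral_mono) (auto simp: indicator_def)
  then obtain m where m: "msq M g = ennreal m" "m \<ge> 0" using G by (cases "msq M g") (auto simp: top_unique)
  have main: "m \<le> G / 8 + 2 * 16^3 * (B\<^sup>2 / d\<^sup>2) * \<theta>" if \<theta>: "\<theta> > 0" "D \<le> \<theta>" for \<theta>
  proof -
    have "deficit g \<le> ennreal \<theta>" using D \<theta> by (simp add: ennreal_leI)
    then obtain t where t: "\<bar>t\<bar> \<ge> 1 / (4 * s)" "shd g t \<le> ennreal (16 * \<theta>)"
      using ex_good_shift[OF assms(1) \<theta>(1)] by blast
    have t0: "\<bar>t\<bar> > 0" using t(1) s_pos by (smt (verit) divide_pos_pos)
    \<comment> \<open>Enough steps to leave the window. The lower bound on the shift gives at most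
      \<open>B / d\<close> of them; the summand 1 in \<open>B\<close> pays for rounding up, as
      \<open>d\<close> is at most 1.\<close>
    define N where "N = nat \<lceil>(2 * M + 1) / \<bar>t\<bar>\<rceil>"
    have N1: "real N \<ge> (2 * M + 1) / \<bar>t\<bar>" unfolding N_def by linarith
    have N2: "real N \<le> (2 * M + 1) / \<bar>t\<bar> + 1"
    proof -
      have "(2 * M + 1) / \<bar>t\<bar> \<ge> 0" using M t0 by simp
      then show ?thesis unfolding N_def by linarith
    qed
    have "(2 * M + 1) / \<bar>t\<bar> \<le> (2 * M + 1) / (1 / (4 * s))"
      by (rule divide_left_mono[OF t(1)]) (use M t0 s_pos in auto)
    also have "\<dots> = 4 * S * (2 * M + 1) / d" using s by simp
    finally have "real N \<le> 4 * S * (2 * M + 1) / d + 1" using N2 by linarith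
    also have "\<dots> \<le> 4 * S * (2 * M + 1) / d + 1 / d" using d by simp
    also have "\<dots> = B / d" by (simp add: B_def add_divide_distrib)
    finally have NB: "real N \<le> B / d" .
    have big: "\<bar>real N * t\<bar> > 2 * M"
    proof -
      have "2 * M + 1 \<le> real N * \<bar>t\<bar>" using N1 t0 by (simp add: pos_divide_le_eq)
      then show ?thesis by (simp add: abs_mult)
    qed
    have sh: "shd g (real k * (real N * t)) \<le> ennreal (16\<^sup>2 * (B\<^sup>2 / d\<^sup>2) * (16 * \<theta>))" if "k < 16" for k
    proof -
      have "shd g (real k * (real N * t)) = shd g (real (k * N) * t)" by (simp add: mult.assoc)
      also have "\<dots> \<le> ennreal ((real (k * N))\<^sup>2) * shd g t" by (rule shd_multiple[OF assms(1)])
      also have "\<dots> \<le> ennreal (16\<^sup>2 * (B\<^sup>2 / d\<^sup>2)) * ennreal (16 * \<theta>)"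
      proof (intro mult_mono ennreal_leI t(2))
        have "real k * real N \<le> 16 * (B / d)" by (rule mult_mono) (use that NB in auto)
        then have "(real (k * N))\<^sup>2 \<le> (16 * (B / d))\<^sup>2" by (intro power_mono) auto
        then show "(real (k * N))\<^sup>2 \<le> 16\<^sup>2 * (B\<^sup>2 / d\<^sup>2)" by (simp only: power_mult_distrib power_divide)
      qed auto
      also have "\<dots> = ennreal (16\<^sup>2 * (B\<^sup>2 / d\<^sup>2) * (16 * \<theta>))"
        by (rule ennreal_mult[symmetric]) (use \<theta> in auto)
      finally show ?thesis .
    qed
    \<comment> \<open>Dividing by 16 at the end turns 2 into 1/8. The error has 16 terms, a factor
      \<open>16^2\<close> from the multiples below 16, a factor 16 from \<open>ex_good_shift\<close>
      and a factor 2, whence \<open>2 * 16^3\<close>.\<close>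
    have "of_nat 16 * msq M g \<le> 2 * nsq g + 2 * (\<Sum>k<16. shd g (real k * (real N * t)))"
      by (rule msq_le_shd[OF assms(1) big])
    also have "\<dots> \<le> 2 * nsq g + 2 * (\<Sum>k<(16::nat). ennreal (16\<^sup>2 * (B\<^sup>2 / d\<^sup>2) * (16 * \<theta>)))"
      by (intro add_mono mult_left_mono sum_mono sh) auto
    also have "\<dots> = ennreal (2 * G + 2 * (16 * (16\<^sup>2 * (B\<^sup>2 / d\<^sup>2) * (16 * \<theta>))))"
    proof -
      have gen: "2 * nsq g + 2 * (\<Sum>k<(16::nat). ennreal c) = ennreal (2 * G + 2 * (16 * c))" if "c \<ge> 0" for c
        using G that by (simp add: ennreal_plus ennreal_mult)
      show ?thesis by (rule gen) (use \<theta> in simp)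
    qed
    finally have "ennreal (16 * m) \<le> ennreal (2 * G + 2 * (16 * (16\<^sup>2 * (B\<^sup>2 / d\<^sup>2) * (16 * \<theta>))))"
      using m by (simp add: ennreal_mult)
    then have "16 * m \<le> 2 * G + 2 * (16 * (16\<^sup>2 * (B\<^sup>2 / d\<^sup>2) * (16 * \<theta>)))"
      using G \<theta> by (subst (asm) ennreal_le_iff) auto
    moreover have "16 * m \<le> 2 * G + 2 * (16 * (16\<^sup>2 * c * (16 * \<theta>))) \<Longrightarrow> m \<le> G / 8 + 2 * 16^3 * c * \<theta>" for c
      by (simp add: algebra_simps)
    ultimately show ?thesis by blast
  qed
  let ?c = "2 * 16^3 * (B\<^sup>2 / d\<^sup>2) :: real"
  have c0: "?c \<ge> 0" by simp
  \<comment> \<open>The deficit may be 0 while a shift is available only for positive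
    \<open>\<theta>\<close>, hence the passage to the limit.\<close>
  have "m \<le> G / 8 + ?c * D"
  proof (rule field_le_epsilon)
    fix e :: real assume e: "e > 0"
    have "m \<le> G / 8 + ?c * (D + e / (?c + 1))"
      by (rule main) (use D e c0 in \<open>auto intro!: add_nonneg_pos divide_pos_pos add_nonneg_nonneg divide_nonneg_nonneg\<close>)
    also have "?c * (D + e / (?c + 1)) = ?c * D + e * (?c / (?c + 1))" by (simp add: distrib_left)
    also have "e * (?c / (?c + 1)) \<le> e * 1"
    proof (rule mult_left_mono)
      have "x / (x + 1) \<le> 1" if "x \<ge> 0" for x :: real using that by simp
      then show "?c / (?c + 1) \<le> 1" using c0 by blast
    qed (use e in simp)
    finally show "m \<le> G / 8 + ?c * D + e" by simp
  qed
  then have "ennreal m \<le> ennreal (G / 8 + ?c * D)" by (rule ennreal_leI)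
  also have "\<dots> = ennreal G / 8 + ennreal ?c * ennreal D"
  proof -
    have "ennreal (G / 8 + c * D) = ennreal G / 8 + ennreal c * ennreal D" if "c \<ge> 0" for c
      using G D that by (simp add: ennreal_plus ennreal_mult ennreal_divide_numeral)
    then show ?thesis using c0 by blast
  qed
  finally show ?thesis using G D m by (simp add: B_def)
qed

end

section \<open>The inversion and the two-step contraction\<close>

text \<open>At \<open>z = zright j - \<omega> j\<close> and with coupling \<open>a (j - 1)\<close>,
  the argument of \<open>u\<close> is the next Riccati variable and the weight is the factor of
  \<open>decay\<close> at \<open>j\<close>. The weight is also the square root of the derivative of
  the inversion. At \<open>z = 0\<close> division by zero makes the value 0.\<close>

definition invol :: "real \<Rightarrow> real \<Rightarrow> (real \<Rightarrow> real) \<Rightarrow> real \<Rightarrow> real" where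
  "invol a E u z = a / \<bar>z\<bar> * u (E - a\<^sup>2 / z)"

lemma invol_measurable[measurable]:
  assumes [measurable]: "u \<in> borel_measurable borel"
  shows "invol a E u \<in> borel_measurable borel"
  unfolding invol_def[abs_def] by measurable

lemma invol_square: "(invol a E u z)\<^sup>2 = (a / \<bar>z\<bar>)\<^sup>2 * (u (E - a\<^sup>2 / z))\<^sup>2"
  by (simp only: invol_def power_mult_distrib)

text \<open>The map from \<open>z\<close> to \<open>E - a^2 / z\<close> is a bijection from the
  complement of 0 to the complement of \<open>E\<close>, with the displayed weight as derivative;
  the two omitted points are null.\<close>

lemma nn_integral_inversion:
  fixes F :: "real \<Rightarrow> real"
  assumes a: "a > 0" and [measurable]: "F \<in> borel_measurable borel" and F0: "\<And>x. F x \<ge> 0"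
    and fin: "(\<integral>\<^sup>+x. ennreal (F x) \<partial>lborel) < \<infinity>"
  shows "(\<integral>\<^sup>+z. ennreal ((a / \<bar>z\<bar>)\<^sup>2 * F (E - a\<^sup>2 / z)) \<partial>lborel) = (\<integral>\<^sup>+x. ennreal (F x) \<partial>lborel)"
proof -
  let ?S = "- {0::real}" and ?g = "\<lambda>z. E - a\<^sup>2 / z" and ?g' = "\<lambda>z. (a / \<bar>z\<bar>)\<^sup>2"
  have intF: "integrable lborel F"
    by (rule integrableI_nonneg) (use fin F0 in auto)
  then have intFl: "integrable lebesgue F" using integrable_completion[of F lborel] by simp
  have img: "?g ` ?S = - {E}"
  proof (intro equalityI subsetI)
    fix x assume x: "x \<in> - {E}"
    have "x = ?g (a\<^sup>2 / (E - x))" "a\<^sup>2 / (E - x) \<in> ?S" using x a by (auto simp: field_simps)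
    then show "x \<in> ?g ` ?S" by blast
  qed (use a in auto)
  have inj: "inj_on ?g ?S" using a by (auto simp: inj_on_def)
  have der: "(?g has_field_derivative ?g' z) (at z within ?S)" if "z \<in> ?S" for z
  proof -
    have "(?g has_real_derivative (0 - (0 * z - a\<^sup>2 * 1) / (z * z))) (at z)"
      by (intro DERIV_diff DERIV_const DERIV_divide DERIV_ident) (use that in simp)
    moreover have "0 - (0 * z - a\<^sup>2 * 1) / (z * z) = ?g' z" by (simp add: power2_eq_square)
    ultimately have "(?g has_real_derivative ?g' z) (at z)" by (simp only:)
    then show ?thesis by (rule has_field_derivative_at_within)
  qed
  have Fa: "F absolutely_integrable_on - {E}"
    unfolding set_integrable_def using integrable_mult_indicator[OF _ intFl, of "- {E}"] by simp
  have "(\<lambda>x. \<bar>?g' x\<bar> * F (?g x)) absolutely_integrable_on ?S \<and>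
     integral ?S (\<lambda>x. \<bar>?g' x\<bar> * F (?g x)) = integral (- {E}) F"
    using has_absolute_integral_change_of_variables_1'[OF _ der inj, of F "integral (- {E}) F"] Fa
    unfolding img by simp
  then have L: "(\<lambda>x. ?g' x * F (?g x)) absolutely_integrable_on ?S"
     "integral ?S (\<lambda>x. ?g' x * F (?g x)) = integral (- {E}) F" by simp_all
  have AE0: "AE x in lebesgue. x \<noteq> (c::real)" for c by (rule AE_completion) (rule AE_lborel_singleton)
  have "(\<integral>\<^sup>+z. ennreal (?g' z * F (?g z)) \<partial>lborel) = (\<integral>\<^sup>+z. ennreal (?g' z * F (?g z)) \<partial>lebesgue)"
    by (simp add: nn_integral_completion)
  also have "\<dots> = (\<integral>\<^sup>+z. ennreal (indicator ?S z *\<^sub>R (?g' z * F (?g z))) \<partial>lebesgue)"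
    by (rule nn_integral_cong_AE) (use AE0[of 0] in \<open>auto simp: indicator_def\<close>)
  also have "\<dots> = ennreal (integral\<^sup>L lebesgue (\<lambda>z. indicator ?S z *\<^sub>R (?g' z * F (?g z))))"
    by (rule nn_integral_eq_integral) (use L(1) F0 in \<open>auto simp: set_integrable_def\<close>)
  also have "integral\<^sup>L lebesgue (\<lambda>z. indicator ?S z *\<^sub>R (?g' z * F (?g z))) = integral ?S (\<lambda>x. ?g' x * F (?g x))"
    using set_lebesgue_integral_eq_integral(2)[OF L(1)] by (simp add: set_lebesgue_integral_def)
  also have "\<dots> = integral (- {E}) F" by (rule L(2))
  also have "\<dots> = integral\<^sup>L lebesgue (\<lambda>z. indicator (- {E}) z *\<^sub>R F z)"
    using set_lebesgue_integral_eq_integral(2)[OF Fa] by (simp add: set_lebesgue_integral_def)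
  also have "ennreal \<dots> = (\<integral>\<^sup>+z. ennreal (indicator (- {E}) z *\<^sub>R F z) \<partial>lebesgue)"
    by (rule nn_integral_eq_integral[symmetric]) (use Fa F0 in \<open>auto simp: set_integrable_def\<close>)
  also have "\<dots> = (\<integral>\<^sup>+z. ennreal (F z) \<partial>lebesgue)"
    by (rule nn_integral_cong_AE, rule eventually_mono[OF AE0[of E]]) (simp add: indicator_def)
  finally show ?thesis by (simp add: nn_integral_completion)
qed

lemma nsq_invol:
  assumes a: "a > 0" and [measurable]: "u \<in> borel_measurable borel" and fin: "nsq u < \<infinity>"
  shows "nsq (invol a E u) = nsq u"
  using nn_integral_inversion[OF a, of "\<lambda>x. (u x)\<^sup>2" E] fin
  by (simp add: nsq_def invol_square)

text \<open>The inversion exchanges a neighbourhood of \<^term>\<open>E\<close> with a neighbourhood of infinity, so the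
  mass of \<^term>\<open>u\<close> is bounded by that of \<^term>\<open>u\<close> near \<^term>\<open>E\<close> plus that of its image near the origin.\<close>
lemma nsq_le_msq_invol:
  assumes a: "a > 0" and [measurable]: "u \<in> borel_measurable borel" and fin: "nsq u < \<infinity>" and M: "M > 0"
    and r: "r > a\<^sup>2 / M"
  shows "nsq u \<le> (\<integral>\<^sup>+x. ennreal ((u x)\<^sup>2) * indicator {E-r..E+r} x \<partial>lborel) + msq M (invol a E u)"
proof -
  let ?F = "\<lambda>x. (u x)\<^sup>2 * indicator (- {E-r..E+r}) x"
  have "(\<integral>\<^sup>+x. ennreal (?F x) \<partial>lborel) \<le> nsq u"
    unfolding nsq_def by (rule nn_integral_mono) (auto simp: indicator_def)
  then have finF: "(\<integral>\<^sup>+x. ennreal (?F x) \<partial>lborel) < \<infinity>" using fin by order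
  have "nsq u = (\<integral>\<^sup>+x. ennreal ((u x)\<^sup>2) * indicator {E-r..E+r} x + ennreal (?F x) \<partial>lborel)"
    unfolding nsq_def by (intro nn_integral_cong) (auto simp: indicator_def)
  also have "\<dots> = (\<integral>\<^sup>+x. ennreal ((u x)\<^sup>2) * indicator {E-r..E+r} x \<partial>lborel) + (\<integral>\<^sup>+x. ennreal (?F x) \<partial>lborel)"
    by (rule nn_integral_add) measurable
  finally have split: "nsq u = (\<integral>\<^sup>+x. ennreal ((u x)\<^sup>2) * indicator {E-r..E+r} x \<partial>lborel) + (\<integral>\<^sup>+x. ennreal (?F x) \<partial>lborel)" .
  have "(\<integral>\<^sup>+x. ennreal (?F x) \<partial>lborel) = (\<integral>\<^sup>+z. ennreal ((a / \<bar>z\<bar>)\<^sup>2 * ?F (E - a\<^sup>2 / z)) \<partial>lborel)"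
    by (rule nn_integral_inversion[symmetric, OF a _ _ finF]) auto
  also have "\<dots> \<le> msq M (invol a E u)"
    unfolding msq_def
  proof (rule nn_integral_mono)
    fix z
    show "ennreal ((a / \<bar>z\<bar>)\<^sup>2 * ?F (E - a\<^sup>2 / z)) \<le> ennreal ((invol a E u z)\<^sup>2) * indicator {-M..M} z"
    proof (cases "\<bar>z\<bar> \<le> M")
      case True
      then have "z \<in> {-M..M}" by auto
      then show ?thesis
        by (simp only: invol_square) (auto simp: indicator_def intro!: ennreal_leI)
    next
      case False
      then have "\<bar>a\<^sup>2 / z\<bar> \<le> a\<^sup>2 / M" using M by (simp add: frac_le)
      then have "\<bar>a\<^sup>2 / z\<bar> < r" using r by linarith
      then have "E - a\<^sup>2 / z \<in> {E-r..E+r}" unfolding atLeastAtMost_iff by linarith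
      then show ?thesis by simp
    qed
  qed
  finally show ?thesis unfolding split by (rule add_left_mono)
qed

text \<open>Jensen's inequality localises: near \<open>E\<close> the convolution reads
  \<open>g\<close> only at distance at most \<open>b\<close>, hence inside the window of half-width
  \<open>M\<close>.\<close>

lemma (in bdd_density) conv_local_mass:
  assumes [measurable]: "g \<in> borel_measurable borel" and fin: "nsq g < \<infinity>"
    and supp: "\<And>y. \<bar>y\<bar> > b \<Longrightarrow> \<rho> y = 0" and M: "\<bar>E\<bar> + r + b \<le> M"
  shows "(\<integral>\<^sup>+x. ennreal ((conv \<rho> g x)\<^sup>2) * indicator {E-r..E+r} x \<partial>lborel) \<le> msq M g"
proof -
  have "(\<integral>\<^sup>+x. ennreal ((conv \<rho> g x)\<^sup>2) * indicator {E-r..E+r} x \<partial>lborel)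
    \<le> (\<integral>\<^sup>+x. (\<integral>\<^sup>+y. ennreal (\<rho> y) * (ennreal ((g (x - y))\<^sup>2) * indicator {-M..M} (x - y)) \<partial>lborel) \<partial>lborel)"
  proof (rule nn_integral_mono)
    fix x
    show "ennreal ((conv \<rho> g x)\<^sup>2) * indicator {E-r..E+r} x \<le>
       (\<integral>\<^sup>+y. ennreal (\<rho> y) * (ennreal ((g (x - y))\<^sup>2) * indicator {-M..M} (x - y)) \<partial>lborel)"
    proof (cases "x \<in> {E-r..E+r}")
      case True
      have "ennreal ((conv \<rho> g x)\<^sup>2) \<le> (\<integral>\<^sup>+y. ennreal (\<rho> y * (g (x - y))\<^sup>2) \<partial>lborel)"
        by (rule ennreal_summand_le(1)[OF conv_variance[OF assms(1,2)]])
      also have "\<dots> \<le> (\<integral>\<^sup>+y. ennreal (\<rho> y) * (ennreal ((g (x - y))\<^sup>2) * indicator {-M..M} (x - y)) \<partial>lborel)"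
      proof (rule nn_integral_mono)
        fix y
        show "ennreal (\<rho> y * (g (x - y))\<^sup>2) \<le> ennreal (\<rho> y) * (ennreal ((g (x - y))\<^sup>2) * indicator {-M..M} (x - y))"
        proof (cases "\<bar>y\<bar> > b")
          case False
          then have "x - y \<in> {-M..M}" using True M by (auto simp: abs_if split: if_splits)
          then show ?thesis by (simp add: ennreal_mult rho_nonneg)
        qed (simp add: supp)
      qed
      finally show ?thesis using True by simp
    qed simp
  qed
  also have "\<dots> = (\<integral>\<^sup>+y. (\<integral>\<^sup>+x. ennreal (\<rho> y) * (ennreal ((g (x - y))\<^sup>2) * indicator {-M..M} (x - y)) \<partial>lborel) \<partial>lborel)"
    by (rule lborel_pair.Fubini'[symmetric]) measurable
  also have "\<dots> = (\<integral>\<^sup>+y. ennreal (\<rho> y) * msq M g \<partial>lborel)"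
  proof (intro nn_integral_cong)
    fix y
    have "(\<integral>\<^sup>+x. ennreal (\<rho> y) * (ennreal ((g (x - y))\<^sup>2) * indicator {-M..M} (x - y)) \<partial>lborel)
      = ennreal (\<rho> y) * (\<integral>\<^sup>+x. ennreal ((g (x - y))\<^sup>2) * indicator {-M..M} (x - y) \<partial>lborel)"
      by (rule nn_integral_cmult) measurable
    also have "(\<integral>\<^sup>+x. ennreal ((g (x - y))\<^sup>2) * indicator {-M..M} (x - y) \<partial>lborel) = msq M g"
      using nn_integral_shift[of "\<lambda>x. ennreal ((g x)\<^sup>2) * indicator {-M..M} x" "- y"] by (simp add: msq_def)
    finally show "(\<integral>\<^sup>+x. ennreal (\<rho> y) * (ennreal ((g (x - y))\<^sup>2) * indicator {-M..M} (x - y)) \<partial>lborel)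
      = ennreal (\<rho> y) * msq M g" .
  qed
  also have "\<dots> = msq M g" by (subst nn_integral_multc) (auto simp: rho_int)
  finally show ?thesis .
qed

text \<open>If both deficits were small, \<open>g\<close> and the inverted function would each have
  little mass in the window. But the two window masses together dominate the whole norm after the
  first convolution, so one of the convolutions must lose mass of order \<open>d^2\<close>.\<close>

lemma two_step_contraction:
  fixes S M :: real
  defines "K \<equiv> 2 * 16^3 * (4 * S * (2 * M + 1) + 1)\<^sup>2"
  assumes r1: "bdd_density \<rho>1 (S / d)" and r2: "bdd_density \<rho>2 (S / d)"
    and d: "0 < d" "d \<le> 1" and a: "0 < a" "a \<le> A"
    and supp: "\<And>y. \<bar>y\<bar> > b \<Longrightarrow> \<rho>1 y = 0" and b: "b \<ge> 0" and E: "\<bar>E\<bar> \<le> R"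
    and M: "M \<ge> R + A\<^sup>2 + b + 1"
    and [measurable]: "g \<in> borel_measurable borel" and fin: "nsq g < \<infinity>"
  shows "nsq (conv \<rho>2 (invol a E (conv \<rho>1 g))) \<le> ennreal (1 - 3 / (4 * (K + 1)) * d\<^sup>2) * nsq g"
proof -
  interpret r1: bdd_density \<rho>1 "S / d" by (rule r1)
  interpret r2: bdd_density \<rho>2 "S / d" by (rule r2)
  let ?u = "conv \<rho>1 g" and ?w = "invol a E (conv \<rho>1 g)"
  let ?h = "conv \<rho>2 ?w"
  have M1: "M \<ge> 1" using M b E by (smt (verit) zero_le_power2)
  have e1: "nsq ?u + r1.deficit g = nsq g" by (rule r1.nsq_conv[OF _ fin]) measurable
  have ule: "nsq ?u \<le> nsq g" by (rule ennreal_summand_le(1)[OF e1])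
  then have finu: "nsq ?u < \<infinity>" using fin by order
  have wu: "nsq ?w = nsq ?u" by (rule nsq_invol[OF a(1) _ finu]) measurable
  have finw: "nsq ?w < \<infinity>" using wu finu by simp
  have e2: "nsq ?h + r2.deficit ?w = nsq ?u" using r2.nsq_conv[OF _ finw] wu by simp
  have m1: "msq M g \<le> nsq g / 8 + ennreal (K / d\<^sup>2) * r1.deficit g"
    unfolding K_def using r1.msq_le_deficit[OF _ fin M1 d refl] by simp
  have m2: "msq M ?w \<le> nsq ?u / 8 + ennreal (K / d\<^sup>2) * r2.deficit ?w"
    unfolding K_def using r2.msq_le_deficit[OF _ finw M1 d refl] wu by simp
  \<comment> \<open>Just above the threshold \<open>a^2 / M\<close>, and at most
    \<open>A^2 + 1\<close> because \<open>M\<close> is at least 1; this explains the lower bound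
    imposed on \<open>M\<close>.\<close>
  define r where "r = a\<^sup>2 / M + 1"
  have "a\<^sup>2 / M \<le> a\<^sup>2" using M1 by (simp add: divide_le_eq mult_le_cancel_left1 power2_eq_square)
  also have "a\<^sup>2 \<le> A\<^sup>2" using a by (intro power_mono) auto
  finally have rM: "\<bar>E\<bar> + r + b \<le> M" using M E by (simp add: r_def)
  have "nsq ?u \<le> (\<integral>\<^sup>+x. ennreal ((?u x)\<^sup>2) * indicator {E-r..E+r} x \<partial>lborel) + msq M ?w"
    by (rule nsq_le_msq_invol[OF a(1) _ finu]) (use M1 in \<open>auto simp: r_def\<close>)
  also have "\<dots> \<le> msq M g + msq M ?w"
    by (intro add_mono r1.conv_local_mass[OF _ fin supp rM]) auto
  finally have t: "nsq ?u \<le> msq M g + msq M ?w" .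
  obtain G where G: "nsq g = ennreal G" "G \<ge> 0" using fin by (cases "nsq g") auto
  obtain U where U: "nsq ?u = ennreal U" "U \<ge> 0" using finu by (cases "nsq ?u") auto
  have "nsq ?h \<le> nsq ?u" by (rule ennreal_summand_le(1)[OF e2])
  then obtain h where h: "nsq ?h = ennreal h" "h \<ge> 0" using U by (cases "nsq ?h") (auto simp: top_unique)
  obtain D1 where D1: "r1.deficit g = ennreal D1" "D1 \<ge> 0" using e1 G by (cases "r1.deficit g") auto
  obtain D2 where D2: "r2.deficit ?w = ennreal D2" "D2 \<ge> 0" using e2 U by (cases "r2.deficit ?w") auto
  have K0: "K / d\<^sup>2 \<ge> 0" "K \<ge> 0" by (auto simp: K_def)
  have E1: "U + D1 = G" using e1 G U D1 by (simp add: ennreal_plus[symmetric] del: ennreal_plus)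
  have E2: "h + D2 = U" using e2 U h D2 by (simp add: ennreal_plus[symmetric] del: ennreal_plus)
  have "ennreal U \<le> (ennreal G / 8 + ennreal (K / d\<^sup>2) * ennreal D1) + (ennreal U / 8 + ennreal (K / d\<^sup>2) * ennreal D2)"
    using order_trans[OF t add_mono[OF m1 m2]] by (simp only: G U D1 D2)
  also have "\<dots> = ennreal ((G / 8 + K / d\<^sup>2 * D1) + (U / 8 + K / d\<^sup>2 * D2))"
  proof -
    have "(ennreal G / 8 + ennreal c * ennreal D1) + (ennreal U / 8 + ennreal c * ennreal D2)
      = ennreal ((G / 8 + c * D1) + (U / 8 + c * D2))" if "c \<ge> 0" for c
      using G U D1 D2 that by (simp add: ennreal_plus ennreal_mult ennreal_divide_numeral)
    then show ?thesis using K0 by blast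
  qed
  finally have "U \<le> (G / 8 + K / d\<^sup>2 * D1) + (U / 8 + K / d\<^sup>2 * D2)"
    by (subst (asm) ennreal_le_iff) (use G U D1 D2 K0 in auto)
  \<comment> \<open>Replacing \<open>U\<close> by \<open>G - D1\<close> leaves 1 - 1/8 - 1/8 of
    \<open>G\<close> on the left.\<close>
  then have 1: "3/4 * G \<le> K / d\<^sup>2 * (D1 + D2) + 7/8 * D1"
  proof -
    have "K / d\<^sup>2 * (D1 + D2) = K / d\<^sup>2 * D1 + K / d\<^sup>2 * D2" by (rule distrib_left)
    moreover assume "U \<le> (G / 8 + K / d\<^sup>2 * D1) + (U / 8 + K / d\<^sup>2 * D2)"
    ultimately show ?thesis using E1 by linarith
  qed
  have d2: "d\<^sup>2 > 0" "d\<^sup>2 \<le> 1" using d by (auto simp: power_le_one)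
  \<comment> \<open>The leftover term is absorbed at the price \<open>1 / d^2\<close>, which turns
    \<open>K\<close> into \<open>K + 1\<close>.\<close>
  have "7/8 * D1 \<le> (1 / d\<^sup>2) * (D1 + D2)"
  proof -
    have "7/8 * D1 \<le> 1 * (D1 + D2)" using D1 D2 by simp
    also have "\<dots> \<le> (1 / d\<^sup>2) * (D1 + D2)"
      by (rule mult_right_mono) (use d2 D1 D2 in auto)
    finally show ?thesis .
  qed
  then have "3/4 * G \<le> K / d\<^sup>2 * (D1 + D2) + (1 / d\<^sup>2) * (D1 + D2)"
    by (rule order_trans[OF 1 add_left_mono])
  then have "3/4 * G \<le> (K + 1) / d\<^sup>2 * (D1 + D2)"
    by (simp only: add_divide_distrib distrib_right)
  then have "3/4 * G * d\<^sup>2 \<le> (K + 1) * (D1 + D2)" using d2 by (simp add: field_simps)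
  then have "3 / (4 * (K + 1)) * d\<^sup>2 * G \<le> D1 + D2" using K0 by (simp add: field_simps)
  then have hG: "h \<le> (1 - 3 / (4 * (K + 1)) * d\<^sup>2) * G" using E1 E2 by (simp add: left_diff_distrib)
  have "3 / (4 * (K + 1)) \<le> 1" using K0 by (simp add: field_simps)
  then have "3 / (4 * (K + 1)) * d\<^sup>2 \<le> 1 * 1" using d2 K0 by (intro mult_mono) auto
  then have "ennreal ((1 - 3 / (4 * (K + 1)) * d\<^sup>2) * G) = ennreal (1 - 3 / (4 * (K + 1)) * d\<^sup>2) * ennreal G"
    using G by (intro ennreal_mult) auto
  then show ?thesis using hG G h by (metis ennreal_leI)
qed

section \<open>The random model\<close>

lemma ric_measurable_comp[measurable (raw)]:
  assumes [measurable]: "e \<in> borel_measurable N" "\<And>i. (\<lambda>x. B x i) \<in> borel_measurable N"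
  shows "(\<lambda>x. ric \<alpha> (B x) k (e x)) \<in> borel_measurable N"
  by (induction k) auto

lemma decay_step:
  "j \<le> q \<Longrightarrow> decay L a \<omega> (j - 1) q E = a (j - 1) / \<bar>zright L a \<omega> j E - \<omega> j\<bar> * decay L a \<omega> j q E"
proof -
  assume "j \<le> q"
  then have "{j - 1 + 1..q} = insert j {j + 1..q}" by auto
  then show ?thesis by (simp add: decay_def)
qed

lemma decay_cong:
  assumes "\<And>i. i > j \<Longrightarrow> \<omega> i = \<omega>' i"
  shows "decay L a \<omega> j q E = decay L a \<omega>' j q E"
  unfolding decay_def
proof (rule prod.cong)
  fix i assume i: "i \<in> {j + 1..q}"
  then have "zright L a \<omega> i E = zright L a \<omega>' i E" by (intro zright_cong) (use assms in auto)
  then show "a (i - 1) / \<bar>zright L a \<omega> i E - \<omega> i\<bar> = a (i - 1) / \<bar>zright L a \<omega>' i E - \<omega>' i\<bar>"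
    using assms[of i] i by simp
qed simp

text \<open>Shifts and scalings of the single-site density are forgotten: what remains is one
  support bound \<open>b\<close> for all sites and the height \<open>S / d j\<close> at each
  site.\<close>

locale anderson_model =
  fixes \<rho> :: "int \<Rightarrow> real \<Rightarrow> real" and a d :: "int \<Rightarrow> real" and S b A :: real
  assumes dens: "\<And>j. bdd_density (\<rho> j) (S / d j)"
    and supp: "\<And>j y. \<bar>y\<bar> > b \<Longrightarrow> \<rho> j y = 0" and b0: "b \<ge> 0"
    and d_pos: "\<And>j. 0 < d j" and d_le: "\<And>j. d j \<le> 1"
    and a_pos: "\<And>n. a n > 0" and a_le: "\<And>n. a n \<le> A"
begin

definition site_measure :: "int \<Rightarrow> real measure" where
  "site_measure j = density lborel (\<lambda>x. ennreal (\<rho> j x))"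

definition \<mu> :: "(int \<Rightarrow> real) measure" where
  "\<mu> = (\<Pi>\<^sub>M j\<in>UNIV. site_measure j)"

lemma rho_measurable[measurable]: "\<rho> j \<in> borel_measurable borel"
  by (rule bdd_density.rho_meas[OF dens])

lemma S_pos: "S > 0"
  using bdd_density.s_pos[OF dens[of 0]] d_pos[of 0] by (simp add: zero_less_divide_iff)

lemma sets_site_measure[measurable_cong]: "sets (site_measure j) = sets borel"
  by (simp add: site_measure_def)

lemma prob_space_site_measure: "prob_space (site_measure j)"
  by (rule prob_spaceI)
    (simp add: site_measure_def emeasure_density bdd_density.rho_int[OF dens])

lemma prob_space_mu: "prob_space \<mu>"
  unfolding \<mu>_def by (rule prob_space_PiM) (rule prob_space_site_measure)

lemma coord_measurable: "(\<lambda>\<omega>. \<omega> j) \<in> borel_measurable \<mu>"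
proof -
  have "(\<lambda>\<omega>. \<omega> j) \<in> measurable \<mu> (site_measure j)"
    unfolding \<mu>_def by (rule measurable_component_singleton) simp
  then show ?thesis by (simp add: measurable_cong_sets[OF refl sets_site_measure])
qed

text \<open>Replacing one coordinate by an independent copy preserves the product measure. Keeping
  the outer integral over all coordinates avoids splitting the index set, although the inner
  integral ignores the old value at \<open>p\<close>.\<close>

lemma nn_integral_resample:
  assumes f[measurable]: "f \<in> borel_measurable \<mu>"
  shows "(\<integral>\<^sup>+\<omega>. f \<omega> \<partial>\<mu>) = (\<integral>\<^sup>+\<omega>. (\<integral>\<^sup>+y. ennreal (\<rho> p y) * f (fun_upd \<omega> p y) \<partial>lborel) \<partial>\<mu>)"
proof -
  interpret P: prob_space "site_measure p" by (rule prob_space_site_measure)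
  interpret Q: prob_space \<mu> by (rule prob_space_mu)
  interpret PQ: pair_sigma_finite "site_measure p" \<mu> ..
  have upd: "(\<lambda>x. fun_upd (snd x) p (fst x)) \<in> measurable (site_measure p \<Otimes>\<^sub>M \<mu>) \<mu>"
    unfolding \<mu>_def by (rule measurable_fun_upd[where J = UNIV]) auto
  have eq: "distr (site_measure p \<Otimes>\<^sub>M \<mu>) \<mu> (\<lambda>x. fun_upd (snd x) p (fst x)) = \<mu>"
    using distr_pair_PiM_eq_PiM[of UNIV site_measure p] prob_space_site_measure
    by (simp add: \<mu>_def case_prod_beta')
  have "(\<integral>\<^sup>+\<omega>. f \<omega> \<partial>\<mu>) = (\<integral>\<^sup>+x. f (fun_upd (snd x) p (fst x)) \<partial>(site_measure p \<Otimes>\<^sub>M \<mu>))"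
    by (subst eq[symmetric], rule nn_integral_distr[OF upd]) (simp add: eq)
  also have "\<dots> = (\<integral>\<^sup>+\<omega>. (\<integral>\<^sup>+y. f (fun_upd \<omega> p y) \<partial>site_measure p) \<partial>\<mu>)"
    using PQ.nn_integral_snd[of "\<lambda>x. f (fun_upd (snd x) p (fst x))"] measurable_compose[OF upd f] by simp
  also have "\<dots> = (\<integral>\<^sup>+\<omega>. (\<integral>\<^sup>+y. ennreal (\<rho> p y) * f (fun_upd \<omega> p y) \<partial>lborel) \<partial>\<mu>)"
  proof (rule nn_integral_cong)
    fix \<omega> assume w: "\<omega> \<in> space \<mu>"
    have "(\<lambda>y. f (fun_upd \<omega> p y)) \<in> borel_measurable (site_measure p)"
      using measurable_compose[OF measurable_Pair2'[OF w] measurable_compose[OF upd f]] by simp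
    then have "(\<lambda>y. f (fun_upd \<omega> p y)) \<in> borel_measurable borel"
      by (simp add: measurable_cong_sets[OF sets_site_measure refl])
    then show "(\<integral>\<^sup>+y. f (fun_upd \<omega> p y) \<partial>site_measure p) = (\<integral>\<^sup>+y. ennreal (\<rho> p y) * f (fun_upd \<omega> p y) \<partial>lborel)"
      unfolding site_measure_def by (intro nn_integral_density) auto
  qed
  finally show ?thesis .
qed

section \<open>Transfer operators along the chain\<close>

text \<open>With \<open>l = E - zleft p E\<close>, the argument of the density at \<open>p\<close>
  is \<open>zright p E - l\<close>. After \<open>n\<close> steps, evaluation at the Riccati variable
  of site \<open>p + n\<close> gives what remains after integrating over the sites
  \<open>p + 1\<close> to \<open>p + n\<close>, the later decay factors being kept apart.\<close>

primrec chain_fun :: "real \<Rightarrow> int \<Rightarrow> real \<Rightarrow> nat \<Rightarrow> real \<Rightarrow> real" where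
  "chain_fun E p l 0 = (\<lambda>z. \<rho> p (z - l))"
| "chain_fun E p l (Suc n) = conv (\<rho> (p + int n + 1)) (invol (a (p + int n)) E (chain_fun E p l n))"

lemma chain_fun_measurable[measurable]: "chain_fun E p l n \<in> borel_measurable borel"
proof (induction n)
  case (Suc n)
  then show ?case by (simp add: bdd_density.conv_measurable[OF dens])
qed simp

text \<open>Joint measurability is required because \<open>l\<close> is random too: it depends on
  the potential to the left of \<open>p\<close>.\<close>

lemma chain_fun_measurable_pair: "(\<lambda>(l, z). chain_fun E p l n z) \<in> borel_measurable (borel \<Otimes>\<^sub>M borel)"
proof (induction n)
  case 0
  show ?case by simp
next
  case (Suc n)
  have [measurable]: "(\<lambda>x::(real \<times> real) \<times> real. chain_fun E p (fst (fst x)) n (E - (a (p + int n))\<^sup>2 / (snd (fst x) - snd x)))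
     \<in> borel_measurable ((borel \<Otimes>\<^sub>M borel) \<Otimes>\<^sub>M lborel)"
  proof -
    have "(\<lambda>x::(real \<times> real) \<times> real. (fst (fst x), E - (a (p + int n))\<^sup>2 / (snd (fst x) - snd x)))
       \<in> measurable ((borel \<Otimes>\<^sub>M borel) \<Otimes>\<^sub>M lborel) (borel \<Otimes>\<^sub>M borel)" by measurable
    from measurable_compose[OF this Suc] show ?thesis by simp
  qed
  have "(\<lambda>x::real \<times> real. \<integral>y. \<rho> (p + int n + 1) y * (a (p + int n) / \<bar>snd x - y\<bar> *
      chain_fun E p (fst x) n (E - (a (p + int n))\<^sup>2 / (snd x - y))) \<partial>lborel) \<in> borel_measurable (borel \<Otimes>\<^sub>M borel)"
    by (rule lborel.borel_measurable_lebesgue_integral) (simp add: case_prod_beta')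
  then show ?case by (simp add: conv_def invol_def case_prod_beta')
qed

lemma chain_fun_comp:
  assumes "f \<in> borel_measurable N" "g \<in> borel_measurable N"
  shows "(\<lambda>x. chain_fun E p (f x) n (g x)) \<in> borel_measurable N"
  using measurable_compose[OF measurable_Pair[OF assms] chain_fun_measurable_pair[of E p n]] by simp

lemma chain_fun_nonneg: "chain_fun E p l n z \<ge> 0"
proof (induction n arbitrary: z)
  case 0
  show ?case by (simp add: bdd_density.rho_nonneg[OF dens])
next
  case (Suc n)
  have "invol (a (p + int n)) E (chain_fun E p l n) x \<ge> 0" for x
    using Suc a_pos[of "p + int n"] by (simp add: invol_def)
  then show ?case by (simp add: bdd_density.conv_nonneg[OF dens])
qed

lemma nsq_chain_fun_0: "nsq (chain_fun E p l 0) \<le> ennreal (S / d p)"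
proof -
  interpret D: bdd_density "\<rho> p" "S / d p" by (rule dens)
  have "nsq (chain_fun E p l 0) = (\<integral>\<^sup>+z. ennreal ((\<rho> p z)\<^sup>2) \<partial>lborel)"
    using nn_integral_shift[of "\<lambda>z. ennreal ((\<rho> p z)\<^sup>2)" "- l"] by (simp add: nsq_def)
  also have "\<dots> \<le> (\<integral>\<^sup>+z. ennreal (S / d p) * ennreal (\<rho> p z) \<partial>lborel)"
  proof (rule nn_integral_mono)
    fix z
    have "(\<rho> p z)\<^sup>2 \<le> S / d p * \<rho> p z"
      using mult_right_mono[OF D.rho_le[of z] D.rho_nonneg[of z]] by (simp add: power2_eq_square)
    then have "ennreal ((\<rho> p z)\<^sup>2) \<le> ennreal (S / d p * \<rho> p z)" by (rule ennreal_leI)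
    also have "\<dots> = ennreal (S / d p) * ennreal (\<rho> p z)"
      by (rule ennreal_mult) (use D.s_pos D.rho_nonneg in auto)
    finally show "ennreal ((\<rho> p z)\<^sup>2) \<le> ennreal (S / d p) * ennreal (\<rho> p z)" .
  qed
  also have "\<dots> = ennreal (S / d p)" by (subst nn_integral_cmult) (auto simp: D.rho_int)
  finally show ?thesis .
qed

lemma nsq_chain_fun_Suc:
  assumes fin: "nsq (chain_fun E p l n) < \<infinity>"
  shows "nsq (chain_fun E p l (Suc n)) \<le> nsq (chain_fun E p l n)"
proof -
  let ?w = "invol (a (p + int n)) E (chain_fun E p l n)"
  have w: "nsq ?w = nsq (chain_fun E p l n)"
    by (rule nsq_invol[OF a_pos _ fin]) measurable
  then have "nsq (conv (\<rho> (p + int n + 1)) ?w) + bdd_density.deficit (\<rho> (p + int n + 1)) ?w = nsq ?w"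
    using fin by (intro bdd_density.nsq_conv[OF dens]) auto
  from ennreal_summand_le(1)[OF this] show ?thesis by (simp add: w)
qed

lemma nsq_chain_fun_finite: "nsq (chain_fun E p l n) < \<infinity>"
proof (induction n)
  case 0
  show ?case using nsq_chain_fun_0[of E p l] by (rule le_less_trans) simp
next
  case (Suc n)
  show ?case using nsq_chain_fun_Suc[OF Suc] Suc by (rule le_less_trans)
qed

text \<open>Every transfer step is a contraction in the weak sense; this covers the steps that are
  not grouped into pairs.\<close>

lemma nsq_chain_fun_antimono: "k \<le> n \<Longrightarrow> nsq (chain_fun E p l n) \<le> nsq (chain_fun E p l k)"
proof (induction n rule: dec_induct)
  case (step n)
  show ?case by (rule order_trans[OF nsq_chain_fun_Suc[OF nsq_chain_fun_finite] step.IH])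
qed simp

text \<open>The coefficient of \<open>d^2\<close> in \<open>two_step_contraction\<close> for the
  smallest admissible window \<open>M = R + A^2 + b + 1\<close>. It is uniform over energies of
  modulus at most \<open>R\<close> and over all boxes.\<close>

definition rate :: "real \<Rightarrow> real" where
  "rate R = 3 / (4 * (2 * 16^3 * (4 * S * (2 * (R + A\<^sup>2 + b + 1) + 1) + 1)\<^sup>2 + 1))"

lemma rate_pos: "rate R > 0" and rate_le_1: "rate R \<le> 1"
proof -
  have nn: "2 * 16^3 * (4 * S * (2 * (R + A\<^sup>2 + b + 1) + 1) + 1)\<^sup>2 \<ge> (0::real)" by simp
  have gen: "3 / (4 * (x + 1)) > 0" "3 / (4 * (x + 1)) \<le> 1" if "x \<ge> 0" for x :: real
    using that by (simp_all add: divide_le_eq)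
  show "rate R > 0" "rate R \<le> 1" unfolding rate_def by (rule gen[OF nn])+
qed

lemma nsq_chain_fun_decay:
  assumes D: "0 < D" "\<And>j. p < j \<Longrightarrow> j \<le> p + 2 * int k \<Longrightarrow> D \<le> d j" "D \<le> 1" and E: "\<bar>E\<bar> \<le> R"
  shows "nsq (chain_fun E p l (2 * k)) \<le> ennreal ((1 - rate R * D\<^sup>2) ^ k * (S / d p))"
  using D(2)
proof (induction k)
  case 0
  then show ?case using nsq_chain_fun_0[of E p l] by simp
next
  case (Suc k)
  let ?n = "2 * k"
  let ?g = "invol (a (p + int ?n)) E (chain_fun E p l ?n)"
  have IH: "nsq (chain_fun E p l ?n) \<le> ennreal ((1 - rate R * D\<^sup>2) ^ k * (S / d p))"
    by (rule Suc.IH) (use Suc.prems in auto)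
  have bd: "bdd_density (\<rho> j) (S / D)" if "p < j" "j \<le> p + 2 * int (Suc k)" for j
  proof -
    interpret J: bdd_density "\<rho> j" "S / d j" by (rule dens)
    have "S / d j \<le> S / D" using Suc.prems[OF that] D S_pos by (intro divide_left_mono) (auto simp: d_pos)
    then show ?thesis using J.rho_le J.rho_nonneg J.rho_int by unfold_locales (auto intro: order_trans)
  qed
  \<comment> \<open>The inversion in front of the first convolution is isometric, so after it two
    transfer steps are exactly the operator of \<open>two_step_contraction\<close>. Both densities
    were weakened to the common height \<open>S / D\<close> for this purpose.\<close>
  have g: "nsq ?g = nsq (chain_fun E p l ?n)"
    by (rule nsq_invol[OF a_pos _ nsq_chain_fun_finite]) measurable
  have c: "0 \<le> 1 - rate R * D\<^sup>2"
  proof -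
    have "rate R * D\<^sup>2 \<le> 1 * 1" using rate_le_1[of R] rate_pos[of R] D
      by (intro mult_mono) (auto simp: power_le_one)
    then show ?thesis by simp
  qed
  have idx: "p + int (Suc ?n) = p + int ?n + 1" by simp
  have "nsq (chain_fun E p l (2 * Suc k)) =
     nsq (conv (\<rho> (p + int (Suc ?n) + 1)) (invol (a (p + int (Suc ?n))) E (conv (\<rho> (p + int ?n + 1)) ?g)))"
    by simp
  also have "\<dots> \<le> ennreal (1 - rate R * D\<^sup>2) * nsq ?g"
    unfolding rate_def
  proof (rule two_step_contraction[where A = A and b = b and R = R and S = S])
    show "bdd_density (\<rho> (p + int ?n + 1)) (S / D)" by (rule bd) auto
    show "bdd_density (\<rho> (p + int (Suc ?n) + 1)) (S / D)" by (rule bd) auto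
    show "nsq ?g < \<infinity>" using g nsq_chain_fun_finite by simp
  qed (use D E a_pos a_le supp b0 in auto)
  also have "\<dots> \<le> ennreal (1 - rate R * D\<^sup>2) * ennreal ((1 - rate R * D\<^sup>2) ^ k * (S / d p))"
    unfolding g by (rule mult_left_mono[OF IH]) simp
  also have "\<dots> = ennreal ((1 - rate R * D\<^sup>2) ^ Suc k * (S / d p))"
    using c S_pos d_pos[of p] by (subst ennreal_mult[symmetric]) (auto simp: mult.assoc less_imp_le)
  finally show ?case .
qed

text \<open>Jensen's inequality followed by the pointwise bound on the last density: it is spent on
  passing from L2 to the supremum, not on contraction.\<close>

lemma chain_fun_sup:
  "ennreal ((chain_fun E p l (Suc n) z)\<^sup>2) \<le> ennreal (S / d (p + int n + 1)) * nsq (chain_fun E p l n)"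
proof -
  let ?j = "p + int n + 1" and ?g = "invol (a (p + int n)) E (chain_fun E p l n)"
  interpret J: bdd_density "\<rho> ?j" "S / d ?j" by (rule dens)
  have g: "nsq ?g = nsq (chain_fun E p l n)"
    by (rule nsq_invol[OF a_pos _ nsq_chain_fun_finite]) measurable
  have fin: "nsq ?g < \<infinity>" using g nsq_chain_fun_finite by simp
  have [measurable]: "?g \<in> borel_measurable borel" by measurable
  have "ennreal ((conv (\<rho> ?j) ?g z)\<^sup>2) \<le> (\<integral>\<^sup>+y. ennreal (\<rho> ?j y * (?g (z - y))\<^sup>2) \<partial>lborel)"
    by (rule ennreal_summand_le(1)[OF J.conv_variance[OF _ fin]]) measurable
  also have "\<dots> \<le> (\<integral>\<^sup>+y. ennreal (S / d ?j) * ennreal ((?g (z - y))\<^sup>2) \<partial>lborel)"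
  proof (rule nn_integral_mono)
    fix y
    have "ennreal (\<rho> ?j y * (?g (z - y))\<^sup>2) \<le> ennreal (S / d ?j * (?g (z - y))\<^sup>2)"
      by (intro ennreal_leI mult_right_mono J.rho_le) simp
    also have "\<dots> = ennreal (S / d ?j) * ennreal ((?g (z - y))\<^sup>2)"
      by (rule ennreal_mult) (use J.s_pos in auto)
    finally show "ennreal (\<rho> ?j y * (?g (z - y))\<^sup>2) \<le> ennreal (S / d ?j) * ennreal ((?g (z - y))\<^sup>2)" .
  qed
  also have "\<dots> = ennreal (S / d ?j) * (\<integral>\<^sup>+y. ennreal ((?g (z - y))\<^sup>2) \<partial>lborel)"
    by (rule nn_integral_cmult) measurable
  also have "(\<integral>\<^sup>+y. ennreal ((?g (z - y))\<^sup>2) \<partial>lborel) = nsq ?g"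
    unfolding nsq_def by (rule nn_integral_reflect) measurable
  finally show ?thesis using g by simp
qed

lemma zright_measurable[measurable (raw)]:
  assumes [measurable]: "e \<in> borel_measurable N" "\<And>i. (\<lambda>x. w x i) \<in> borel_measurable N"
  shows "(\<lambda>x. zright L a (w x) j (e x)) \<in> borel_measurable N"
  unfolding zright_def by measurable

lemma zleft_measurable[measurable (raw)]:
  assumes [measurable]: "e \<in> borel_measurable N" "\<And>i. (\<lambda>x. w x i) \<in> borel_measurable N"
  shows "(\<lambda>x. zleft L a (w x) j (e x)) \<in> borel_measurable N"
  unfolding zleft_def by measurable

lemma decay_measurable[measurable (raw)]:
  assumes [measurable]: "e \<in> borel_measurable N" "\<And>i. (\<lambda>x. w x i) \<in> borel_measurable N"
  shows "(\<lambda>x. decay L a (w x) p q (e x)) \<in> borel_measurable N"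
  unfolding decay_def by measurable

lemma site_energy_measurable[measurable (raw)]:
  assumes [measurable]: "e \<in> borel_measurable N" "\<And>i. (\<lambda>x. w x i) \<in> borel_measurable N"
  shows "(\<lambda>x. site_energy L a (w x) p (e x)) \<in> borel_measurable N"
  unfolding site_energy_def by measurable

text \<open>Integrating out \<^term>\<open>\<omega> (p + int n + 1)\<close> for successive \<^term>\<open>n\<close>: the Riccati variable is a Markov
  chain running from right to left, and each step applies one transfer operator.\<close>
lemma chain_integral:
  assumes "p + int n \<le> q" "q \<le> int L"
  shows "(\<integral>\<^sup>+\<omega>. ennreal (\<rho> p (site_energy L a \<omega> p E) * decay L a \<omega> p q E) \<partial>\<mu>) =
    (\<integral>\<^sup>+\<omega>. ennreal (chain_fun E p (E - zleft L a \<omega> p E) n (zright L a \<omega> (p + int n) E)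
       * decay L a \<omega> (p + int n) q E) \<partial>\<mu>)"
  using assms(1)
proof (induction n)
  case 0
  show ?case by (simp add: site_energy_def algebra_simps)
next
  case (Suc n)
  define j where "j = p + int n + 1"
  have j: "p + int n = j - 1" "p + int (Suc n) = j" "j \<le> q" "j \<le> int L" "p < j" using Suc.prems assms(2) by (auto simp: j_def)
  let ?l = "\<lambda>\<omega>. E - zleft L a \<omega> p E"
  let ?g = "\<lambda>\<omega>. invol (a (j - 1)) E (chain_fun E p (?l \<omega>) n)"
  have "(\<integral>\<^sup>+\<omega>. ennreal (\<rho> p (site_energy L a \<omega> p E) * decay L a \<omega> p q E) \<partial>\<mu>) =
    (\<integral>\<^sup>+\<omega>. ennreal (chain_fun E p (?l \<omega>) n (zright L a \<omega> (j - 1) E) * decay L a \<omega> (j - 1) q E) \<partial>\<mu>)"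
    using Suc.IH Suc.prems j(1) by simp
  also have "\<dots> = (\<integral>\<^sup>+\<omega>. (\<integral>\<^sup>+y. ennreal (\<rho> j y) *
      ennreal (chain_fun E p (?l (fun_upd \<omega> j y)) n (zright L a (fun_upd \<omega> j y) (j - 1) E) *
       decay L a (fun_upd \<omega> j y) (j - 1) q E) \<partial>lborel) \<partial>\<mu>)"
    by (rule nn_integral_resample)
      (intro measurable_compose[OF _ measurable_ennreal] borel_measurable_times chain_fun_comp
        borel_measurable_diff borel_measurable_const zright_measurable zleft_measurable decay_measurable coord_measurable)
  also have "\<dots> = (\<integral>\<^sup>+\<omega>. ennreal (chain_fun E p (?l \<omega>) (Suc n) (zright L a \<omega> j E) * decay L a \<omega> j q E) \<partial>\<mu>)"
  proof (rule nn_integral_cong)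
    fix \<omega>
    let ?z = "zright L a \<omega> j E"
    have e1: "zleft L a (fun_upd \<omega> j y) p E = zleft L a \<omega> p E" for y
      by (rule zleft_cong) (use j in auto)
    have e2: "zright L a (fun_upd \<omega> j y) j E = ?z" for y by (rule zright_cong) auto
    \<comment> \<open>Valid for every \<open>y\<close>, including \<open>y = ?z\<close>: the Riccati
      step, the decay factor and \<open>invol\<close> share the same convention for division by
      zero.\<close>
    have e3: "zright L a (fun_upd \<omega> j y) (j - 1) E = E - (a (j - 1))\<^sup>2 / (?z - y)" for y
      using zright_rec[OF j(4), of a "fun_upd \<omega> j y" E] e2 by simp
    have e4: "decay L a (fun_upd \<omega> j y) (j - 1) q E = a (j - 1) / \<bar>?z - y\<bar> * decay L a \<omega> j q E" for y
      using decay_step[OF j(3), of L a "fun_upd \<omega> j y" E] e2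
        decay_cong[of j "fun_upd \<omega> j y" \<omega> L a q E] by simp
    have dn: "decay L a \<omega> j q E \<ge> 0" by (rule decay_nonneg[of a, OF a_pos])
    interpret J: bdd_density "\<rho> j" "S / d j" by (rule dens)
    have g0: "?g \<omega> x \<ge> 0" for x using chain_fun_nonneg a_pos[of "j - 1"] by (simp add: invol_def)
    have fin: "nsq (?g \<omega>) < \<infinity>"
      using nsq_invol[OF a_pos _ nsq_chain_fun_finite, of E p "?l \<omega>" n "j - 1" E] nsq_chain_fun_finite by simp
    have gm[measurable]: "?g \<omega> \<in> borel_measurable borel" by measurable
    have "(\<integral>\<^sup>+y. ennreal (\<rho> j y) *
      ennreal (chain_fun E p (?l (fun_upd \<omega> j y)) n (zright L a (fun_upd \<omega> j y) (j - 1) E) *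
       decay L a (fun_upd \<omega> j y) (j - 1) q E) \<partial>lborel) =
       (\<integral>\<^sup>+y. ennreal (\<rho> j y * ?g \<omega> (?z - y)) * ennreal (decay L a \<omega> j q E) \<partial>lborel)"
    proof (rule nn_integral_cong)
      fix y
      have "ennreal (\<rho> j y) * ennreal (chain_fun E p (?l (fun_upd \<omega> j y)) n (zright L a (fun_upd \<omega> j y) (j - 1) E) *
         decay L a (fun_upd \<omega> j y) (j - 1) q E) = ennreal (\<rho> j y) * ennreal (?g \<omega> (?z - y) * decay L a \<omega> j q E)"
        unfolding e1 e3 e4 by (simp add: invol_def mult_ac)
      also have "\<dots> = ennreal (\<rho> j y) * (ennreal (?g \<omega> (?z - y)) * ennreal (decay L a \<omega> j q E))"
        by (simp only: ennreal_mult[OF g0 dn])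
      also have "\<dots> = ennreal (\<rho> j y * ?g \<omega> (?z - y)) * ennreal (decay L a \<omega> j q E)"
        by (simp only: ennreal_mult[OF J.rho_nonneg g0] mult.assoc)
      finally show "ennreal (\<rho> j y) * ennreal (chain_fun E p (?l (fun_upd \<omega> j y)) n (zright L a (fun_upd \<omega> j y) (j - 1) E) *
         decay L a (fun_upd \<omega> j y) (j - 1) q E) = ennreal (\<rho> j y * ?g \<omega> (?z - y)) * ennreal (decay L a \<omega> j q E)" .
    qed
    also have "\<dots> = (\<integral>\<^sup>+y. ennreal (\<rho> j y * ?g \<omega> (?z - y)) \<partial>lborel) * ennreal (decay L a \<omega> j q E)"
      by (rule nn_integral_multc) measurable
    also have "(\<integral>\<^sup>+y. ennreal (\<rho> j y * ?g \<omega> (?z - y)) \<partial>lborel) = ennreal (conv (\<rho> j) (?g \<omega>) ?z)"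
      by (rule J.conv_nn[OF gm fin g0, symmetric])
    also have "conv (\<rho> j) (?g \<omega>) ?z = chain_fun E p (?l \<omega>) (Suc n) ?z"
      using j(1) by (simp add: j_def[symmetric])
    also have "ennreal \<dots> * ennreal (decay L a \<omega> j q E) = ennreal (chain_fun E p (?l \<omega>) (Suc n) ?z * decay L a \<omega> j q E)"
      by (rule ennreal_mult[symmetric, OF chain_fun_nonneg dn])
    finally show "(\<integral>\<^sup>+y. ennreal (\<rho> j y) *
      ennreal (chain_fun E p (?l (fun_upd \<omega> j y)) n (zright L a (fun_upd \<omega> j y) (j - 1) E) *
       decay L a (fun_upd \<omega> j y) (j - 1) q E) \<partial>lborel) =
       ennreal (chain_fun E p (?l \<omega>) (Suc n) (zright L a \<omega> j E) * decay L a \<omega> j q E)" .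
  qed
  finally show ?case unfolding j(2) .
qed

text \<open>\<open>D\<close> is required only strictly between \<open>p\<close> and
  \<open>q\<close>; the end sites enter through their own heights. This matters because one end is
  the site 0, where the polynomial lower bound on \<open>d\<close> says nothing.\<close>

lemma chain_bound:
  assumes pq: "p < q" "q \<le> int L" and E: "\<bar>E\<bar> \<le> R"
    and D: "0 < D" "D \<le> 1" "\<And>j. p < j \<Longrightarrow> j < q \<Longrightarrow> D \<le> d j" and k: "2 * int k < q - p"
  shows "(\<integral>\<^sup>+\<omega>. ennreal (\<rho> p (site_energy L a \<omega> p E) * decay L a \<omega> p q E) \<partial>\<mu>)
    \<le> ennreal (sqrt (S / d q * ((1 - rate R * D\<^sup>2) ^ k * (S / d p))))"
proof -
  \<comment> \<open>The interior sites; the remaining step, at site \<open>q\<close>, is the one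
    that yields the sup bound.\<close>
  define n where "n = nat (q - p - 1)"
  have n: "p + int (Suc n) = q" "p + int n + 1 = q" "2 * k \<le> n" using pq k by (auto simp: n_def)
  have c: "0 \<le> 1 - rate R * D\<^sup>2"
  proof -
    have "rate R * D\<^sup>2 \<le> 1 * 1" using rate_le_1[of R] rate_pos[of R] D
      by (intro mult_mono) (auto simp: power_le_one)
    then show ?thesis by simp
  qed
  have Sd: "S / d j \<ge> 0" for j using S_pos d_pos[of j] by simp
  have pw: "chain_fun E p l (Suc n) z \<le> sqrt (S / d q * ((1 - rate R * D\<^sup>2) ^ k * (S / d p)))" for l z
  proof -
    have "ennreal ((chain_fun E p l (Suc n) z)\<^sup>2) \<le> ennreal (S / d q) * nsq (chain_fun E p l n)"
      using chain_fun_sup[of E p l n z] n(2) by simp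
    also have "\<dots> \<le> ennreal (S / d q) * nsq (chain_fun E p l (2 * k))"
      by (intro mult_left_mono nsq_chain_fun_antimono n(3)) simp
    also have "\<dots> \<le> ennreal (S / d q) * ennreal ((1 - rate R * D\<^sup>2) ^ k * (S / d p))"
      by (intro mult_left_mono nsq_chain_fun_decay D E) (use k in auto)
    also have "\<dots> = ennreal (S / d q * ((1 - rate R * D\<^sup>2) ^ k * (S / d p)))"
      by (rule ennreal_mult[symmetric]) (intro mult_nonneg_nonneg zero_le_power c Sd)+
    finally have "(chain_fun E p l (Suc n) z)\<^sup>2 \<le> S / d q * ((1 - rate R * D\<^sup>2) ^ k * (S / d p))"
      by (subst (asm) ennreal_le_iff) (intro mult_nonneg_nonneg zero_le_power c Sd)+
    then show ?thesis by (rule real_le_rsqrt)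
  qed
  interpret prob_space \<mu> by (rule prob_space_mu)
  have "(\<integral>\<^sup>+\<omega>. ennreal (\<rho> p (site_energy L a \<omega> p E) * decay L a \<omega> p q E) \<partial>\<mu>) =
    (\<integral>\<^sup>+\<omega>. ennreal (chain_fun E p (E - zleft L a \<omega> p E) (Suc n) (zright L a \<omega> q E) * decay L a \<omega> q q E) \<partial>\<mu>)"
    using chain_integral[of p "Suc n" q L E] pq n(1) by simp
  also have "\<dots> \<le> (\<integral>\<^sup>+\<omega>. ennreal (sqrt (S / d q * ((1 - rate R * D\<^sup>2) ^ k * (S / d p)))) \<partial>\<mu>)"
  proof (intro nn_integral_mono ennreal_leI)
    fix \<omega>
    have "decay L a \<omega> q q E = 1" by (simp add: decay_def)
    then show "chain_fun E p (E - zleft L a \<omega> p E) (Suc n) (zright L a \<omega> q E) * decay L a \<omega> q q E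
       \<le> sqrt (S / d q * ((1 - rate R * D\<^sup>2) ^ k * (S / d p)))"
      using pw by (simp only: mult_1_right)
  qed
  also have "\<dots> = ennreal (sqrt (S / d q * ((1 - rate R * D\<^sup>2) ^ k * (S / d p))))"
    by (simp add: emeasure_space_1)
  finally show ?thesis .
qed

end

section \<open>From boxes to the whole line\<close>

text \<open>Reduces an uncountable supremum to a countable one, so that the supremum over times in a
  box is measurable in the potential.\<close>

lemma SUP_eq_SUP_rat:
  fixes f :: "real \<Rightarrow> real"
  assumes "continuous_on UNIV f"
  shows "(SUP t. ennreal (f t)) = (SUP q::rat. ennreal (f (of_rat q)))"
proof (rule antisym)
  let ?B = "SUP q::rat. ennreal (f (of_rat q))"
  have "closed {t. ennreal (f t) \<le> ?B}"
    by (rule closed_Collect_le) (intro continuous_on_ennreal assms continuous_on_const)+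
  moreover have "\<rat> \<subseteq> {t. ennreal (f t) \<le> ?B}"
    by (auto elim!: Rats_cases intro: SUP_upper)
  ultimately have "closure \<rat> \<subseteq> {t. ennreal (f t) \<le> ?B}" by (intro closure_minimal)
  then have "ennreal (f t) \<le> ?B" for t unfolding Rats_closure_real by auto
  then show "(SUP t. ennreal (f t)) \<le> ?B" by (intro SUP_least)
  show "?B \<le> (SUP t. ennreal (f t))" by (intro SUP_least SUP_upper) simp
qed

lemma box_entry_continuous:
  assumes pos: "\<And>n. a n > 0"
  shows "continuous_on UNIV (\<lambda>t. box_entry a \<omega> L t m)"
proof -
  obtain \<Lambda> :: "real set" and \<phi> where "finite \<Lambda>"
    "\<And>l. l \<in> \<Lambda> \<Longrightarrow> box_eigen L a \<omega> l (\<phi> l)"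
    "\<And>l. l \<in> \<Lambda> \<Longrightarrow> (\<Sum>n=-int L..int L. (\<phi> l n)\<^sup>2) = 1"
    and e: "\<And>t m. box_entry a \<omega> L t m = (\<Sum>l\<in>\<Lambda>. of_real (\<phi> l 0 * \<phi> l m) * exp (- \<i> * of_real t * of_real l))"
    by (rule box_entry_expansion[where a = a and L = L and \<omega> = \<omega>, OF pos]) (rule that, assumption+)
  show ?thesis unfolding e by (intro continuous_intros)
qed

lemma jacobi_power_support: "\<bar>n\<bar> > int k \<Longrightarrow> (jacobi_op a \<omega> ^^ k) (delta_vec 0) n = 0"
proof (induction k arbitrary: n)
  case (Suc k)
  have "(jacobi_op a \<omega> ^^ k) (delta_vec 0) (n + 1) = 0" "(jacobi_op a \<omega> ^^ k) (delta_vec 0) (n - 1) = 0"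
    "(jacobi_op a \<omega> ^^ k) (delta_vec 0) n = 0" using Suc.prems by (auto intro!: Suc.IH)
  then show ?case
    by (simp only: funpow.simps o_apply jacobi_op_def[of a \<omega> "(jacobi_op a \<omega> ^^ k) (delta_vec 0)"] mult_zero_right add_0_right)
qed (simp add: delta_vec_def)

text \<open>After \<open>k\<close> applications a vector started at 0 has spread at most to distance
  \<open>k\<close>, so a box of size at least \<open>k\<close> has not yet been noticed.\<close>

lemma box_power_eq: "k \<le> L \<Longrightarrow> (box_op L a \<omega> ^^ k) (delta_vec 0) = (jacobi_op a \<omega> ^^ k) (delta_vec 0)"
proof (induction k)
  case (Suc k)
  then have IH: "(box_op L a \<omega> ^^ k) (delta_vec 0) = (jacobi_op a \<omega> ^^ k) (delta_vec 0)" by simp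
  show ?case
  proof
    fix n
    show "(box_op L a \<omega> ^^ Suc k) (delta_vec 0) n = (jacobi_op a \<omega> ^^ Suc k) (delta_vec 0) n"
    proof (cases "\<bar>n\<bar> \<le> int L")
      case True
      then show ?thesis by (simp add: IH box_op_def)
    next
      case False
      then have "\<bar>n\<bar> > int (Suc k)" using Suc.prems by linarith
      then show ?thesis using False jacobi_power_support[of "Suc k" n a \<omega>] by (simp add: box_op_def)
    qed
  qed
qed simp

lemma jacobi_op_bound:
  assumes a: "\<And>n. \<bar>a n\<bar> \<le> A" and w: "\<And>n. \<bar>\<omega> n\<bar> \<le> b" and psi: "\<And>n. \<bar>\<psi> n\<bar> \<le> B"
  shows "\<bar>jacobi_op a \<omega> \<psi> n\<bar> \<le> (2 * A + b) * B"
proof -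
  have 0: "A \<ge> 0" "b \<ge> 0" "B \<ge> 0"
    using order_trans[OF abs_ge_zero a] order_trans[OF abs_ge_zero w] order_trans[OF abs_ge_zero psi] by auto
  have "\<bar>jacobi_op a \<omega> \<psi> n\<bar> \<le> \<bar>a n * \<psi> (n + 1)\<bar> + \<bar>a (n - 1) * \<psi> (n - 1)\<bar> + \<bar>\<omega> n * \<psi> n\<bar>"
    unfolding jacobi_op_def by linarith
  also have "\<dots> \<le> A * B + A * B + b * B"
    unfolding abs_mult by (intro add_mono mult_mono a w psi 0 abs_ge_zero)
  also have "\<dots> = (2 * A + b) * B" by (simp add: algebra_simps)
  finally show ?thesis .
qed

lemma box_power_bound:
  assumes a: "\<And>n. \<bar>a n\<bar> \<le> A" and w: "\<And>n. \<bar>\<omega> n\<bar> \<le> b"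
  shows "\<bar>(box_op L a \<omega> ^^ k) (delta_vec 0) n\<bar> \<le> (2 * A + b) ^ k"
proof (induction k arbitrary: n)
  case (Suc k)
  have 0: "A \<ge> 0" "b \<ge> 0" using order_trans[OF abs_ge_zero a] order_trans[OF abs_ge_zero w] by auto
  show ?case
    using jacobi_op_bound[where n = n and a = a and \<omega> = \<omega> and \<psi> = "(box_op L a \<omega> ^^ k) (delta_vec 0)" and B = "(2 * A + b) ^ k", OF a w Suc.IH] 0
    by (simp add: box_op_def[of L a \<omega> "(box_op L a \<omega> ^^ k) (delta_vec 0)" n])
qed (simp add: delta_vec_def)

text \<open>Each term of the exponential series is eventually constant in \<open>L\<close>, and the
  series of \<open>exp (\<bar>t\<bar> * (2 * A + b))\<close> dominates uniformly in
  \<open>L\<close>; Tannery's theorem applies.\<close>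

lemma box_entry_tendsto:
  assumes a: "\<And>n. \<bar>a n\<bar> \<le> A" and w: "\<And>n. \<bar>\<omega> n\<bar> \<le> b"
  shows "(\<lambda>L. box_entry a \<omega> L t m) \<longlonglongrightarrow> evolution_entry a \<omega> t m"
proof -
  let ?c = "\<lambda>k. (- \<i> * complex_of_real t) ^ k / of_nat (fact k)"
  let ?M = "\<lambda>k. (\<bar>t\<bar> * (2 * A + b)) ^ k / fact k"
  have c: "cmod (?c k) = \<bar>t\<bar> ^ k / fact k" for k by (simp add: norm_divide norm_power norm_mult)
  have bd: "cmod (?c k * complex_of_real ((box_op L a \<omega> ^^ k) (delta_vec 0) m)) \<le> ?M k" for k L
  proof -
    have "\<bar>t\<bar> ^ k / fact k * \<bar>(box_op L a \<omega> ^^ k) (delta_vec 0) m\<bar> \<le> \<bar>t\<bar> ^ k / fact k * (2 * A + b) ^ k"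
      by (rule mult_left_mono[OF box_power_bound[of a A \<omega> b, OF a w]]) simp
    then show ?thesis unfolding norm_mult c by (simp add: power_mult_distrib)
  qed
  have lim: "(\<lambda>L. ?c k * complex_of_real ((box_op L a \<omega> ^^ k) (delta_vec 0) m)) \<longlonglongrightarrow>
      ?c k * complex_of_real ((jacobi_op a \<omega> ^^ k) (delta_vec 0) m)" for k
    by (rule tendsto_eventually, rule eventually_sequentiallyI[of k]) (simp add: box_power_eq)
  have "summable ?M" using summable_exp[of "\<bar>t\<bar> * (2 * A + b)"] by (simp add: field_simps)
  moreover have "eventually (\<lambda>(k, L). cmod (?c k * complex_of_real ((box_op L a \<omega> ^^ k) (delta_vec 0) m)) \<le> ?M k) (at_top \<times>\<^sub>F sequentially)"
    by (rule always_eventually) (use bd in auto)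
  ultimately show ?thesis
    using tannerys_theorem[OF lim] unfolding box_entry_def evolution_entry_def by auto
qed

context anderson_model
begin

lemma box_power_measurable:
  "(\<lambda>\<omega>. (box_op L a \<omega> ^^ k) (delta_vec 0) m) \<in> borel_measurable \<mu>"
proof (induction k arbitrary: m)
  case (Suc k)
  have "(\<lambda>\<omega>. (box_op L a \<omega> ^^ Suc k) (delta_vec 0) m) =
    (\<lambda>\<omega>. if \<bar>m\<bar> \<le> int L then a m * (box_op L a \<omega> ^^ k) (delta_vec 0) (m + 1)
       + a (m - 1) * (box_op L a \<omega> ^^ k) (delta_vec 0) (m - 1) + \<omega> m * (box_op L a \<omega> ^^ k) (delta_vec 0) m else 0)"
    by (simp add: box_op_def jacobi_op_def fun_eq_iff)
  then show ?case
    by (simp only:) (intro measurable_If borel_measurable_add borel_measurable_times borel_measurable_const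
        Suc coord_measurable; simp)
qed simp

definition box_sup :: "nat \<Rightarrow> int \<Rightarrow> (int \<Rightarrow> real) \<Rightarrow> ennreal" where
  "box_sup L m \<omega> = (SUP t. ennreal (cmod (box_entry a \<omega> L t m)))"

lemma box_sup_measurable: "box_sup L m \<in> borel_measurable \<mu>"
proof -
  have [measurable]: "(\<lambda>\<omega>. box_entry a \<omega> L t m) \<in> borel_measurable \<mu>" for t
    unfolding box_entry_def
    by (intro borel_measurable_suminf borel_measurable_times borel_measurable_const
        measurable_compose[OF box_power_measurable borel_measurable_of_real])
  have "box_sup L m = (\<lambda>\<omega>. SUP q::rat. ennreal (cmod (box_entry a \<omega> L (of_rat q) m)))"
    unfolding box_sup_def
    by (intro ext SUP_eq_SUP_rat continuous_on_norm box_entry_continuous a_pos)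
  then show ?thesis by simp
qed

lemma AE_bounded: "AE \<omega> in \<mu>. \<forall>n. \<bar>\<omega> n\<bar> \<le> b"
proof -
  have "AE x in site_measure n. \<bar>x\<bar> \<le> b" for n
  proof -
    have "ennreal (\<rho> n x) > 0 \<longrightarrow> \<bar>x\<bar> \<le> b" for x using supp[of x n] by (cases "\<bar>x\<bar> \<le> b") auto
    then show ?thesis unfolding site_measure_def by (subst AE_density) auto
  qed
  then have "AE \<omega> in \<mu>. \<bar>\<omega> n\<bar> \<le> b" for n
    unfolding \<mu>_def by (intro AE_PiM_component prob_space_site_measure) auto
  then show ?thesis by (simp add: AE_all_countable)
qed

lemma A_nonneg: "A \<ge> 0" using a_pos[of 0] a_le[of 0] by linarith

text \<open>After averaging at \<open>p\<close>, Fubini moves the energy outside, where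
  \<open>chain_bound\<close> applies at each fixed value. The window of admissible energies has
  length \<open>2 * (2 * A + b)\<close>, the prefactor in the bound.\<close>

lemma box_sup_bound:
  assumes pq: "(p = 0 \<and> q = m) \<or> (p = m \<and> q = 0)" "- int L \<le> p" "p < q" "q \<le> int L"
    and D: "0 < D" "D \<le> 1" "\<And>j. p < j \<Longrightarrow> j < q \<Longrightarrow> D \<le> d j" and k: "2 * int k < q - p"
  shows "(\<integral>\<^sup>+\<omega>. box_sup L m \<omega> \<partial>\<mu>) \<le>
    ennreal (2 * (2 * A + b) * sqrt (S / d q * ((1 - rate (2 * A + b) * D\<^sup>2) ^ k * (S / d p))))"
proof -
  let ?R = "2 * A + b"
  let ?B = "sqrt (S / d q * ((1 - rate (2 * A + b) * D\<^sup>2) ^ k * (S / d p)))"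
  let ?F = "\<lambda>E \<omega>. ennreal (\<rho> p (site_energy L a \<omega> p E) * decay L a \<omega> p q E * indicator {-?R..?R} E)"
  interpret Q: prob_space \<mu> by (rule prob_space_mu)
  interpret PQ: pair_sigma_finite "lborel :: real measure" \<mu> ..
  have R0: "?R \<ge> 0" using A_nonneg b0 by simp
  have B0: "?B \<ge> 0"
  proof -
    have "0 \<le> 1 - rate ?R * D\<^sup>2"
      using mult_mono[OF rate_le_1[of ?R] power_le_one[of D 2]] rate_pos[of ?R] D by simp
    then show ?thesis using S_pos d_pos[of p] d_pos[of q]
      by (intro real_sqrt_ge_zero mult_nonneg_nonneg zero_le_power divide_nonneg_nonneg) auto
  qed
  have meas: "(\<lambda>x. ?F (fst x) (snd x)) \<in> borel_measurable (lborel \<Otimes>\<^sub>M \<mu>)"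
  proof -
    have c: "(\<lambda>x::real \<times> (int \<Rightarrow> real). snd x i) \<in> borel_measurable (lborel \<Otimes>\<^sub>M \<mu>)" for i
      by (rule measurable_compose[OF measurable_snd coord_measurable])
    have f: "(\<lambda>x::real \<times> (int \<Rightarrow> real). fst x) \<in> borel_measurable (lborel \<Otimes>\<^sub>M \<mu>)" by simp
    have i: "(\<lambda>x::real \<times> (int \<Rightarrow> real). indicator {-?R..?R} (fst x) :: real) \<in> borel_measurable (lborel \<Otimes>\<^sub>M \<mu>)"
      by simp
    show ?thesis
      by (intro measurable_compose[OF _ measurable_ennreal] borel_measurable_times decay_measurable f c i
          measurable_compose[OF site_energy_measurable rho_measurable])
  qed
  have "(\<integral>\<^sup>+\<omega>. box_sup L m \<omega> \<partial>\<mu>) = (\<integral>\<^sup>+\<omega>. (\<integral>\<^sup>+y. ennreal (\<rho> p y) * box_sup L m (fun_upd \<omega> p y) \<partial>lborel) \<partial>\<mu>)"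
    by (rule nn_integral_resample[OF box_sup_measurable])
  also have "\<dots> \<le> (\<integral>\<^sup>+\<omega>. (\<integral>\<^sup>+E. ?F E \<omega> \<partial>lborel) \<partial>\<mu>)"
  proof (rule nn_integral_mono_AE, rule eventually_mono[OF AE_bounded])
    fix \<omega> :: "int \<Rightarrow> real" assume "\<forall>n. \<bar>\<omega> n\<bar> \<le> b"
    then show "(\<integral>\<^sup>+y. ennreal (\<rho> p y) * box_sup L m (fun_upd \<omega> p y) \<partial>lborel) \<le> (\<integral>\<^sup>+E. ?F E \<omega> \<partial>lborel)"
      unfolding box_sup_def
      by (intro spectral_averaging a_pos a_le pq rho_measurable supp bdd_density.rho_nonneg[OF dens]) auto
  qed
  also have "\<dots> = (\<integral>\<^sup>+E. (\<integral>\<^sup>+\<omega>. ?F E \<omega> \<partial>\<mu>) \<partial>lborel)"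
    using PQ.Fubini[OF meas] by simp
  also have "\<dots> \<le> (\<integral>\<^sup>+E. ennreal ?B * indicator {-?R..?R} E \<partial>lborel)"
  proof (rule nn_integral_mono)
    fix E
    show "(\<integral>\<^sup>+\<omega>. ?F E \<omega> \<partial>\<mu>) \<le> ennreal ?B * indicator {-?R..?R} E"
    proof (cases "E \<in> {-?R..?R}")
      case True
      then have "\<bar>E\<bar> \<le> ?R" by auto
      then show ?thesis using chain_bound[OF pq(3,4) _ D k, of E ?R] True by simp
    qed simp
  qed
  also have "\<dots> = ennreal ?B * ennreal (2 * ?R)"
    using R0 by (simp add: nn_integral_cmult)
  also have "\<dots> = ennreal (2 * ?R * ?B)" using B0 R0 by (simp add: ennreal_mult[symmetric] mult.commute)
  finally show ?thesis .
qed

lemma evolution_sup_le_liminf: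
  assumes w: "\<forall>n. \<bar>\<omega> n\<bar> \<le> b"
  shows "(SUP t. ennreal (cmod (evolution_entry a \<omega> t m))) \<le> liminf (\<lambda>L. box_sup L m \<omega>)"
proof (rule SUP_least)
  fix t
  have "(\<lambda>L. box_entry a \<omega> L t m) \<longlonglongrightarrow> evolution_entry a \<omega> t m"
    by (rule box_entry_tendsto[where A = A and b = b]) (use a_pos a_le w in \<open>auto simp: abs_of_pos\<close>)
  then have "(\<lambda>L. ennreal (cmod (box_entry a \<omega> L t m))) \<longlonglongrightarrow> ennreal (cmod (evolution_entry a \<omega> t m))"
    by (intro tendsto_ennrealI tendsto_norm)
  then have "liminf (\<lambda>L. ennreal (cmod (box_entry a \<omega> L t m))) = ennreal (cmod (evolution_entry a \<omega> t m))"
    by (rule lim_imp_Liminf[OF trivial_limit_sequentially])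
  moreover have "liminf (\<lambda>L. ennreal (cmod (box_entry a \<omega> L t m))) \<le> liminf (\<lambda>L. box_sup L m \<omega>)"
    unfolding box_sup_def by (intro Liminf_mono always_eventually allI SUP_upper) simp
  ultimately show "ennreal (cmod (evolution_entry a \<omega> t m)) \<le> liminf (\<lambda>L. box_sup L m \<omega>)" by simp
qed

text \<open>The chain always runs from the smaller site to the larger one, so positive and negative
  \<open>m\<close> exchange the roles of \<open>p\<close> and \<open>q\<close>; the bound is
  symmetric in the two end heights.\<close>

lemma evolution_sup_bound:
  assumes m: "m \<noteq> 0" and D: "0 < D" "D \<le> 1" "\<And>j. j \<noteq> 0 \<Longrightarrow> \<bar>j\<bar> \<le> \<bar>m\<bar> \<Longrightarrow> D \<le> d j" and k: "2 * int k < \<bar>m\<bar>"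
  shows "(\<integral>\<^sup>+\<omega>. (SUP t. ennreal (cmod (evolution_entry a \<omega> t m))) \<partial>\<mu>) \<le>
    ennreal (2 * (2 * A + b) * sqrt (S / d 0 * ((1 - rate (2 * A + b) * D\<^sup>2) ^ k * (S / d m))))"
    (is "_ \<le> ?B")
proof -
  have "(\<integral>\<^sup>+\<omega>. box_sup L m \<omega> \<partial>\<mu>) \<le> ?B" if "nat \<bar>m\<bar> \<le> L" for L
  proof (cases "m > 0")
    case True
    have "(\<integral>\<^sup>+\<omega>. box_sup L m \<omega> \<partial>\<mu>) \<le>
       ennreal (2 * (2 * A + b) * sqrt (S / d m * ((1 - rate (2 * A + b) * D\<^sup>2) ^ k * (S / d 0))))"
      by (rule box_sup_bound) (use that D k True in auto)
    then show ?thesis by (simp add: mult_ac)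
  next
    case False
    then show ?thesis using that D k m by (intro box_sup_bound) auto
  qed
  then have ev: "eventually (\<lambda>L. (\<integral>\<^sup>+\<omega>. box_sup L m \<omega> \<partial>\<mu>) \<le> ?B) sequentially"
    by (rule eventually_sequentiallyI)
  \<comment> \<open>The supremum of limits is at most the lower limit of suprema; Fatou's lemma is
    then applied only to the measurable box suprema.\<close>
  have "(\<integral>\<^sup>+\<omega>. (SUP t. ennreal (cmod (evolution_entry a \<omega> t m))) \<partial>\<mu>) \<le> (\<integral>\<^sup>+\<omega>. liminf (\<lambda>L. box_sup L m \<omega>) \<partial>\<mu>)"
    by (rule nn_integral_mono_AE, rule eventually_mono[OF AE_bounded]) (rule evolution_sup_le_liminf)
  also have "\<dots> \<le> liminf (\<lambda>L. \<integral>\<^sup>+\<omega>. box_sup L m \<omega> \<partial>\<mu>)"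
    by (rule nn_integral_liminf) (rule box_sup_measurable)
  also have "\<dots> \<le> limsup (\<lambda>L. \<integral>\<^sup>+\<omega>. box_sup L m \<omega> \<partial>\<mu>)"
    by (rule Liminf_le_Limsup) simp
  also have "\<dots> \<le> ?B" by (rule Limsup_bounded[OF ev])
  finally show ?thesis .
qed

end

section \<open>Explicit rates and conclusion\<close>

text \<open>A negative exponent would make the lower bound on \<open>d\<close> unbounded, against
  the upper bound 1. The sign ensures that the lower bound at \<open>m\<close> also holds at all
  nonzero sites nearer to 0.\<close>

lemma nonneg_of_bounded_powr:
  fixes C \<zeta> :: real
  assumes C: "C > 0" and bd: "\<And>n::nat. n \<noteq> 0 \<Longrightarrow> C * real n powr (- \<zeta>) \<le> 1"
  shows "\<zeta> \<ge> 0"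
proof (rule ccontr)
  assume "\<not> \<zeta> \<ge> 0"
  then have z: "- \<zeta> > 0" by simp
  obtain n :: nat where n: "real n > (1 / C) powr (1 / (- \<zeta>))" using reals_Archimedean2 by blast
  have "((1 / C) powr (1 / (- \<zeta>))) powr (- \<zeta>) < real n powr (- \<zeta>)"
    by (rule powr_less_mono2[OF z _ n]) simp
  moreover have "((1 / C) powr (1 / (- \<zeta>))) powr (- \<zeta>) = 1 / C"
    using z C by (simp add: powr_powr)
  ultimately have "1 / C < real n powr (- \<zeta>)" by (simp only:)
  then have "C * real n powr (- \<zeta>) > 1" using C by (simp add: pos_divide_less_eq mult.commute)
  moreover have "n \<noteq> 0"
  proof
    assume "n = 0"
    with n have "(1 / C) powr (1 / (- \<zeta>)) < 0" by simp
    then show False by (simp add: not_less[symmetric])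
  qed
  ultimately show False using bd[of n] by simp
qed

lemma scaled_density_bdd_density:
  assumes [measurable]: "r \<in> borel_measurable borel" and r0: "\<And>x. r x \<ge> 0" and rS: "\<And>x. r x \<le> S"
    and int: "integral\<^sup>L lborel r = 1" and d: "d n > 0"
  shows "bdd_density (\<lambda>x. scaled_density r d n (x - c)) (S / d n)"
proof
  show "(\<lambda>x. scaled_density r d n (x - c)) \<in> borel_measurable borel"
    unfolding scaled_density_def by measurable
  show "scaled_density r d n (y - c) \<ge> 0" "scaled_density r d n (y - c) \<le> S / d n" for y
    using r0 rS d by (auto simp: scaled_density_def divide_right_mono)
  \<comment> \<open>A non-integrable function has integral 0 by convention, which the value 1 rules
    out.\<close>
  have "integrable lborel r" using int not_integrable_integral_eq by fastforce
  then have "(\<integral>\<^sup>+x. ennreal (r x) \<partial>lborel) = 1"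
    using nn_integral_eq_integral[of lborel r] r0 int by simp
  moreover have "(\<integral>\<^sup>+x. ennreal (r x) \<partial>lborel) = (\<integral>\<^sup>+y. ennreal (scaled_density r d n (y - c)) \<partial>lborel)"
  proof -
    have "(\<integral>\<^sup>+y. ennreal (scaled_density r d n (y - c)) \<partial>lborel) =
       \<bar>d n\<bar> * (\<integral>\<^sup>+x. ennreal (scaled_density r d n (c + d n * x - c)) \<partial>lborel)"
      by (rule nn_integral_real_affine) (use d in \<open>auto simp: scaled_density_def\<close>)
    also have "\<dots> = (\<integral>\<^sup>+x. ennreal \<bar>d n\<bar> * ennreal (scaled_density r d n (c + d n * x - c)) \<partial>lborel)"
      by (rule nn_integral_cmult[symmetric]) (auto simp: scaled_density_def)
    also have "\<dots> = (\<integral>\<^sup>+x. ennreal (r x) \<partial>lborel)"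
      using d r0 by (intro nn_integral_cong) (simp add: scaled_density_def ennreal_mult[symmetric])
    finally show ?thesis by simp
  qed
  ultimately show "(\<integral>\<^sup>+y. ennreal (scaled_density r d n (y - c)) \<partial>lborel) = 1" by simp
qed

text \<open>With \<open>1 - u \<le> exp (- u)\<close> and
  \<open>D^2 * x = C^2 * x powr (1 - 2 * \<zeta>)\<close>, about \<open>x / 2\<close> pairs give the
  exponent \<open>\<kappa> * C^2 / 2\<close>; rounding \<open>k\<close> down costs at most
  \<open>exp \<kappa>\<close>. The square root halves both exponents, and also turns
  \<open>S / dm\<close>, at most \<open>S / C * x powr \<zeta>\<close>, into the prefactor.\<close>

lemma decay_rate_estimate:
  fixes S d0 dm \<kappa> D C \<zeta> x :: real and k :: nat
  assumes S: "S > 0" and d0: "d0 > 0" and C: "C > 0" and x: "x > 0"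
    and D: "D = C * x powr (- \<zeta>)" "D \<le> dm" "D \<le> 1" and \<kappa>: "0 < \<kappa>" "\<kappa> \<le> 1" and k: "real k \<ge> x / 2 - 1"
  shows "sqrt (S / d0 * ((1 - \<kappa> * D\<^sup>2) ^ k * (S / dm))) \<le>
    S / sqrt (d0 * C) * exp (\<kappa> / 2) * x powr (\<zeta> / 2) * exp (- (\<kappa> * C\<^sup>2 / 4) * x powr (1 - 2 * \<zeta>))"
proof -
  have D0: "D > 0" using D C x by simp
  have D2: "D\<^sup>2 \<le> 1" using D0 D by (simp add: power_le_one)
  have kD: "\<kappa> * D\<^sup>2 \<le> 1" using mult_mono[OF \<kappa>(2) D2] \<kappa> by simp
  have Dx: "D\<^sup>2 * x = C\<^sup>2 * x powr (1 - 2 * \<zeta>)"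
  proof -
    have "D\<^sup>2 * x = C\<^sup>2 * (x powr (- \<zeta>) * x powr (- \<zeta>) * x powr 1)"
      using x by (simp add: D(1) power2_eq_square)
    also have "x powr (- \<zeta>) * x powr (- \<zeta>) * x powr 1 = x powr (1 - 2 * \<zeta>)"
      by (simp only: powr_add[symmetric]) simp
    finally show ?thesis .
  qed
  have "(1 - \<kappa> * D\<^sup>2) ^ k \<le> exp (- (\<kappa> * D\<^sup>2)) ^ k"
    by (rule power_mono) (use kD exp_ge_add_one_self[of "- (\<kappa> * D\<^sup>2)"] in auto)
  also have "\<dots> = exp (- (real k * (\<kappa> * D\<^sup>2)))" by (simp add: exp_of_nat_mult[symmetric])
  also have "\<dots> \<le> exp (\<kappa> - \<kappa> * C\<^sup>2 / 2 * x powr (1 - 2 * \<zeta>))"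
  proof -
    have "(x / 2 - 1) * (\<kappa> * D\<^sup>2) \<le> real k * (\<kappa> * D\<^sup>2)" by (rule mult_right_mono[OF k]) (use \<kappa> in simp)
    moreover have "(x / 2 - 1) * (\<kappa> * D\<^sup>2) = \<kappa> / 2 * (D\<^sup>2 * x) - \<kappa> * D\<^sup>2" by (simp add: algebra_simps)
    moreover have "\<kappa> * D\<^sup>2 \<le> \<kappa> * 1" using D2 \<kappa> by (intro mult_left_mono) auto
    moreover have "\<kappa> / 2 * (D\<^sup>2 * x) = \<kappa> * C\<^sup>2 / 2 * x powr (1 - 2 * \<zeta>)" unfolding Dx by simp
    ultimately have "- (real k * (\<kappa> * D\<^sup>2)) \<le> \<kappa> - \<kappa> * C\<^sup>2 / 2 * x powr (1 - 2 * \<zeta>)" by linarith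
    then show ?thesis by simp
  qed
  finally have p: "(1 - \<kappa> * D\<^sup>2) ^ k \<le> exp (\<kappa> - \<kappa> * C\<^sup>2 / 2 * x powr (1 - 2 * \<zeta>))" .
  have "S / dm \<le> S / D" using S D0 D by (intro divide_left_mono) auto
  also have "S / D = S / C * x powr \<zeta>" unfolding D(1) using x by (simp add: powr_minus field_simps)
  finally have q: "S / dm \<le> S / C * x powr \<zeta>" .
  let ?e = "exp (\<kappa> / 2) * exp (- (\<kappa> * C\<^sup>2 / 4) * x powr (1 - 2 * \<zeta>))"
  have e2: "?e\<^sup>2 = exp (\<kappa> - \<kappa> * C\<^sup>2 / 2 * x powr (1 - 2 * \<zeta>))"
    by (simp add: power2_eq_square exp_add[symmetric])
  have x2: "(x powr (\<zeta> / 2))\<^sup>2 = x powr \<zeta>" by (simp add: power2_eq_square powr_add[symmetric])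
  have "S / d0 * ((1 - \<kappa> * D\<^sup>2) ^ k * (S / dm)) \<le> S / d0 * (?e\<^sup>2 * (S / C * x powr \<zeta>))"
    unfolding e2 using S d0 C D0 D by (intro mult_left_mono mult_mono p q) auto
  also have "\<dots> = (S / sqrt (d0 * C) * ?e * x powr (\<zeta> / 2))\<^sup>2"
    unfolding power_mult_distrib power_divide x2 using d0 C by (simp add: power2_eq_square)
  finally have "sqrt (S / d0 * ((1 - \<kappa> * D\<^sup>2) ^ k * (S / dm))) \<le> sqrt ((S / sqrt (d0 * C) * ?e * x powr (\<zeta> / 2))\<^sup>2)"
    by (rule real_sqrt_le_mono)
  also have "\<dots> = S / sqrt (d0 * C) * ?e * x powr (\<zeta> / 2)" using S d0 C by simp
  finally show ?thesis by (simp add: mult_ac)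
qed

theorem theorem2p5:
  fixes r :: "real \<Rightarrow> real" and d c a :: "int \<Rightarrow> real"
    and \<delta> C \<zeta> :: real
  assumes r_meas: "r \<in> borel_measurable borel"
    and r_nonneg: "\<And>x. r x \<ge> 0"
    and r_bounded: "bounded (range r)"
    and r_compact_supp: "\<exists>K. \<forall>x. \<bar>x\<bar> > K \<longrightarrow> r x = 0"
    and r_int: "integral\<^sup>L lborel r = 1"
    and d_pos: "\<And>n. 0 < d n" and d_le1: "\<And>n. d n \<le> 1"
    and C_pos: "C > 0" and zeta_lt: "\<zeta> < 1/2"
    and d_lower: "\<And>n. n \<noteq> 0 \<Longrightarrow> d n \<ge> C * \<bar>real_of_int n\<bar> powr (- \<zeta>)"
    and c_bounded: "bounded (range c)"
    and a_bounded: "bounded (range a)"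
    and \<delta>_pos: "\<delta> > 0" and a_lower: "\<And>n. a n \<ge> \<delta>"
  shows "\<exists>C' > 0. \<exists>\<gamma>'' > 0. \<forall>m::int. m \<noteq> 0 \<longrightarrow>
           (\<integral>\<^sup>+ \<omega>. (SUP t::real. ennreal (cmod (evolution_entry a \<omega> t m))) \<partial>anderson_measure r d c)
           \<le> ennreal (C' * \<bar>real_of_int m\<bar> powr (\<zeta> / 2)
                       * exp (- \<gamma>'' * \<bar>real_of_int m\<bar> powr (1 - 2 * \<zeta>)))"
proof -
  obtain S0 where S0: "\<And>x. \<bar>r x\<bar> \<le> S0" using r_bounded unfolding bounded_iff by auto
  obtain K0 where K0: "\<And>x. \<bar>x\<bar> > K0 \<Longrightarrow> r x = 0" using r_compact_supp by blast
  obtain c0 where c0: "\<And>n. \<bar>c n\<bar> \<le> c0" using c_bounded unfolding bounded_iff by auto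
  obtain A where A: "\<And>n. \<bar>a n\<bar> \<le> A" using a_bounded unfolding bounded_iff by auto
  define K where "K = max K0 0"
  define b where "b = K + c0"
  have c0': "c0 \<ge> 0" using c0[of 0] by linarith
  have supp: "scaled_density r d j (y - c j) = 0" if "\<bar>y\<bar> > b" for j y
  proof -
    have "\<bar>y - c j\<bar> > K" using that c0[of j] unfolding b_def by linarith
    \<comment> \<open>Scaling by a factor of at most 1 only shrinks the support, so one bound
      \<open>b\<close> serves all sites.\<close>
    moreover have "\<bar>y - c j\<bar> \<le> \<bar>(y - c j) / d j\<bar>"
      using d_pos[of j] mult_left_le[OF d_le1[of j], of "\<bar>y - c j\<bar>"] by (simp add: abs_divide le_divide_eq)
    ultimately have "\<bar>(y - c j) / d j\<bar> > K0" unfolding K_def by linarith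
    then show ?thesis using K0 by (simp add: scaled_density_def)
  qed
  interpret anderson_model "\<lambda>j x. scaled_density r d j (x - c j)" a d S0 b A
  proof (rule anderson_model.intro)
    show "bdd_density (\<lambda>x. scaled_density r d j (x - c j)) (S0 / d j)" for j
      by (rule scaled_density_bdd_density) (use r_meas r_nonneg r_int d_pos S0 in \<open>auto simp: abs_le_iff\<close>)
    show "0 < a n" for n using a_lower[of n] \<delta>_pos by linarith
    show "a n \<le> A" for n using A[of n] by linarith
    show "0 \<le> b" unfolding b_def K_def using c0' by simp
  qed (use supp d_pos d_le1 in auto)
  have mu: "\<mu> = anderson_measure r d c"
    unfolding \<mu>_def anderson_measure_def site_measure_def ..
  have zeta: "\<zeta> \<ge> 0"
  proof (rule nonneg_of_bounded_powr[OF C_pos])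
    fix n :: nat assume "n \<noteq> 0"
    then show "C * real n powr (- \<zeta>) \<le> 1" using d_lower[of "int n"] d_le1[of "int n"] by simp
  qed
  define R where "R = 2 * A + b"
  define C' where "C' = 2 * R * (S0 / sqrt (d 0 * C) * exp (rate R / 2))"
  define \<gamma> where "\<gamma> = rate R * C\<^sup>2 / 4"
  have Rpos: "R > 0" using a_pos[of 0] a_le[of 0] b0 unfolding R_def by linarith
  have "C' > 0" unfolding C'_def using Rpos S_pos d_pos[of 0] C_pos by simp
  moreover have "\<gamma> > 0" unfolding \<gamma>_def using rate_pos C_pos by simp
  moreover have "(\<integral>\<^sup>+ \<omega>. (SUP t::real. ennreal (cmod (evolution_entry a \<omega> t m))) \<partial>anderson_measure r d c)
           \<le> ennreal (C' * \<bar>real_of_int m\<bar> powr (\<zeta> / 2) * exp (- \<gamma> * \<bar>real_of_int m\<bar> powr (1 - 2 * \<zeta>)))"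
    if m: "m \<noteq> 0" for m
  proof -
    define x where "x = \<bar>real_of_int m\<bar>"
    define D where "D = C * x powr (- \<zeta>)"
    \<comment> \<open>The number of disjoint pairs among the \<open>\<bar>m\<bar> - 1\<close> sites
      strictly between 0 and \<open>m\<close>.\<close>
    define k where "k = (nat \<bar>m\<bar> - 1) div 2"
    have x: "x > 0" unfolding x_def using m by simp
    have D0: "D > 0" unfolding D_def using C_pos x by simp
    have Dm: "D \<le> d m" unfolding D_def x_def by (rule d_lower[OF m])
    have Dj: "D \<le> d j" if "j \<noteq> 0" "\<bar>j\<bar> \<le> \<bar>m\<bar>" for j
    proof -
      have "x powr (- \<zeta>) \<le> \<bar>real_of_int j\<bar> powr (- \<zeta>)"
        by (rule powr_mono2') (use that zeta in \<open>auto simp: x_def\<close>)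
      then have "D \<le> C * \<bar>real_of_int j\<bar> powr (- \<zeta>)" unfolding D_def using C_pos by simp
      then show ?thesis using d_lower[OF that(1)] by linarith
    qed
    have D1: "D \<le> 1" using Dm d_le1[of m] by linarith
    have k1: "2 * int k < \<bar>m\<bar>" using m unfolding k_def by linarith
    have k2: "real k \<ge> x / 2 - 1"
    proof -
      have "nat \<bar>m\<bar> \<le> 2 * k + 2" unfolding k_def by linarith
      then have "\<bar>m\<bar> \<le> 2 * int k + 2" by linarith
      then have "real_of_int \<bar>m\<bar> \<le> real_of_int (2 * int k + 2)" by (rule of_int_le_iff[THEN iffD2])
      then show ?thesis unfolding x_def by simp
    qed
    have "(\<integral>\<^sup>+ \<omega>. (SUP t::real. ennreal (cmod (evolution_entry a \<omega> t m))) \<partial>anderson_measure r d c)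
      \<le> ennreal (2 * R * sqrt (S0 / d 0 * ((1 - rate R * D\<^sup>2) ^ k * (S0 / d m))))"
      unfolding mu[symmetric] R_def by (rule evolution_sup_bound[OF m D0 D1 Dj k1])
    also have "\<dots> \<le> ennreal (2 * R * (S0 / sqrt (d 0 * C) * exp (rate R / 2) * x powr (\<zeta> / 2) *
        exp (- (rate R * C\<^sup>2 / 4) * x powr (1 - 2 * \<zeta>))))"
      using Rpos
      by (intro ennreal_leI mult_left_mono decay_rate_estimate[OF S_pos d_pos C_pos x D_def Dm D1 rate_pos rate_le_1 k2]) simp
    also have "\<dots> = ennreal (C' * x powr (\<zeta> / 2) * exp (- \<gamma> * x powr (1 - 2 * \<zeta>)))"
      by (simp add: C'_def \<gamma>_def mult.assoc)
    finally show ?thesis unfolding x_def .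
  qed
  ultimately show ?thesis by blast
qed

end
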